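(* For all $b\in F(s)$, $\mathrm{ch}(b)=D(b^* )$.
   Context: Integers $n\ge1$, $\ell\ge2$, $s\ge0$. $F(s)$: set of $b=c_\ell\otimes\cdots\otimes c_1$ with $c_j\subseteq\{1,\dots,n\}$, $\sum|c_j|=s$; $\dot F(s)$: set of $d_1\otimes\cdots\otimes d_n$ with $d_i\subseteq\{1,\dots,\ell\}$, $\sum|d_i|=s$. Duality $b^*=d(1)\otimes\cdots\otimes d(n)$, $d(i)=\{j:i\in c_j\}$. Crystals: the word of $c_\ell\otimes\cdots\otimes c_1$ concatenates entries of $c_\ell$ (increasing), ..., $c_1$; that of $d_1\otimes\cdots\otimes d_n$ concatenates $d_1,\dots,d_n$; for letters $k,k+1$, encode $k$ as $+$, $k+1$ as $-$, delete adjacent $+-$ recursively; lowering changes the $k$ of the leftmost remaining $+$ into $k+1$, raising the $k+1$ of the rightmost remaining $-$ into $k$ (or $0$). This gives type $A_{n-1}$ on $F(s)$ and $A_{\ell-1}$ on $\dot F(s)$. $b$ is a tableau if $c_1,\dots,c_\ell$ placed left to right, top-aligned, form a semistandard Young tableau. $P(b)$: the unique tableau such that $b\mapsto P(b)$, restricted to the $A_{n-1}$-component of $b$, is a crystal isomorphism onto a component consisting of tableaux. $b$ has dominant evaluation if for each $k$ it has no more entries $k+1$ than $k$. Charge: cyclage $\xi(c_\ell\otimes\cdots\otimes c_1)=c_{\ell-1}\otimes\cdots\otimes c_1\otimes c_\ell$; it is authorised for $b$ if (a) $b$ has dominant evaluation and $1\notin c_\ell$, or (b) $b$ is a tableau and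 no $k$ lies in every $c_j$. If some $k$ lies in every $c_j$, with $k_0$ the least, $\mathrm{red}(b)$ deletes all $k_0$'s and replaces each $k>k_0$ by $k-1$. The charge $\mathrm{ch}$ is defined by: $\mathrm{ch}(b)=0$ if $b$ is a tableau consisting of a single (possibly empty) column, i.e. $c_\ell=\cdots=c_2=\emptyset$; for a tableau $b$, $\mathrm{ch}(\mathrm{red}(b))=\mathrm{ch}(b)$ when some letter lies in every column, and $\mathrm{ch}(b)=\mathrm{ch}(\xi(b))+|c_\ell|$ when the cyclage is authorised; and $\mathrm{ch}(b)=\mathrm{ch}(P(b))$ in general (the paper asserts that iterating reduction, cyclage and $P$ eventually reaches a column, so this recursion defines $\mathrm{ch}$). Energy on $\dot F(s)$: $B(\omega_k)$ is the crystal of columns of size $k$; $R_i$ replaces $d_i\otimes d_{i+1}$ by its image under the unique $A_{\ell-1}$-crystal isomorphism $B(\omega_{|d_i|})\otimes B(\omega_{|d_{i+1}|})\to B(\omega_{|d_{i+1}|})\otimes B(\omega_{|d_i|})$. For two columns with $|d_1|\ge|d_2|$: place $d_1$ as right column in rows $1..|d_1|$, $d_2$ as left column in rows $t+1..t+|d_2|$ with $t\ge0$ minimal such that $t+|d_2|\ge|d_1|$ and each two-cell row has left entry $\le$ right entry; $H(d_1\otimes d_2)=t+|d_2|-|d_1|$; if $|d_1|<|d_2|$, $H(d_1\otimes d_2)=H(R_1(d_1\otimes d_2))$. For $x=d_1\otimes\cdots\otimes d_n$ and $1\le i<j\le n$, $d_{i+1}^{(j)}$ is the $(i+1)$-th factor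 after applying successively $R_{j-1},\dots,R_{i+1}$ to $x$; $D(x)=\sum_{1\le i<j\le n}H(d_i\otimes d_{i+1}^{(j)})$.
   Formalization: The recursion for ch gets one extra rule: for a tableau with c_l empty, the empty c_l may be dropped without changing ch. Without it ch is undetermined, e.g. for ∅⊗{1}⊗{1} with n=1, where cyclage followed by P returns the same tableau. *)

theory Defs
  imports Main
begin

text \<open>
  A tensor product of columns is a list of finite sets of positive integers, read from left to
  right.  So \<open>c\<^sub>l \<otimes> \<dots> \<otimes> c\<^sub>1\<close> is the list \<open>[c\<^sub>l, \<dots>, c\<^sub>1]\<close>, whose head is \<open>c\<^sub>l\<close>, while
  \<open>d\<^sub>1 \<otimes> \<dots> \<otimes> d\<^sub>n\<close> is \<open>[d\<^sub>1, \<dots>, d\<^sub>n]\<close>.  With this convention both kinds of products have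
  the same reading word and the same crystal operators.
\<close>

type_synonym tensor = "nat set list"

text \<open>
  Products of \<open>r\<close> columns with letters in \<open>{1..m}\<close> and \<open>s\<close> letters in total: \<open>F(s)\<close> is
  \<open>tensors n l s\<close> and its dotted version is \<open>tensors l n s\<close>.
\<close>

definition tensors :: "nat \<Rightarrow> nat \<Rightarrow> nat \<Rightarrow> tensor set" where
  "tensors m r s =
     {b. length b = r \<and> (\<forall>c\<in>set b. c \<subseteq> {1..m}) \<and> sum_list (map card b) = s}"

text \<open>The column \<open>c\<^sub>j\<close> of \<open>c\<^sub>l \<otimes> \<dots> \<otimes> c\<^sub>1\<close>, for \<open>1 \<le> j \<le> l\<close>.\<close>

definition col :: "tensor \<Rightarrow> nat \<Rightarrow> nat set" where
  "col b j = b ! (length b - j)"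

definition dual :: "nat \<Rightarrow> tensor \<Rightarrow> tensor" where
  "dual n b = map (\<lambda>i. {j \<in> {1..length b}. i \<in> col b j}) [1..<n + 1]"


section \<open>Crystals\<close>

text \<open>Each letter of the word is paired with the position in the list of the factor it comes from.\<close>

definition word :: "tensor \<Rightarrow> (nat \<times> nat) list" where
  "word b = concat (map (\<lambda>i. map (\<lambda>a. (a, i)) (sorted_list_of_set (b ! i))) [0..<length b])"

text \<open>
  Deletion of adjacent pairs \<open>+-\<close>, that is of a letter \<open>k\<close> directly followed by \<open>k + 1\<close>, until
  none is left, in a word with letters \<open>k\<close> and \<open>k + 1\<close>.
\<close>

fun cancel :: "nat \<Rightarrow> (nat \<times> nat) list \<Rightarrow> (nat \<times> nat) list" where
  "cancel k [] = []"
| "cancel k (x # xs) =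
     (case cancel k xs of
        [] \<Rightarrow> [x]
      | y # ys \<Rightarrow> if fst x = k \<and> fst y = k + 1 then ys else x # y # ys)"

definition signature :: "nat \<Rightarrow> tensor \<Rightarrow> (nat \<times> nat) list" where
  "signature k b = cancel k (filter (\<lambda>x. fst x = k \<or> fst x = k + 1) (word b))"

definition lower :: "nat \<Rightarrow> tensor \<Rightarrow> tensor option" where
  "lower k b =
     (case filter (\<lambda>x. fst x = k) (signature k b) of
        [] \<Rightarrow> None
      | (_, i) # _ \<Rightarrow> Some (b[i := insert (k + 1) (b ! i - {k})]))"

definition raise :: "nat \<Rightarrow> tensor \<Rightarrow> tensor option" where
  "raise k b =
     (case rev (filter (\<lambda>x. fst x = k + 1) (signature k b)) of
        [] \<Rightarrow> None
      | (_, i) # _ \<Rightarrow> Some (b[i := insert k (b ! i - {k + 1})]))"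

text \<open>In what follows \<open>m\<close> is the number of letters, so the crystals have type \<open>A\<^bsub>m-1\<^esub>\<close>.\<close>

definition component :: "nat \<Rightarrow> tensor \<Rightarrow> tensor set" where
  "component m b =
     {(x, y). \<exists>k\<in>{1..<m}. lower k x = Some y \<or> raise k x = Some y}\<^sup>* `` {b}"

definition crystal_iso ::
  "nat \<Rightarrow> (tensor \<Rightarrow> tensor) \<Rightarrow> tensor set \<Rightarrow> tensor set \<Rightarrow> bool" where
  "crystal_iso m \<phi> A B \<longleftrightarrow>
     bij_betw \<phi> A B \<and>
     (\<forall>x\<in>A. \<forall>k\<in>{1..<m}.
        map_option \<phi> (lower k x) = lower k (\<phi> x) \<and>
        map_option \<phi> (raise k x) = raise k (\<phi> x))"


section \<open>Tableaux\<close>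

definition is_tableau :: "tensor \<Rightarrow> bool" where
  "is_tableau b \<longleftrightarrow>
     (\<forall>j\<in>{1..<length b}.
        card (col b (j + 1)) \<le> card (col b j) \<and>
        (\<forall>r < card (col b (j + 1)).
           sorted_list_of_set (col b j) ! r \<le> sorted_list_of_set (col b (j + 1)) ! r))"

text \<open>
  The target component is taken inside the same \<open>F(s)\<close> as \<open>b\<close>.  This matters for uniqueness: as
  crystals of type \<open>A\<^bsub>n-1\<^esub>\<close>, components do not see columns of size \<open>n\<close>.
\<close>

definition P :: "nat \<Rightarrow> tensor \<Rightarrow> tensor" where
  "P n b =
     (THE t. t \<in> tensors n (length b) (sum_list (map card b)) \<and>
        (\<forall>x\<in>component n t. is_tableau x) \<and>
        (\<exists>\<phi>. crystal_iso n \<phi> (component n b) (component n t) \<and> \<phi> b = t))"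


section \<open>Charge\<close>

definition mult :: "nat \<Rightarrow> tensor \<Rightarrow> nat" where
  "mult k b = length (filter (\<lambda>c. k \<in> c) b)"

definition dominant_evaluation :: "tensor \<Rightarrow> bool" where
  "dominant_evaluation b \<longleftrightarrow> (\<forall>k\<ge>1. mult (k + 1) b \<le> mult k b)"

definition in_every_column :: "nat \<Rightarrow> tensor \<Rightarrow> bool" where
  "in_every_column k b \<longleftrightarrow> (\<forall>c\<in>set b. k \<in> c)"

definition cyclage :: "tensor \<Rightarrow> tensor" where
  "cyclage b = tl b @ [hd b]"

definition authorised :: "tensor \<Rightarrow> bool" where
  "authorised b \<longleftrightarrow>
     dominant_evaluation b \<and> 1 \<notin> hd b \<or>
     is_tableau b \<and> \<not> (\<exists>k. in_every_column k b)"

definition red :: "tensor \<Rightarrow> tensor" where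
  "red b =
     (let k0 = (LEAST k. in_every_column k b)
      in map (\<lambda>c. (\<lambda>k. if k > k0 then k - 1 else k) ` (c - {k0})) b)"

text \<open>
  \<open>charge_rel n b m\<close> says that the recursion computes the value \<open>m\<close> as the charge of \<open>b\<close>.

  The rule \<open>drop\<close> expresses that only the nonempty \<open>c\<^sub>j\<close> are columns of a tableau: an empty
  \<open>c\<^sub>l\<close> is padding.  Without it the recursion does not terminate on a tableau with \<open>c\<^sub>l\<close> empty and
  at least two nonempty columns, because then no letter lies in every \<open>c\<^sub>j\<close> and \<open>P\<close> takes the
  cyclage of \<open>b\<close> back to \<open>b\<close>; the first example is \<open>\<emptyset> \<otimes> {1} \<otimes> {1}\<close>.
\<close>

inductive charge_rel :: "nat \<Rightarrow> tensor \<Rightarrow> nat \<Rightarrow> bool" for n :: nat where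
  column: "is_tableau b \<Longrightarrow> \<forall>j\<in>{2..length b}. col b j = {} \<Longrightarrow> charge_rel n b 0"
| red: "is_tableau b \<Longrightarrow> \<exists>k. in_every_column k b \<Longrightarrow> charge_rel n (red b) m
    \<Longrightarrow> charge_rel n b m"
| cyclage: "is_tableau b \<Longrightarrow> authorised b \<Longrightarrow> charge_rel n (cyclage b) m
    \<Longrightarrow> charge_rel n b (m + card (hd b))"
| P: "charge_rel n (P n b) m \<Longrightarrow> charge_rel n b m"
| drop: "is_tableau ({} # b) \<Longrightarrow> b \<noteq> [] \<Longrightarrow> charge_rel n b m \<Longrightarrow> charge_rel n ({} # b) m"

definition charge :: "nat \<Rightarrow> tensor \<Rightarrow> nat" where
  "charge n b = (THE m. charge_rel n b m)"


section \<open>Energy\<close>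

text \<open>\<open>B(\<omega>\<^bsub>k\<^esub>) \<otimes> B(\<omega>\<^bsub>k'\<^esub>)\<close> with letters in \<open>{1..l}\<close>.\<close>

definition column_product :: "nat \<Rightarrow> nat \<Rightarrow> nat \<Rightarrow> tensor set" where
  "column_product l k k' =
     {[d, d'] | d d'. d \<subseteq> {1..l} \<and> card d = k \<and> d' \<subseteq> {1..l} \<and> card d' = k'}"

definition R2 :: "nat \<Rightarrow> nat set \<Rightarrow> nat set \<Rightarrow> tensor" where
  "R2 l d d' =
     (THE y. \<exists>\<phi>. crystal_iso l \<phi> (column_product l (card d) (card d'))
                                (column_product l (card d') (card d)) \<and> y = \<phi> [d, d'])"

text \<open>The factor \<open>d\<^sub>i\<close> of \<open>x = d\<^sub>1 \<otimes> \<dots> \<otimes> d\<^sub>n\<close> is \<open>x ! (i - 1)\<close>.\<close>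

definition R :: "nat \<Rightarrow> nat \<Rightarrow> tensor \<Rightarrow> tensor" where
  "R l i x = take (i - 1) x @ R2 l (x ! (i - 1)) (x ! i) @ drop (i + 1) x"

text \<open>
  For \<open>card d' \<le> card d\<close>: the column \<open>d\<close> fills the rows \<open>1, \<dots>, card d\<close> on the right and \<open>d'\<close> the
  rows \<open>t + 1, \<dots>, t + card d'\<close> on the left.
\<close>

definition admissible_shift :: "nat set \<Rightarrow> nat set \<Rightarrow> nat \<Rightarrow> bool" where
  "admissible_shift d d' t \<longleftrightarrow>
     card d \<le> t + card d' \<and>
     (\<forall>r\<in>{1..card d} \<inter> {t + 1..t + card d'}.
        sorted_list_of_set d' ! (r - t - 1) \<le> sorted_list_of_set d ! (r - 1))"

definition H_large :: "nat set \<Rightarrow> nat set \<Rightarrow> nat" where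
  "H_large d d' = (LEAST t. admissible_shift d d' t) + card d' - card d"

definition H :: "nat \<Rightarrow> nat set \<Rightarrow> nat set \<Rightarrow> nat" where
  "H l d d' =
     (if card d' \<le> card d then H_large d d'
      else H_large (R2 l d d' ! 0) (R2 l d d' ! 1))"

text \<open>The factor at place \<open>i + 1\<close> after applying first \<open>R\<^bsub>j-1\<^esub>\<close>, and so on, and last \<open>R\<^bsub>i+1\<^esub>\<close>.\<close>

definition moved :: "nat \<Rightarrow> tensor \<Rightarrow> nat \<Rightarrow> nat \<Rightarrow> nat set" where
  "moved l x i j = fold (R l) (rev [i + 1..<j]) x ! i"

definition energy :: "nat \<Rightarrow> tensor \<Rightarrow> nat" where
  "energy l x =
     (\<Sum>(i, j) | 1 \<le> i \<and> i < j \<and> j \<le> length x. H l (x ! (i - 1)) (moved l x i j))"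

end

theory Submission
  imports Defs
begin

text \<open>
  The crystal operators act on words in \<open>\<plusminus>\<close> through their partial sums, here called heights:
  \<open>lower k\<close> acts just after the last maximum of the heights, \<open>raise k\<close> just before the first one.
  Reading \<open>b\<close> as a 0-1 matrix, the operators of type \<open>A\<^bsub>l-1\<^esub>\<close> on \<open>b\<^sup>*\<close> become operators \<open>cstep\<close> that
  move a letter of \<open>b\<close> to the neighbouring column, and a case analysis on \<open>2 \<times> 2\<close> blocks shows
  that they commute with the operators of type \<open>A\<^bsub>n-1\<^esub>\<close>.  Hence \<open>b\<close> is a tableau iff \<open>b\<^sup>*\<close> is of
  highest weight, \<open>P(b)\<^sup>*\<close> is the highest weight element of the component of \<open>b\<^sup>*\<close>, and \<open>R\<^sub>i\<close> is the
  reflection of the strings of the \<open>i\<close>-th operator on the other side.  So \<open>D\<close> is constant on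
  components, that is, \<open>D(P(b)\<^sup>*) = D(b\<^sup>*)\<close>.

  The cyclage becomes the rotation \<open>j \<mapsto> j + 1\<close> modulo \<open>l\<close> of the letters of \<open>b\<^sup>*\<close>.  It commutes with
  the \<open>R\<^sub>i\<close>, and it changes \<open>H(d \<otimes> d')\<close> by the difference of the indicators of \<open>l \<in> d'\<close> and
  \<open>l \<in> e\<close>, where \<open>R(d \<otimes> d') = e \<otimes> e'\<close>.  In \<open>D\<close> these differences telescope, and what remains
  besides \<open>|c\<^sub>l|\<close> vanishes for a tableau without full rows, because the first factor of a highest
  weight element is an initial segment.  Full columns of \<open>b\<^sup>*\<close> contribute nothing to \<open>D\<close>, which
  handles reduction.  Finally \<open>D\<close> strictly decreases along cyclages, so the recursion for the charge
  terminates.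
\<close>

text \<open>\<open>P\<close> and \<open>R2\<close> are given by definite descriptions, so besides
  exhibiting an isomorphism one has to exclude every other candidate. One argument,
  \<open>bisim_unique\<close>, serves both: two related candidates are raised in parallel until they
  are of highest weight and are compared there. Within the tableaux of a fixed \<open>F(s)\<close>,
  and within a product of two columns, the string lengths \<open>phi\<close> determine a highest
  weight element.

  \<open>charge_rel\<close> is nondeterministic, as its rules overlap. Confluence is replaced by an
  invariant: each rule alters the energy of the dual by exactly what it adds to the value, so all
  derivations agree, and only the existence of a derivation requires a termination argument.

  The closed form \<open>H_eq\<close> makes the local energy tractable: \<open>H\<close> is the
  distance from a pair of columns to the nearer end of its string under \<open>cstep\<close>. Its
  invariance under reflection and its change under rotation are read off from this form.\<close>

section \<open>Heights\<close>

text \<open>The \<open>N + 1\<close> partial sums of \<open>N\<close> steps are compared. Lowering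
  changes the step out of the last maximum, so \<open>q = N\<close> encodes that lowering is
  undefined; likewise \<open>q = 0\<close> in \<open>is_first\<close> for raising.\<close>

definition is_last :: "(nat \<Rightarrow> int) \<Rightarrow> nat \<Rightarrow> nat \<Rightarrow> bool" where
  "is_last g N q \<longleftrightarrow> q \<le> N \<and> (\<forall>r\<le>N. g r \<le> g q) \<and> (\<forall>r\<le>N. q < r \<longrightarrow> g r < g q)"

definition is_first :: "(nat \<Rightarrow> int) \<Rightarrow> nat \<Rightarrow> nat \<Rightarrow> bool" where
  "is_first g N q \<longleftrightarrow> q \<le> N \<and> (\<forall>r\<le>N. g r \<le> g q) \<and> (\<forall>r<q. g r < g q)"

definition mx :: "(nat \<Rightarrow> int) \<Rightarrow> nat \<Rightarrow> int" where
  "mx g N = Max (g ` {..N})"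

lemma mx_ge: "r \<le> N \<Longrightarrow> g r \<le> mx g N"
  unfolding mx_def by (rule Max_ge) auto

lemma mx_attained: "\<exists>r\<le>N. mx g N = g r"
proof -
  have "mx g N \<in> g ` {..N}" unfolding mx_def by (rule Max_in) auto
  then show ?thesis by auto
qed

lemma mx_le_iff: "mx g N \<le> c \<longleftrightarrow> (\<forall>r\<le>N. g r \<le> c)"
  unfolding mx_def by (subst Max_le_iff) auto

lemma mx_eqI: "q \<le> N \<Longrightarrow> (\<And>r. r \<le> N \<Longrightarrow> g r \<le> g q) \<Longrightarrow> mx g N = g q"
  by (simp add: antisym mx_ge mx_le_iff)

lemma mx_cong: "(\<And>r. r \<le> N \<Longrightarrow> g r = g' r) \<Longrightarrow> mx g N = mx g' N"
  unfolding mx_def by (metis (no_types, lifting) atMost_iff image_cong)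

lemma is_last_cong: "(\<And>r. r \<le> N \<Longrightarrow> g r = g' r) \<Longrightarrow> is_last g N q = is_last g' N q"
  unfolding is_last_def by (smt (verit) order.trans)

lemma is_last_mx: "is_last g N q \<Longrightarrow> mx g N = g q"
  unfolding is_last_def by (blast intro: mx_eqI)

lemma is_first_mx: "is_first g N q \<Longrightarrow> mx g N = g q"
  unfolding is_first_def by (blast intro: mx_eqI)

lemma is_last_unique: "is_last g N q \<Longrightarrow> is_last g N q' \<Longrightarrow> q = q'"
  unfolding is_last_def by (meson linorder_neqE_nat not_le order.strict_iff_not)

lemma is_first_unique: "is_first g N q \<Longrightarrow> is_first g N q' \<Longrightarrow> q = q'"
  unfolding is_first_def by (meson linorder_neqE_nat not_le order.strict_iff_not)

lemma is_last_exists: "\<exists>q. is_last g N q"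
proof -
  let ?P = "\<lambda>q. q \<le> N \<and> g q = mx g N"
  obtain r where r: "?P r" using mx_attained by metis
  let ?q = "Greatest ?P"
  have *: "?P ?q" using r by (rule GreatestI_nat[where P = ?P and b = N]) auto
  have "\<And>r. ?P r \<Longrightarrow> r \<le> ?q" by (rule Greatest_le_nat[where P = ?P and b = N]) auto
  then have "is_last g N ?q" using * mx_ge[of _ N g] unfolding is_last_def
    by (smt (verit, best) not_le)
  then show ?thesis ..
qed

lemma is_first_exists: "\<exists>q. is_first g N q"
proof -
  let ?P = "\<lambda>q. q \<le> N \<and> g q = mx g N"
  obtain r where r: "?P r" using mx_attained by metis
  let ?q = "Least ?P"
  have *: "?P ?q" using r by (rule LeastI)
  have "\<And>r. ?P r \<Longrightarrow> ?q \<le> r" by (rule Least_le)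
  then have "is_first g N ?q" using * mx_ge[of _ N g] unfolding is_first_def
    by (smt (verit, best) not_le le_trans less_imp_le)
  then show ?thesis ..
qed

lemma is_last_end_iff: "is_last g N N \<longleftrightarrow> mx g N = g N"
  unfolding is_last_def using mx_ge[of _ N g] mx_eqI[of N N g] by fastforce

lemma is_first_0_iff: "is_first g N 0 \<longleftrightarrow> mx g N = g 0"
  unfolding is_first_def using mx_ge[of _ N g] mx_eqI[of 0 N g] by fastforce

text \<open>All heights after \<open>q\<close> were strictly below the maximum, so after the shift
  by 2 they reach at most the new value at \<open>Suc q\<close>, which no earlier height attains.
  This is why raising undoes lowering; \<open>is_last_bump\<close> is the converse.\<close>

lemma is_first_bump:
  assumes "is_last g N q" "q < N" "\<And>r. r \<le> N \<Longrightarrow> g' r = g r + (if q < r then 2 else 0)"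
    "g (Suc q) = g q - 1"
  shows "is_first g' N (Suc q)"
  unfolding is_first_def
proof (intro conjI allI impI)
  show "Suc q \<le> N" using assms by auto
  fix r
  show "r \<le> N \<Longrightarrow> g' r \<le> g' (Suc q)"
    using assms(1,2,3)[unfolded is_last_def] assms(4) by (smt (verit) Suc_leI lessI)
  show "r < Suc q \<Longrightarrow> g' r < g' (Suc q)"
    using assms(1,2,3)[unfolded is_last_def] assms(4)
    by (smt (verit) Suc_leI lessI less_Suc_eq_le order.trans less_imp_le not_le)
qed

lemma is_last_bump:
  assumes "is_first g N (Suc q)" "\<And>r. r \<le> N \<Longrightarrow> g' r = g r - (if q < r then 2 else 0)"
    "g (Suc q) = g q + 1"
  shows "is_last g' N q"
  unfolding is_last_def
proof (intro conjI allI impI)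
  show q: "q \<le> N" using assms(1) by (auto simp: is_first_def)
  fix r
  have a: "\<And>r. r \<le> N \<Longrightarrow> g r \<le> g q + 1" "\<And>r. r \<le> q \<Longrightarrow> g r \<le> g q"
    using assms(1,3) unfolding is_first_def by (auto simp: less_Suc_eq_le)
  show "r \<le> N \<Longrightarrow> g' r \<le> g' q"
    using a(1)[of r] a(2)[of r] assms(2)[of r] assms(2)[of q] q by (cases "q < r") auto
  show "r \<le> N \<Longrightarrow> q < r \<Longrightarrow> g' r < g' q"
    using a(1)[of r] assms(2)[of r] assms(2)[of q] q by auto
qed

text \<open>This lemma and the next three prepend one step to a path. In a tie between the start and
  the rest, the last maximum lies in the rest and the first one at the start, whence the different
  strictness of the hypotheses.\<close>

lemma is_last_Suc:
  assumes "is_last g N q" "\<And>r. r \<le> N \<Longrightarrow> g' (Suc r) = c + g r" "g' 0 \<le> c + g q"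
  shows "is_last g' (Suc N) (Suc q)"
  unfolding is_last_def
proof (intro conjI allI impI)
  show "Suc q \<le> Suc N" using assms(1) by (auto simp: is_last_def)
  fix r
  show "r \<le> Suc N \<Longrightarrow> g' r \<le> g' (Suc q)"
    using assms by (cases r) (auto simp: is_last_def)
  show "r \<le> Suc N \<Longrightarrow> Suc q < r \<Longrightarrow> g' r < g' (Suc q)"
    using assms by (cases r) (auto simp: is_last_def)
qed

lemma is_last_Suc_0:
  assumes "is_last g N q" "\<And>r. r \<le> N \<Longrightarrow> g' (Suc r) = c + g r" "g' 0 > c + g q"
  shows "is_last g' (Suc N) 0"
  unfolding is_last_def
proof (intro conjI allI impI)
  fix r
  show "r \<le> Suc N \<Longrightarrow> 0 < r \<Longrightarrow> g' r < g' 0"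
    using assms by (cases r) (force simp: is_last_def)+
  then show "r \<le> Suc N \<Longrightarrow> g' r \<le> g' 0" by (cases r) auto
qed auto

lemma is_first_Suc:
  assumes "is_first g N q" "\<And>r. r \<le> N \<Longrightarrow> g' (Suc r) = c + g r" "g' 0 < c + g q"
  shows "is_first g' (Suc N) (Suc q)"
  unfolding is_first_def
proof (intro conjI allI impI)
  show "Suc q \<le> Suc N" using assms(1) by (auto simp: is_first_def)
  fix r
  show "r \<le> Suc N \<Longrightarrow> g' r \<le> g' (Suc q)"
    using assms by (cases r) (auto simp: is_first_def)
  show "r < Suc q \<Longrightarrow> g' r < g' (Suc q)"
    using assms by (cases r) (auto simp: is_first_def)
qed

lemma is_first_Suc_0:
  assumes "is_first g N q" "\<And>r. r \<le> N \<Longrightarrow> g' (Suc r) = c + g r" "g' 0 \<ge> c + g q"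
  shows "is_first g' (Suc N) 0"
  unfolding is_first_def
proof (intro conjI allI impI)
  fix r
  show "r \<le> Suc N \<Longrightarrow> g' r \<le> g' 0"
    using assms by (cases r) (force simp: is_first_def)+
qed auto

text \<open>
  \<open>A i p\<close> says that the letter \<open>i\<close> occurs in the factor at index \<open>p\<close> of the list \<open>b\<close>.  Then \<open>rh A k\<close>
  are the heights of the word of \<open>b\<close> in the letters \<open>k\<close> and \<open>k + 1\<close>, and \<open>ch A p\<close> those of the word of
  \<open>b\<^sup>*\<close> in the letters \<open>l - p - 1\<close> and \<open>l - p\<close>.
\<close>

definition rh :: "(nat \<Rightarrow> nat \<Rightarrow> bool) \<Rightarrow> nat \<Rightarrow> nat \<Rightarrow> int" where
  "rh A k q = (\<Sum>p<q. of_bool (A (Suc k) p) - of_bool (A k p))"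

definition ch :: "(nat \<Rightarrow> nat \<Rightarrow> bool) \<Rightarrow> nat \<Rightarrow> nat \<Rightarrow> int" where
  "ch A p i = (\<Sum>t<i. of_bool (A (Suc t) p) - of_bool (A (Suc t) (Suc p)))"

lemma rh_0 [simp]: "rh A k 0 = 0" and ch_0 [simp]: "ch A p 0 = 0"
  by (simp_all add: rh_def ch_def)

lemma rh_Suc: "rh A k (Suc q) = rh A k q + (of_bool (A (Suc k) q) - of_bool (A k q))"
  by (simp add: rh_def)

lemma ch_Suc: "ch A p (Suc i) = ch A p i + (of_bool (A (Suc i) p) - of_bool (A (Suc i) (Suc p)))"
  by (simp add: ch_def)

section \<open>Row and column moves commute\<close>

definition rmove :: "(nat \<Rightarrow> nat \<Rightarrow> bool) \<Rightarrow> nat \<Rightarrow> nat \<Rightarrow> nat \<Rightarrow> nat \<Rightarrow> bool" where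
  "rmove A k q = (\<lambda>i p. if p = q \<and> i = k then False else if p = q \<and> i = Suc k then True else A i p)"

text \<open>\<open>i\<close> is a height position, so the letter concerned is \<open>Suc i\<close>.
  It moves towards the head of the list, that is, to the column with the larger label.\<close>

definition cmove :: "(nat \<Rightarrow> nat \<Rightarrow> bool) \<Rightarrow> nat \<Rightarrow> nat \<Rightarrow> nat \<Rightarrow> nat \<Rightarrow> bool" where
  "cmove A p i = (\<lambda>r s. if r = Suc i \<and> s = p then True else if r = Suc i \<and> s = Suc p then False else A r s)"

lemma rh_last_step:
  assumes "is_last (rh A k) N q" "q < N" shows "A k q" "\<not> A (Suc k) q"
proof -
  have "rh A k (Suc q) < rh A k q" using assms by (auto simp: is_last_def)
  then show "A k q" "\<not> A (Suc k) q" by (auto simp: rh_Suc split: if_splits)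
qed

lemma ch_last_step:
  assumes "is_last (ch A p) m i" "i < m" shows "A (Suc i) (Suc p)" "\<not> A (Suc i) p"
proof -
  have "ch A p (Suc i) < ch A p i" using assms by (auto simp: is_last_def)
  then show "A (Suc i) (Suc p)" "\<not> A (Suc i) p" by (auto simp: ch_Suc split: if_splits)
qed

lemma rh_first_step:
  assumes "is_first (rh A k) N (Suc q)" shows "A (Suc k) q" "\<not> A k q"
proof -
  have "rh A k (Suc q) > rh A k q" using assms by (auto simp: is_first_def)
  then show "A (Suc k) q" "\<not> A k q" by (auto simp: rh_Suc split: if_splits)
qed

lemma ch_first_step:
  assumes "is_first (ch A p) m (Suc i)" shows "A (Suc i) p" "\<not> A (Suc i) (Suc p)"
proof -
  have "ch A p (Suc i) > ch A p i" using assms by (auto simp: is_first_def)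
  then show "A (Suc i) p" "\<not> A (Suc i) (Suc p)" by (auto simp: ch_Suc split: if_splits)
qed

text \<open>The letter passes between neighbouring columns, so only the partial sum taken between
  the two can change. Letter \<open>Suc i\<close> counts positively for \<open>k = i\<close> and
  negatively for \<open>k = Suc i\<close>.\<close>

lemma rh_cmove:
  assumes "A (Suc i) (Suc p)" "\<not> A (Suc i) p"
  shows "rh (cmove A p i) k q = rh A k q +
    (if q = Suc p then of_bool (k = i) - of_bool (k = Suc i) else 0)"
proof (induction q)
  case (Suc q)
  then show ?case using assms
    by (cases "k = i"; cases "k = Suc i") (auto simp: rh_Suc cmove_def)
qed simp

text \<open>Turning \<open>k\<close> into \<open>Suc k\<close> affects only the count of the letters
  up to \<open>k\<close>.\<close>

lemma ch_rmove:
  assumes "A k q" "\<not> A (Suc k) q" "1 \<le> k"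
  shows "ch (rmove A k q) p i = ch A p i +
    (if i = k then of_bool (q = Suc p) - of_bool (q = p) else 0)"
proof (induction i)
  case 0 then show ?case using assms by auto
next
  case (Suc i)
  then show ?case using assms
    by (cases "q = p"; cases "q = Suc p") (auto simp: ch_Suc rmove_def)
qed

lemma rh_rmove:
  assumes "A k q" "\<not> A (Suc k) q"
  shows "rh (rmove A k q) k r = rh A k r + (if q < r then 2 else 0)"
  using assms by (induction r) (auto simp: rh_Suc rmove_def less_Suc_eq)

lemma ch_cmove:
  assumes "A (Suc i) (Suc p)" "\<not> A (Suc i) p"
  shows "ch (cmove A p i) p r = ch A p r + (if i < r then 2 else 0)"
  using assms by (induction r) (auto simp: ch_Suc cmove_def less_Suc_eq)

text \<open>At the point of change neither function exceeds one of its other values, so both maxima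
  are attained where the functions agree.\<close>

lemma mx_point_change:
  assumes "\<And>r. r \<noteq> c \<Longrightarrow> g' r = g r" "c' \<le> N" "c' \<noteq> c" "g c \<le> g c'"
    "c'' \<le> N" "c'' \<noteq> c" "g' c \<le> g' c''"
  shows "mx g' N = mx g N"
proof (rule antisym)
  show "mx g' N \<le> mx g N" unfolding mx_le_iff
    using assms by (metis mx_ge order.trans)
  show "mx g N \<le> mx g' N" unfolding mx_le_iff
    using assms by (metis mx_ge order.trans)
qed

text \<open>Only the height at \<open>Suc p\<close> can change. That \<open>i\<close> is the last
  maximum of the column heights excludes one pattern in the other row of the 2 x 2 block, and then
  the height at \<open>p\<close> or at \<open>Suc (Suc p)\<close> dominates before and after the
  move.\<close>

lemma mx_rh_cmove:
  assumes l: "is_last (ch A p) m i" "i < m" and "Suc p < N" "k < m" "1 \<le> k"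
  shows "mx (rh (cmove A p i) k) N = mx (rh A k) N"
proof -
  note s = ch_last_step[OF l]
  note h = rh_cmove[of A i p, OF s]
  consider "k \<noteq> i" "k \<noteq> Suc i" | "k = i" | "k = Suc i" by blast
  then show ?thesis
  proof cases
    case 1
    then show ?thesis by (auto intro!: mx_cong simp: h)
  next
    case 2
    obtain k' where k': "k = Suc k'" using \<open>1 \<le> k\<close> by (cases k) auto
    have "ch A p k' \<le> ch A p k"
      using l k' 2 by (auto simp: is_last_def)
    then have "A k (Suc p) \<longrightarrow> A k p" using k' by (auto simp: ch_Suc)
    then show ?thesis using s 2 assms(3)
      by (intro mx_point_change[where c = "Suc p" and c' = p
          and c'' = "if A k p then p else Suc (Suc p)"])
        (auto simp: h rh_Suc[of A])
  next
    case 3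
    have "ch A p (Suc k) < ch A p i"
      using l 3 \<open>k < m\<close> by (auto simp: is_last_def)
    then have "A (Suc k) p \<longrightarrow> A (Suc k) (Suc p)" using 3 s by (auto simp: ch_Suc)
    then show ?thesis using s 3 assms(3)
      by (intro mx_point_change[where c = "Suc p"
          and c' = "if A (Suc k) (Suc p) then Suc (Suc p) else p"
          and c'' = "if A (Suc k) (Suc p) then Suc (Suc p) else p"])
        (auto simp: h rh_Suc[of A])
  qed
qed

text \<open>The argument for \<open>mx_rh_cmove\<close> with rows and columns exchanged;
  \<open>k'\<close> is the height position just below \<open>k\<close>.\<close>

lemma mx_ch_rmove:
  assumes l: "is_last (rh A k) N q" "q < N" and "Suc p < N" "k < m" "1 \<le> k"
  shows "mx (ch (rmove A k q) p) m = mx (ch A p) m"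
proof -
  note s = rh_last_step[OF l]
  note h = ch_rmove[of A k q, OF s \<open>1 \<le> k\<close>]
  obtain k' where k': "k = Suc k'" using \<open>1 \<le> k\<close> by (cases k) auto
  have kk: "ch A p k = ch A p k' + (of_bool (A k p) - of_bool (A k (Suc p)))" "k' \<noteq> k" "k' < m"
    using k' assms(4) by (auto simp: ch_Suc)
  consider "q \<noteq> p" "q \<noteq> Suc p" | "q = p" | "q = Suc p" by blast
  then show ?thesis
  proof cases
    case 1
    then show ?thesis by (auto intro!: mx_cong simp: h)
  next
    case 3
    have "rh A k p \<le> rh A k q"
      using l 3 by (auto simp: is_last_def)
    then have "A k p \<longrightarrow> A (Suc k) p" using 3 by (auto simp: rh_Suc)
    then show ?thesis using s 3 assms(3,4) kk
      by (intro mx_point_change[where c = k and c' = "if A k p then Suc k else k'"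
          and c'' = "if A k p then Suc k else k'"])
        (auto simp: h[unfolded 3] ch_Suc[of A])
  next
    case 2
    have "rh A k (Suc (Suc p)) < rh A k p"
      using l 2 \<open>Suc p < N\<close> by (auto simp: is_last_def)
    then have "A (Suc k) (Suc p) \<longrightarrow> A k (Suc p)" using 2 s by (auto simp: rh_Suc)
    then show ?thesis using s 2 assms(3,4) kk
      by (intro mx_point_change[where c = k
          and c' = "if A k (Suc p) then k' else Suc k"
          and c'' = "if A k (Suc p) then k' else Suc k"])
        (auto simp: h[unfolded 2] ch_Suc[of A])
  qed
qed

lemma is_last_point_change:
  assumes "is_last g N q" "\<And>r. r \<noteq> c \<Longrightarrow> g' r = g r" "mx g' N = mx g N" "q \<noteq> c"
    "c \<le> N \<Longrightarrow> q < c \<Longrightarrow> g' c < g q"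
  shows "is_last g' N q"
  using assms is_last_mx[OF assms(1)] unfolding is_last_def by (metis mx_ge)

lemma rmove_cmove_apart:
  assumes "k \<noteq> i \<and> k \<noteq> Suc i \<or> q \<noteq> p \<and> q \<noteq> Suc p"
  shows "rmove (cmove A p i) k q = cmove (rmove A k q) p i"
proof (intro ext)
  fix r s
  consider "r = Suc i" "s = p \<or> s = Suc p" | "\<not> (r = Suc i \<and> (s = p \<or> s = Suc p))" by blast
  then show "rmove (cmove A p i) k q r s = cmove (rmove A k q) p i r s"
  proof cases
    case 1
    then have "\<not> (s = q \<and> r = k)" "\<not> (s = q \<and> r = Suc k)" using assms by auto
    then show ?thesis using 1(2) unfolding rmove_def cmove_def 1(1)[symmetric] by (simp only: if_False)
  next
    case 2
    then have "\<not> (r = Suc i \<and> s = p)" "\<not> (r = Suc i \<and> s = Suc p)" by auto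
    then show ?thesis by (simp only: rmove_def cmove_def if_False)
  qed
qed

text \<open>A 2 x 2 block with a single entry, which travels to the opposite corner along either
  side.\<close>

lemma rmove_cmove_one:
  assumes "A k (Suc p)" "\<not> A k p" "\<not> A (Suc k) (Suc p)" "\<not> A (Suc k) p" "k = Suc i"
  shows "rmove (cmove A p i) k p = cmove (rmove A k (Suc p)) p k"
proof (intro ext)
  fix r s
  show "rmove (cmove A p i) k p r s = cmove (rmove A k (Suc p)) p k r s"
    using assms by (cases "r = k"; cases "r = Suc k"; cases "s = p"; cases "s = Suc p")
      (simp_all add: rmove_def cmove_def)
qed

text \<open>A 2 x 2 block with a single hole, which travels to the opposite corner along either
  side; the entries move the other way.\<close>

lemma rmove_cmove_three:
  assumes "A k (Suc p)" "A k p" "A (Suc k) (Suc p)" "\<not> A (Suc k) p" "k = Suc i"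
  shows "rmove (cmove A p k) k (Suc p) = cmove (rmove A k p) p i"
proof (intro ext)
  fix r s
  show "rmove (cmove A p k) k (Suc p) r s = cmove (rmove A k p) p i r s"
    using assms by (cases "r = k"; cases "r = Suc k"; cases "s = p"; cases "s = Suc p")
      (simp_all add: rmove_def cmove_def)
qed

text \<open>Unless the moves meet in the block of rows \<open>k\<close>, \<open>Suc k\<close> and
  columns \<open>p\<close>, \<open>Suc p\<close>, both keep their positions, since the one height
  that may change does not disturb the last maximum. If they meet, the maximality conditions leave
  exactly one entry or exactly one hole in the block, and whichever move comes second acts in the
  other column or row.\<close>

lemma commute_row_col:
  assumes r: "is_last (rh A k) N q" "q < N" and c: "is_last (ch A p) m i" "i < m"
    and bd: "Suc p < N" "k < m" "1 \<le> k"
  shows "\<exists>q'<N. \<exists>i'<m. is_last (rh (cmove A p i) k) N q' \<and> is_last (ch (rmove A k q) p) m i' \<and>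
    rmove (cmove A p i) k q' = cmove (rmove A k q) p i'"
proof -
  note rs = rh_last_step[OF r] and cs = ch_last_step[OF c]
  define A1 where "A1 = cmove A p i"
  define A2 where "A2 = rmove A k q"
  have rhc: "rh A1 k x = rh A k x + (if x = Suc p then of_bool (k = i) - of_bool (k = Suc i) else 0)" for x
    unfolding A1_def using cs by (rule rh_cmove)
  have chr: "ch A2 p x = ch A p x + (if x = k then of_bool (q = Suc p) - of_bool (q = p) else 0)" for x
    unfolding A2_def using rs \<open>1 \<le> k\<close> by (rule ch_rmove)
  note mr = mx_rh_cmove[OF c bd, folded A1_def] and mc = mx_ch_rmove[OF r bd, folded A2_def]
  note mr' = is_last_mx[OF r(1)] and mc' = is_last_mx[OF c(1)]
  obtain k' where k': "k = Suc k'" using \<open>1 \<le> k\<close> by (cases k) auto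
  have kk: "ch A p k = ch A p k' + (of_bool (A k p) - of_bool (A k (Suc p)))" "k' \<noteq> k" "k' \<le> m"
    using k' bd by (auto simp: ch_Suc)
  have r1: "rh A k x \<le> rh A k q" "q < x \<Longrightarrow> rh A k x < rh A k q" if "x \<le> N" for x
    using r that by (auto simp: is_last_def)
  have c1: "ch A p x \<le> ch A p i" "i < x \<Longrightarrow> ch A p x < ch A p i" if "x \<le> m" for x
    using c that by (auto simp: is_last_def)
  \<comment> \<open>The two remaining ways to meet would make one cell both occupied and
    empty.\<close>
  have ex: "k = i \<Longrightarrow> q \<noteq> Suc p" "k = Suc i \<Longrightarrow> q \<noteq> p" using rs cs by auto
  consider (out) "k \<noteq> i \<and> k \<noteq> Suc i \<or> q \<noteq> p \<and> q \<noteq> Suc p"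
    | (a) "k = Suc i" "q = Suc p" | (b) "k = i" "q = p"
    using ex by blast
  then show ?thesis
  proof cases
    case out
    have 1: "is_last (rh A1 k) N q"
    proof (cases "k \<noteq> i \<and> k \<noteq> Suc i")
      case True
      then have "rh A1 k = rh A k" by (auto simp: rhc fun_eq_iff)
      then show ?thesis using r(1) by simp
    next
      case False
      then have qq: "q \<noteq> p" "q \<noteq> Suc p" using out by auto
      show ?thesis
      proof (rule is_last_point_change[OF r(1), where c = "Suc p"])
        assume x: "Suc p \<le> N" "q < Suc p"
        then have qp: "q < p" using qq by auto
        have "rh A k p < rh A k q" "rh A k (Suc (Suc p)) < rh A k q"
          using r1(2) x bd qp by auto
        moreover have "k = i \<longrightarrow> A k (Suc p) \<longrightarrow> A k p"
          using c1(1)[of k'] k' c(2) by (auto simp: ch_Suc split: if_splits)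
        moreover have "rh A1 k (Suc p) = rh A k (Suc p) + (of_bool (k = i) - of_bool (k = Suc i))"
          by (simp add: rhc)
        ultimately show "rh A1 k (Suc p) < rh A k q"
          using False cs by (auto simp: rh_Suc[of A] split: if_splits)
      qed (use qq mr in \<open>auto simp: rhc\<close>)
    qed
    have 2: "is_last (ch A2 p) m i"
    proof (cases "q \<noteq> p \<and> q \<noteq> Suc p")
      case True
      then have "ch A2 p = ch A p" by (auto simp: chr fun_eq_iff)
      then show ?thesis using c(1) by simp
    next
      case False
      then have qq: "k \<noteq> i" "k \<noteq> Suc i" using out by auto
      show ?thesis
      proof (rule is_last_point_change[OF c(1), where c = "k"])
        assume x: "k \<le> m" "i < k"
        then have qp: "i < k'" using qq k' by auto
        have "ch A p k' < ch A p i" "ch A p (Suc k) < ch A p i"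
          using c1(2) x bd qp k' by auto
        moreover have "q = Suc p \<longrightarrow> A k p \<longrightarrow> A (Suc k) p"
          using r1(1)[of p] bd by (auto simp: rh_Suc split: if_splits)
        moreover have "ch A2 p k = ch A p k + (of_bool (q = Suc p) - of_bool (q = p))"
          by (simp add: chr)
        ultimately show "ch A2 p k < ch A p i"
          using False rs k' by (auto simp: ch_Suc[of A] split: if_splits)
      qed (use qq mc in \<open>auto simp: chr\<close>)
    qed
    have "rmove A1 k q = cmove A2 p i"
      unfolding A1_def A2_def using out by (rule rmove_cmove_apart)
    then show ?thesis unfolding A1_def[symmetric] A2_def[symmetric]
      using 1 2 r(2) c(2) by (intro exI[of _ q] exI[of _ i] conjI)
  next
    case a
    have "A (Suc k) p \<Longrightarrow> False"
      using c1(2)[of "Suc k"] a bd rs cs by (auto simp: ch_Suc split: if_splits)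
    then have n: "\<not> A (Suc k) p" by auto
    have 1: "is_last (rh A1 k) N p"
      unfolding is_last_def
    proof (intro conjI allI impI)
      have v: "rh A1 k p = rh A k q"
        using n a cs rhc[of p] rh_Suc[of A k p] by simp
      fix x assume x: "x \<le> N"
      show "rh A1 k x \<le> rh A1 k p"
        using r1(1)[OF x] rhc[of x] v a by (simp split: if_splits)
      show "p < x \<Longrightarrow> rh A1 k x < rh A1 k p"
        using r1(2)[OF x] rhc[of x] v a by (cases "x = Suc p"; simp)
    qed (use bd in auto)
    have 2: "is_last (ch A2 p) m k"
      unfolding is_last_def
    proof (intro conjI allI impI)
      have v: "ch A2 p k = ch A p i"
        using n a cs chr[of k] ch_Suc[of A p i] by simp
      fix x assume x: "x \<le> m"
      show "ch A2 p x \<le> ch A2 p k"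
        using c1(1)[OF x] chr[of x] v a by (cases "x = k"; simp)
      show "k < x \<Longrightarrow> ch A2 p x < ch A2 p k"
        using c1(2)[OF x] chr[of x] v a by simp
    qed (use bd in auto)
    have "rmove A1 k p = cmove A2 p k"
      unfolding A1_def A2_def a(2) by (rule rmove_cmove_one) (use a n cs rs in auto)
    then show ?thesis unfolding A1_def[symmetric] A2_def[symmetric]
      using 1 2 bd by (intro exI[of _ p] exI[of _ k] conjI) auto
  next
    case b
    have n: "A k (Suc p)"
      using r1(2)[of "Suc (Suc p)"] b bd rs cs by (auto simp: rh_Suc split: if_splits)
    have 1: "is_last (rh A1 k) N (Suc p)"
      unfolding is_last_def
    proof (intro conjI allI impI)
      have v: "rh A1 k (Suc p) = rh A k q"
        using rs b rhc[of "Suc p"] rh_Suc[of A k p] cs by simp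
      fix x assume x: "x \<le> N"
      show "rh A1 k x \<le> rh A1 k (Suc p)"
        using r1(1)[OF x] rhc[of x] v b by (cases "x = Suc p"; simp)
      show "Suc p < x \<Longrightarrow> rh A1 k x < rh A1 k (Suc p)"
        using r1(2)[OF x] rhc[of x] v b by simp
    qed (use bd in auto)
    have 2: "is_last (ch A2 p) m k'"
      unfolding is_last_def
    proof (intro conjI allI impI)
      have v: "ch A2 p k' = ch A p i"
        using n b rs chr[of k'] kk by simp
      fix x assume x: "x \<le> m"
      show "ch A2 p x \<le> ch A2 p k'"
        using c1(1)[OF x] chr[of x] v b by (simp split: if_splits)
      show "k' < x \<Longrightarrow> ch A2 p x < ch A2 p k'"
        using c1(2)[OF x] chr[of x] v b Suc_lessI[of k' x] unfolding k'[symmetric] by (cases "x = k"; force)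
    qed (use kk in auto)
    have "rmove A1 k (Suc p) = cmove A2 p k'"
      unfolding A1_def A2_def b(2) b(1)[symmetric] by (rule rmove_cmove_three) (use b n cs rs k' in auto)
    then show ?thesis unfolding A1_def[symmetric] A2_def[symmetric]
      using 1 2 bd k' by (intro exI[of _ "Suc p"] exI[of _ k'] conjI) auto
  qed
qed

definition mem :: "tensor \<Rightarrow> nat \<Rightarrow> nat \<Rightarrow> bool" where
  "mem b i p \<longleftrightarrow> i \<in> b ! p"

lemma mx_Suc:
  assumes "\<And>r. r \<le> N \<Longrightarrow> g' (Suc r) = c + g r"
  shows "mx g' (Suc N) = max (g' 0) (c + mx g N)"
proof -
  obtain q where q: "is_last g N q" using is_last_exists by blast
  then have m: "mx g N = g q" by (rule is_last_mx)
  show ?thesis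
  proof (cases "g' 0 \<le> c + g q")
    case True
    have "is_last g' (Suc N) (Suc q)" using q assms True by (rule is_last_Suc)
    from is_last_mx[OF this] show ?thesis using True assms[of q] q m by (auto simp: is_last_def)
  next
    case False
    have "is_last g' (Suc N) 0" using q assms False by (intro is_last_Suc_0[of g N q g' c]) auto
    then show ?thesis using False m by (auto dest!: is_last_mx)
  qed
qed

section \<open>The crystal operators in terms of heights\<close>

text \<open>A column with both letters contributes \<open>+-\<close>, which cancels at once and
  matches its zero step in the heights.\<close>

definition seg :: "nat \<Rightarrow> nat set \<Rightarrow> nat \<Rightarrow> (nat \<times> nat) list" where
  "seg k c i = (if k \<in> c then [(k, i)] else []) @ (if Suc k \<in> c then [(Suc k, i)] else [])"

fun segs :: "nat \<Rightarrow> tensor \<Rightarrow> nat \<Rightarrow> (nat \<times> nat) list" where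
  "segs k [] i = []"
| "segs k (c # b) i = seg k c i @ segs k b (Suc i)"

lemma filter_letters:
  assumes "finite c"
  shows "filter (\<lambda>x. fst x = k \<or> fst x = k + 1) (map (\<lambda>a. (a, i)) (sorted_list_of_set c)) = seg k c i"
proof -
  let ?l = "(if k \<in> c then [k] else []) @ (if Suc k \<in> c then [Suc k] else [])"
  have "filter (\<lambda>a. a = k \<or> a = Suc k) (sorted_list_of_set c) = ?l"
    by (rule sorted_distinct_set_unique) (use assms in \<open>auto simp: sorted_wrt_filter\<close>)
  then show ?thesis by (auto simp: filter_map o_def seg_def)
qed

lemma segs_eq: "concat (map (\<lambda>j. seg k (b ! j) (i + j)) [0..<length b]) = segs k b i"
proof (induction b arbitrary: i)
  case (Cons c b)
  show ?case using Cons[of "Suc i"] by (simp add: map_upt_Suc del: upt_Suc)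
qed simp

lemma signature_eq:
  assumes "\<forall>c\<in>set b. finite c"
  shows "signature k b = cancel k (segs k b 0)"
proof -
  have "filter (\<lambda>x. fst x = k \<or> fst x = k + 1) (word b)
      = concat (map (\<lambda>j. seg k (b ! j) j) [0..<length b])"
    unfolding word_def filter_concat map_map o_def
    using assms by (intro arg_cong[where f = concat] map_cong) (auto simp: filter_letters[simplified])
  then show ?thesis using segs_eq[of k b 0] by (simp add: signature_def)
qed

lemma rh_Cons: "rh (mem (c # b)) k (Suc q) = (of_bool (Suc k \<in> c) - of_bool (k \<in> c)) + rh (mem b) k q"
  unfolding rh_def by (subst sum.lessThan_Suc_shift) (simp add: mem_def)

text \<open>With \<open>-\<close> as an up step, the surviving \<open>-\<close> are the records of
  the heights: their number is the maximum, the last of them is the step into the first maximum, and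
  the first surviving \<open>+\<close> is the step out of the last one. In the induction a
  \<open>-\<close> at the head joins the others, while a \<open>+\<close> deletes the first
  surviving \<open>-\<close>, or survives if there is none. The offset \<open>i\<close> keeps track
  of positions in the whole list.\<close>

lemma cancel_segs:
  "\<exists>ms ps. cancel k (segs k b i) = ms @ ps \<and> (\<forall>x\<in>set ms. fst x = Suc k) \<and> (\<forall>x\<in>set ps. fst x = k) \<and>
     int (length ms) = mx (rh (mem b) k) (length b) \<and>
     (if ps = [] then is_last (rh (mem b) k) (length b) (length b)
      else \<exists>q<length b. snd (hd ps) = i + q \<and> is_last (rh (mem b) k) (length b) q) \<and>
     (if ms = [] then is_first (rh (mem b) k) (length b) 0
      else \<exists>q<length b. snd (last ms) = i + q \<and> is_first (rh (mem b) k) (length b) (Suc q))"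
proof (induction b arbitrary: i)
  case Nil
  have "mx (rh (mem []) k) 0 = 0" using mx_eqI[of 0 0] by simp
  then show ?case by (auto simp: is_last_def is_first_def)
next
  case (Cons c b)
  let ?g = "rh (mem b) k" and ?h = "rh (mem (c # b)) k" and ?N = "length b"
  define d :: int where "d = of_bool (Suc k \<in> c) - of_bool (k \<in> c)"
  have h: "\<And>r. ?h (Suc r) = d + ?g r" by (simp add: rh_Cons d_def)
  have h0: "?h 0 = 0" by simp
  obtain ms ps where IH: "cancel k (segs k b (Suc i)) = ms @ ps"
    "\<forall>x\<in>set ms. fst x = Suc k" "\<forall>x\<in>set ps. fst x = k" "int (length ms) = mx ?g ?N"
    "if ps = [] then is_last ?g ?N ?N else \<exists>q<?N. snd (hd ps) = Suc i + q \<and> is_last ?g ?N q"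
    "if ms = [] then is_first ?g ?N 0 else \<exists>q<?N. snd (last ms) = Suc i + q \<and> is_first ?g ?N (Suc q)"
    using Cons.IH[of "Suc i"] by blast
  have mxh: "mx ?h (Suc ?N) = max 0 (d + mx ?g ?N)" using mx_Suc[of ?N ?h d ?g] h by simp
  have L: "if ps = [] then is_last ?h (Suc ?N) (Suc ?N)
      else \<exists>q<Suc ?N. snd (hd ps) = i + q \<and> is_last ?h (Suc ?N) q" if "d + mx ?g ?N \<ge> 0"
  proof -
    have "is_last ?h (Suc ?N) (Suc q)" if "is_last ?g ?N q" for q
      using that \<open>d + mx ?g ?N \<ge> 0\<close> h by (intro is_last_Suc[OF that, of _ d]) (auto simp: is_last_mx[OF that])
    then show ?thesis using IH(5) by (fastforce split: if_splits)
  qed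
  have F: "\<exists>q<Suc ?N. snd (last ms) = i + q \<and> is_first ?h (Suc ?N) (Suc q)"
    if "d + mx ?g ?N > 0" "ms \<noteq> []"
  proof -
    have "is_first ?h (Suc ?N) (Suc q)" if "is_first ?g ?N q" for q
      using that \<open>d + mx ?g ?N > 0\<close> h by (intro is_first_Suc[OF that, of _ d]) (auto simp: is_first_mx[OF that])
    then show ?thesis using IH(6) that(2) by fastforce
  qed
  have F0: "is_first ?h (Suc ?N) 0" if "d + mx ?g ?N \<le> 0"
  proof -
    obtain q where q: "is_first ?g ?N q" using is_first_exists by blast
    then show ?thesis using that h by (intro is_first_Suc_0[OF q, of _ d]) (auto simp: is_first_mx[OF q])
  qed
  have step: ?case if "cancel k (segs k (c # b) i) = ms' @ ps'"
    "\<forall>x\<in>set ms'. fst x = Suc k" "\<forall>x\<in>set ps'. fst x = k"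
    "int (length ms') = mx ?h (Suc ?N)"
    "if ps' = [] then is_last ?h (Suc ?N) (Suc ?N)
      else \<exists>q<Suc ?N. snd (hd ps') = i + q \<and> is_last ?h (Suc ?N) q"
    "if ms' = [] then is_first ?h (Suc ?N) 0
      else \<exists>q<Suc ?N. snd (last ms') = i + q \<and> is_first ?h (Suc ?N) (Suc q)" for ms' ps'
    unfolding that(1) by (intro exI[of _ ms'] exI[of _ ps'] conjI refl) (use that(2-) in simp_all)
  have pos: "ms \<noteq> [] \<Longrightarrow> mx ?g ?N > 0" and nonneg: "mx ?g ?N \<ge> 0"
    using IH(4)[symmetric] by auto
  consider (zero) "k \<in> c \<longleftrightarrow> Suc k \<in> c" | (up) "k \<notin> c" "Suc k \<in> c" | (down) "k \<in> c" "Suc k \<notin> c" by blast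
  then show ?case
  proof cases
    case zero
    then have d: "d = 0" by (simp add: d_def)
    show ?thesis
    proof (rule step[OF _ IH(2,3)])
      show "cancel k (segs k (c # b) i) = ms @ ps"
        using zero IH(1) by (auto simp: seg_def split: list.splits)
      show "int (length ms) = mx ?h (Suc ?N)" using mxh d nonneg IH(4) by simp
      show "if ps = [] then is_last ?h (Suc ?N) (Suc ?N)
        else \<exists>q<Suc ?N. snd (hd ps) = i + q \<and> is_last ?h (Suc ?N) q" using d nonneg by (intro L) simp
      show "if ms = [] then is_first ?h (Suc ?N) 0
        else \<exists>q<Suc ?N. snd (last ms) = i + q \<and> is_first ?h (Suc ?N) (Suc q)"
      proof (cases "ms = []")
        case True
        then show ?thesis using F0 IH(4) d by simp
      next
        case False
        then show ?thesis using F pos d by simp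
      qed
    qed
  next
    case up
    then have d: "d = 1" by (simp add: d_def)
    show ?thesis
    proof (rule step[OF _ _ IH(3)])
      show "cancel k (segs k (c # b) i) = ((Suc k, i) # ms) @ ps"
        using up IH(1) by (auto simp: seg_def split: list.splits)
      show "\<forall>x\<in>set ((Suc k, i) # ms). fst x = Suc k" using IH(2) by simp
      show "int (length ((Suc k, i) # ms)) = mx ?h (Suc ?N)" using mxh d nonneg IH(4) by simp
      show "if ps = [] then is_last ?h (Suc ?N) (Suc ?N)
        else \<exists>q<Suc ?N. snd (hd ps) = i + q \<and> is_last ?h (Suc ?N) q" using d nonneg by (intro L) simp
      show "if (Suc k, i) # ms = [] then is_first ?h (Suc ?N) 0
        else \<exists>q<Suc ?N. snd (last ((Suc k, i) # ms)) = i + q \<and> is_first ?h (Suc ?N) (Suc q)"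
      proof (cases "ms = []")
        case True
        then have "is_first ?h (Suc ?N) (Suc 0)"
          using IH(6) h d by (intro is_first_Suc[of ?g ?N 0 ?h d]) auto
        then show ?thesis using True by auto
      next
        case False
        then show ?thesis using F pos[OF False] d by simp
      qed
    qed
  next
    case down
    then have d: "d = -1" by (simp add: d_def)
    show ?thesis
    proof (cases ms)
      case Nil
      have m0: "mx ?g ?N = 0" using IH(4) Nil by simp
      obtain q where q: "is_last ?g ?N q" using is_last_exists by blast
      have l: "is_last ?h (Suc ?N) 0"
        using h d m0 by (intro is_last_Suc_0[OF q, of _ d]) (auto simp: is_last_mx[OF q, symmetric])
      show ?thesis
      proof (rule step[of "[]" "(k, i) # ps"])
        show "cancel k (segs k (c # b) i) = [] @ ((k, i) # ps)"
          using down IH(1,3) Nil by (auto simp: seg_def split: list.splits)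
        show "\<forall>x\<in>set ((k, i) # ps). fst x = k" using IH(3) by simp
      qed (use l F0 m0 d mxh in auto)
    next
      case (Cons y ms')
      have m1: "mx ?g ?N = 1 + int (length ms')" using IH(4) Cons by simp
      show ?thesis
      proof (rule step[OF _ _ IH(3)])
        show "cancel k (segs k (c # b) i) = ms' @ ps"
          using down IH(1,2) Cons by (auto simp: seg_def split: list.splits)
        show "\<forall>x\<in>set ms'. fst x = Suc k" using IH(2) Cons by simp
        show "int (length ms') = mx ?h (Suc ?N)" using mxh d m1 by simp
        show "if ps = [] then is_last ?h (Suc ?N) (Suc ?N)
          else \<exists>q<Suc ?N. snd (hd ps) = i + q \<and> is_last ?h (Suc ?N) q" using d m1 by (intro L) simp
        show "if ms' = [] then is_first ?h (Suc ?N) 0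
          else \<exists>q<Suc ?N. snd (last ms') = i + q \<and> is_first ?h (Suc ?N) (Suc q)"
        proof (cases "ms' = []")
          case True
          then show ?thesis using F0 m1 d by simp
        next
          case False
          then have "length ms' > 0" by simp
          then have "d + mx ?g ?N > 0" using m1 d by linarith
          then show ?thesis using F Cons False by simp
        qed
      qed
    qed
  qed
qed

lemma filter_minus_plus:
  assumes "\<forall>x\<in>set ms. fst x = Suc k" "\<forall>x\<in>set ps. fst x = k"
  shows "filter (\<lambda>x. fst x = k) (ms @ ps) = ps" "filter (\<lambda>x. fst x = k + 1) (ms @ ps) = ms"
  using assms by (auto simp: filter_id_conv filter_empty_conv)

lemma lower_eq:
  assumes "\<forall>c\<in>set b. finite c" "is_last (rh (mem b) k) (length b) q"
  shows "lower k b = (if q < length b then Some (b[q := insert (Suc k) (b ! q - {k})]) else None)"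
proof -
  obtain ms ps where c: "cancel k (segs k b 0) = ms @ ps"
    "\<forall>x\<in>set ms. fst x = Suc k" "\<forall>x\<in>set ps. fst x = k"
    "if ps = [] then is_last (rh (mem b) k) (length b) (length b)
      else \<exists>q<length b. snd (hd ps) = 0 + q \<and> is_last (rh (mem b) k) (length b) q"
    using cancel_segs[of k b 0] by blast
  have *: "filter (\<lambda>x. fst x = k) (signature k b) = ps"
    unfolding signature_eq[OF assms(1)] c(1) by (rule filter_minus_plus[OF c(2,3)])
  show ?thesis
  proof (cases ps)
    case Nil
    then have "q = length b" using c(4) assms(2) is_last_unique by auto
    then show ?thesis using * Nil by (simp add: lower_def)
  next
    case (Cons a ps')
    then have "snd a = q" "q < length b" using c(4) assms(2) is_last_unique by fastforce+
    then show ?thesis using * Cons by (cases a) (simp add: lower_def)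
  qed
qed

lemma raise_eq:
  assumes "\<forall>c\<in>set b. finite c" "is_first (rh (mem b) k) (length b) q"
  shows "raise k b = (case q of 0 \<Rightarrow> None | Suc q' \<Rightarrow> Some (b[q' := insert k (b ! q' - {Suc k})]))"
proof -
  obtain ms ps where c: "cancel k (segs k b 0) = ms @ ps"
    "\<forall>x\<in>set ms. fst x = Suc k" "\<forall>x\<in>set ps. fst x = k"
    "if ms = [] then is_first (rh (mem b) k) (length b) 0
      else \<exists>q<length b. snd (last ms) = 0 + q \<and> is_first (rh (mem b) k) (length b) (Suc q)"
    using cancel_segs[of k b 0] by blast
  have *: "filter (\<lambda>x. fst x = k + 1) (signature k b) = ms"
    unfolding signature_eq[OF assms(1)] c(1) by (rule filter_minus_plus[OF c(2,3)])
  show ?thesis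
  proof (cases ms rule: rev_cases)
    case Nil
    then have "q = 0" using c(4) assms(2) is_first_unique by auto
    then show ?thesis using * Nil by (simp add: raise_def)
  next
    case (snoc ms' a)
    then have "Suc (snd a) = q" using c(4) assms(2) is_first_unique by fastforce
    then show ?thesis using * snoc by (cases a) (auto simp: raise_def)
  qed
qed

lemma finite_update:
  "\<forall>c\<in>set b. finite c \<Longrightarrow> finite x \<Longrightarrow> \<forall>c\<in>set (b[q := x]). finite c"
  using set_update_subset_insert[of b q x] by blast

definition letters_le :: "nat \<Rightarrow> tensor \<Rightarrow> bool" where
  "letters_le m b \<longleftrightarrow> (\<forall>c\<in>set b. c \<subseteq> {1..m})"

lemma letters_le_finite: "letters_le m b \<Longrightarrow> \<forall>c\<in>set b. finite c"
  unfolding letters_le_def using finite_subset by blast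

lemma mem_rmove: "q < length b \<Longrightarrow> mem (b[q := insert (Suc k) (b ! q - {k})]) = rmove (mem b) k q"
  by (intro ext) (auto simp: mem_def rmove_def nth_list_update)

lemma mem_cmove: "Suc p < length x \<Longrightarrow>
    mem (x[p := insert (Suc i) (x ! p), Suc p := x ! Suc p - {Suc i}]) = cmove (mem x) p i"
  by (intro ext) (auto simp: mem_def cmove_def nth_list_update)

lemma mem_inject:
  assumes "length b = length b'" "mem b = mem b'" shows "b = b'"
proof (rule nth_equalityI)
  fix p assume "p < length b"
  show "b ! p = b' ! p" using fun_cong[OF fun_cong[OF assms(2)], of _ p] by (auto simp: mem_def)
qed (fact assms(1))

lemma lower_SomeD:
  assumes "\<forall>c\<in>set b. finite c" "lower k b = Some b'"
  obtains q where "is_last (rh (mem b) k) (length b) q" "q < length b"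
    "b' = b[q := insert (Suc k) (b ! q - {k})]"
  using assms is_last_exists[of "rh (mem b) k" "length b"] lower_eq[OF assms(1)]
  by (fastforce split: if_splits)

lemma raise_SomeD:
  assumes "\<forall>c\<in>set b. finite c" "raise k b = Some b'"
  obtains q where "is_first (rh (mem b) k) (length b) (Suc q)" "q < length b"
    "b' = b[q := insert k (b ! q - {Suc k})]"
proof -
  obtain q where q: "is_first (rh (mem b) k) (length b) q" using is_first_exists by blast
  with raise_eq[OF assms(1) q] assms(2) that show ?thesis
    by (cases q) (auto simp: is_first_def)
qed

lemma lower_None_iff:
  assumes "\<forall>c\<in>set b. finite c"
  shows "lower k b = None \<longleftrightarrow> mx (rh (mem b) k) (length b) = rh (mem b) k (length b)"
proof -
  obtain q where q: "is_last (rh (mem b) k) (length b) q" using is_last_exists by blast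
  have "lower k b = None \<longleftrightarrow> q = length b"
    using lower_eq[OF assms q] q by (auto simp: is_last_def)
  also have "\<dots> \<longleftrightarrow> is_last (rh (mem b) k) (length b) (length b)" using q is_last_unique by auto
  finally show ?thesis by (simp add: is_last_end_iff)
qed

lemma raise_None_iff:
  assumes "\<forall>c\<in>set b. finite c"
  shows "raise k b = None \<longleftrightarrow> mx (rh (mem b) k) (length b) = 0"
proof -
  obtain q where q: "is_first (rh (mem b) k) (length b) q" using is_first_exists by blast
  have "raise k b = None \<longleftrightarrow> q = 0"
    using raise_eq[OF assms q] by (auto split: nat.splits)
  also have "\<dots> \<longleftrightarrow> is_first (rh (mem b) k) (length b) 0" using q is_first_unique by auto
  finally show ?thesis by (simp add: is_first_0_iff)
qed

lemma raise_lower_inverse: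
  assumes b: "\<forall>c\<in>set b. finite c" "lower k b = Some b'" shows "raise k b' = Some b"
proof -
  obtain q where q: "is_last (rh (mem b) k) (length b) q" "q < length b"
    "b' = b[q := insert (Suc k) (b ! q - {k})]" using lower_SomeD[OF b] .
  have s: "mem b k q" "\<not> mem b (Suc k) q" using rh_last_step[OF q(1,2)] by auto
  have m: "mem b' = rmove (mem b) k q" using q mem_rmove by simp
  have f: "\<forall>c\<in>set b'. finite c"
    unfolding q(3) by (rule finite_update) (use b(1) q(2) in auto)
  have "is_first (rh (mem b') k) (length b) (Suc q)"
    using s by (intro is_first_bump[OF q(1,2)]) (auto simp: m rh_rmove rh_Suc)
  moreover have "length b' = length b" using q(3) by simp
  ultimately show ?thesis using raise_eq[OF f, of k "Suc q"] q(2,3) s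
    by (auto simp: mem_def insert_absorb intro!: nth_equalityI simp: nth_list_update)
qed

lemma lower_raise_inverse:
  assumes b: "\<forall>c\<in>set b. finite c" "raise k b = Some b'" shows "lower k b' = Some b"
proof -
  obtain q where q: "is_first (rh (mem b) k) (length b) (Suc q)" "q < length b"
    "b' = b[q := insert k (b ! q - {Suc k})]" using raise_SomeD[OF b] .
  have s: "mem b (Suc k) q" "\<not> mem b k q" using rh_first_step[OF q(1)] by auto
  have s': "mem b' k q" "\<not> mem b' (Suc k) q" using q(2,3) by (auto simp: mem_def)
  have e: "b = b'[q := insert (Suc k) (b' ! q - {k})]"
    using q(2,3) s by (auto simp: mem_def insert_absorb intro!: nth_equalityI simp: nth_list_update)
  have m: "mem b = rmove (mem b') k q" by (subst e, rule mem_rmove) (use q(2,3) in simp)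
  have f: "\<forall>c\<in>set b'. finite c"
    unfolding q(3) by (rule finite_update) (use b(1) q(2) in auto)
  have h: "rh (mem b) k r = rh (mem b') k r + (if q < r then 2 else 0)" for r
    unfolding m by (rule rh_rmove) (use s' in auto)
  have "rh (mem b) k (Suc q) = rh (mem b) k q + 1" using s by (simp add: rh_Suc)
  then have "is_last (rh (mem b') k) (length b) q"
    by (intro is_last_bump[OF q(1)]) (simp_all add: h)
  moreover have l: "length b' = length b" using q(3) by simp
  ultimately have "lower k b' = Some (b'[q := insert (Suc k) (b' ! q - {k})])"
    using lower_eq[OF f, of k q] q(2) by simp
  then show ?thesis unfolding e[symmetric] .
qed

section \<open>Column operators\<close>

text \<open>On \<open>b\<^sup>*\<close> this is the lowering operator with index \<open>l - p - 1\<close>, see \<open>cstep_dual\<close>.\<close>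

definition cstep :: "nat \<Rightarrow> nat \<Rightarrow> tensor \<Rightarrow> tensor \<Rightarrow> bool" where
  "cstep m p x y \<longleftrightarrow> letters_le m x \<and> Suc p < length x \<and>
     (\<exists>i<m. is_last (ch (mem x) p) m i \<and>
        y = x[p := insert (Suc i) (x ! p), Suc p := x ! Suc p - {Suc i}])"

lemma letters_le_update: "letters_le m b \<Longrightarrow> c \<subseteq> {1..m} \<Longrightarrow> letters_le m (b[q := c])"
  unfolding letters_le_def using set_update_subset_insert[of b q c] by blast

lemma letters_le_nth: "letters_le m b \<Longrightarrow> p < length b \<Longrightarrow> b ! p \<subseteq> {1..m}"
  unfolding letters_le_def by auto

lemma letters_le_lower:
  assumes g: "letters_le m b" and k: "k \<in> {1..<m}" and b: "lower k b = Some b'"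
  shows "letters_le m b' \<and> length b' = length b"
proof -
  obtain q where q: "q < length b" "b' = b[q := insert (Suc k) (b ! q - {k})]"
    using lower_SomeD[OF letters_le_finite[OF g] b] by metis
  have "insert (Suc k) (b ! q - {k}) \<subseteq> {1..m}" using letters_le_nth[OF g q(1)] k by auto
  then show ?thesis using q(2) g by (simp add: letters_le_update)
qed

lemma letters_le_raise:
  assumes g: "letters_le m b" and k: "k \<in> {1..<m}" and b: "raise k b = Some b'"
  shows "letters_le m b' \<and> length b' = length b"
proof -
  obtain q where q: "q < length b" "b' = b[q := insert k (b ! q - {Suc k})]"
    using raise_SomeD[OF letters_le_finite[OF g] b] by metis
  have "insert k (b ! q - {Suc k}) \<subseteq> {1..m}" using letters_le_nth[OF g q(1)] k by auto
  then show ?thesis using q(2) g by (simp add: letters_le_update)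
qed

lemma cstep_length: "cstep m p x y \<Longrightarrow> length y = length x"
  by (auto simp: cstep_def)

lemma cstep_letters_le:
  assumes "cstep m p x y" shows "letters_le m y"
proof -
  obtain i where i: "letters_le m x" "Suc p < length x" "i < m"
    and y: "y = x[p := insert (Suc i) (x ! p), Suc p := x ! Suc p - {Suc i}]"
    using assms by (auto simp: cstep_def)
  have "insert (Suc i) (x ! p) \<subseteq> {1..m}" "x ! Suc p - {Suc i} \<subseteq> {1..m}"
    using letters_le_nth[OF i(1), of p] letters_le_nth[OF i(1,2)] i by auto
  then show ?thesis using i(1) by (simp add: y letters_le_update)
qed

lemma cstep_mem:
  assumes "cstep m p x y"
  obtains i where "is_last (ch (mem x) p) m i" "i < m" "mem y = cmove (mem x) p i"
  using assms mem_cmove[of p x] by (auto simp: cstep_def)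

lemma cstep_fun: "cstep m p x y \<Longrightarrow> cstep m p x y' \<Longrightarrow> y = y'"
  by (auto simp: cstep_def dest: is_last_unique)

lemma cstep_defined_iff:
  assumes "letters_le m x" "Suc p < length x"
  shows "(\<exists>y. cstep m p x y) \<longleftrightarrow> mx (ch (mem x) p) m \<noteq> ch (mem x) p m"
proof -
  obtain i where i: "is_last (ch (mem x) p) m i" using is_last_exists by blast
  have "(\<exists>y. cstep m p x y) \<longleftrightarrow> i < m"
    using assms i by (auto simp: cstep_def dest: is_last_unique)
  also have "\<dots> \<longleftrightarrow> \<not> is_last (ch (mem x) p) m m"
  proof -
    have "i \<le> m" using i by (simp add: is_last_def)
    moreover have "is_last (ch (mem x) p) m m \<longleftrightarrow> i = m" using i is_last_unique by blast
    ultimately show ?thesis by auto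
  qed
  finally show ?thesis by (simp add: is_last_end_iff)
qed

lemma cstep_heights:
  assumes "cstep m p x y"
  shows "mx (ch (mem y) p) m = mx (ch (mem x) p) m + 1" "ch (mem y) p m = ch (mem x) p m + 2"
proof -
  obtain i where i: "is_last (ch (mem x) p) m i" "i < m" "mem y = cmove (mem x) p i"
    using cstep_mem[OF assms] .
  note s = ch_last_step[OF i(1,2)]
  have h: "ch (mem y) p r = ch (mem x) p r + (if i < r then 2 else 0)" for r
    unfolding i(3) by (rule ch_cmove) (use s in auto)
  have "is_first (ch (mem y) p) m (Suc i)"
    by (rule is_first_bump[OF i(1,2) h]) (use s in \<open>simp add: ch_Suc\<close>)
  then show "mx (ch (mem y) p) m = mx (ch (mem x) p) m + 1"
    using s by (simp add: is_first_mx is_last_mx[OF i(1)] h ch_Suc[of "mem x"])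
  show "ch (mem y) p m = ch (mem x) p m + 2" using h i(2) by simp
qed

text \<open>The moved letter is the position of the first maximum of the new column heights, so it
  can be recovered from \<open>y\<close>.\<close>

lemma cstep_inj:
  assumes "cstep m p x y" "cstep m p x' y" shows "x = x'"
proof -
  have *: "\<exists>i. is_first (ch (mem y) p) m (Suc i) \<and> x = y[p := y ! p - {Suc i}, Suc p := insert (Suc i) (y ! Suc p)]"
    if xy: "cstep m p x y" for x
  proof -
    obtain i where i: "is_last (ch (mem x) p) m i" "i < m" "Suc p < length x"
      "y = x[p := insert (Suc i) (x ! p), Suc p := x ! Suc p - {Suc i}]"
      using xy by (auto simp: cstep_def)
    have m: "mem y = cmove (mem x) p i" using i mem_cmove by simp
    note s = ch_last_step[OF i(1,2)]
    have h: "ch (mem y) p r = ch (mem x) p r + (if i < r then 2 else 0)" for r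
      unfolding m by (rule ch_cmove) (use s in auto)
    have "is_first (ch (mem y) p) m (Suc i)"
      by (rule is_first_bump[OF i(1,2) h]) (use s in \<open>simp add: ch_Suc\<close>)
    moreover have "x = y[p := y ! p - {Suc i}, Suc p := insert (Suc i) (y ! Suc p)]"
      using s i(3) unfolding i(4)
      by (intro nth_equalityI) (auto simp: nth_list_update mem_def)
    ultimately show ?thesis by blast
  qed
  show ?thesis using *[OF assms(1)] *[OF assms(2)] by (metis is_first_unique nat.inject)
qed

lemma cstep_pred:
  assumes "letters_le m y" "Suc p < length y" "mx (ch (mem y) p) m \<noteq> 0"
  shows "\<exists>x. cstep m p x y"
proof -
  obtain q where q: "is_first (ch (mem y) p) m q" using is_first_exists by blast
  have "q \<noteq> 0" using is_first_mx[OF q] assms(3) by (metis ch_0)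
  then obtain i where i: "is_first (ch (mem y) p) m (Suc i)" using q by (cases q) auto
  have im: "i < m" using i by (simp add: is_first_def)
  note s = ch_first_step[OF i]
  define x where "x = y[p := y ! p - {Suc i}, Suc p := insert (Suc i) (y ! Suc p)]"
  have "y ! p - {Suc i} \<subseteq> {1..m}" "insert (Suc i) (y ! Suc p) \<subseteq> {1..m}"
    using letters_le_nth[OF assms(1), of p] letters_le_nth[OF assms(1,2)] assms(2) im by auto
  then have g: "letters_le m x" unfolding x_def by (intro letters_le_update assms(1))
  have l: "length x = length y" by (simp add: x_def)
  have e: "y = x[p := insert (Suc i) (x ! p), Suc p := x ! Suc p - {Suc i}]"
    using s assms(2) by (intro nth_equalityI) (auto simp: nth_list_update mem_def x_def)
  have m: "mem y = cmove (mem x) p i" by (subst e, rule mem_cmove) (use l assms in simp)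
  have s': "mem x (Suc i) (Suc p)" "\<not> mem x (Suc i) p" using assms(2) by (auto simp: mem_def x_def)
  have h: "ch (mem y) p r = ch (mem x) p r + (if i < r then 2 else 0)" for r
    unfolding m by (rule ch_cmove) (use s' in auto)
  have "is_last (ch (mem x) p) m i"
    using s by (intro is_last_bump[OF i]) (auto simp: h ch_Suc[of "mem y"])
  then have "cstep m p x y" unfolding cstep_def using g l assms(2) im e by auto
  then show ?thesis ..
qed

section \<open>Bisimulations between crystals\<close>

text \<open>The graph of an isomorphism of crystals is an instance, but relations compose more easily.\<close>

definition bisim :: "nat \<Rightarrow> (tensor \<Rightarrow> tensor \<Rightarrow> bool) \<Rightarrow> bool" where
  "bisim m T \<longleftrightarrow> (\<forall>x y. T x y \<longrightarrow> (\<forall>k\<in>{1..<m}.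
     rel_option T (lower k x) (lower k y) \<and> rel_option T (raise k x) (raise k y)))"

lemma bisim_OO: "bisim m S \<Longrightarrow> bisim m T \<Longrightarrow> bisim m (S OO T)"
  unfolding bisim_def option.rel_compp by fastforce

lemma bisim_conversep: "bisim m T \<Longrightarrow> bisim m T\<inverse>\<inverse>"
  unfolding bisim_def option.rel_conversep by fastforce

lemma bisim_eq: "bisim m (=)"
  unfolding bisim_def by (auto simp: option.rel_eq)

lemma bisim_relpowp: "bisim m T \<Longrightarrow> bisim m (T ^^ r)"
  by (induction r) (auto simp: bisim_eq intro: bisim_OO)

lemma bisim_cstep_lower:
  assumes T: "cstep m p x y" and k: "k \<in> {1..<m}" and x: "lower k x = Some x'"
  shows "\<exists>y'. lower k y = Some y' \<and> cstep m p x' y'"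
proof -
  have g: "letters_le m x" "Suc p < length x" using T by (auto simp: cstep_def)
  obtain i where i: "is_last (ch (mem x) p) m i" "i < m"
    and y: "y = x[p := insert (Suc i) (x ! p), Suc p := x ! Suc p - {Suc i}]"
    using T by (auto simp: cstep_def)
  obtain q where q: "is_last (rh (mem x) k) (length x) q" "q < length x"
    and x': "x' = x[q := insert (Suc k) (x ! q - {k})]"
    using lower_SomeD[OF letters_le_finite[OF g(1)] x] .
  have my: "mem y = cmove (mem x) p i" using y mem_cmove g by simp
  have mx': "mem x' = rmove (mem x) k q" using x' mem_rmove q by simp
  have l: "length y = length x" "length x' = length x" by (simp_all add: x' y)
  obtain q' i' where qi: "q' < length x" "i' < m" "is_last (rh (mem y) k) (length x) q'"
    "is_last (ch (mem x') p) m i'" "rmove (mem y) k q' = cmove (mem x') p i'"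
    using commute_row_col[OF q i] g(2) k unfolding my mx' by auto
  have gy: "letters_le m y" "letters_le m x'" using cstep_letters_le[OF T] letters_le_lower[OF g(1) k x] by auto
  have "lower k y = Some (y[q' := insert (Suc k) (y ! q' - {k})])" (is "_ = Some ?y'")
    using lower_eq[OF letters_le_finite[OF gy(1)], of k q'] qi l by simp
  moreover have "?y' = x'[p := insert (Suc i') (x' ! p), Suc p := x' ! Suc p - {Suc i'}]"
    using qi l g by (intro mem_inject) (simp_all add: mem_rmove mem_cmove)
  ultimately show ?thesis using gy qi l g by (auto simp: cstep_def)
qed

lemma lower_mx_ch:
  assumes "letters_le m x" "k \<in> {1..<m}" "lower k x = Some x'" "Suc p < length x"
  shows "mx (ch (mem x') p) m = mx (ch (mem x) p) m" "ch (mem x') p m = ch (mem x) p m"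
proof -
  obtain q where q: "is_last (rh (mem x) k) (length x) q" "q < length x"
    and x': "x' = x[q := insert (Suc k) (x ! q - {k})]"
    using lower_SomeD[OF letters_le_finite[OF assms(1)] assms(3)] .
  have mx': "mem x' = rmove (mem x) k q" using x' mem_rmove q by simp
  show "mx (ch (mem x') p) m = mx (ch (mem x) p) m"
    unfolding mx' by (rule mx_ch_rmove[OF q]) (use assms in auto)
  show "ch (mem x') p m = ch (mem x) p m"
    unfolding mx' using rh_last_step[OF q] assms by (simp add: ch_rmove)
qed

lemma cstep_mx_rh:
  assumes "cstep m p x y" "k \<in> {1..<m}"
  shows "mx (rh (mem y) k) (length x) = mx (rh (mem x) k) (length x)"
    "rh (mem y) k (length x) = rh (mem x) k (length x)"
proof -
  obtain i where i: "is_last (ch (mem x) p) m i" "i < m" "mem y = cmove (mem x) p i"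
    using cstep_mem[OF assms(1)] .
  have p: "Suc p < length x" using assms(1) by (simp add: cstep_def)
  show "mx (rh (mem y) k) (length x) = mx (rh (mem x) k) (length x)"
    unfolding i(3) by (rule mx_rh_cmove[OF i(1,2)]) (use assms p in auto)
  show "rh (mem y) k (length x) = rh (mem x) k (length x)"
    unfolding i(3) using ch_last_step[OF i(1,2)] p by (simp add: rh_cmove)
qed

text \<open>The matrix argument covers lowering only. For raising, the heights show that
  \<open>cstep\<close> also applies to the raised element; lowering its image gives
  \<open>y\<close>, because \<open>cstep\<close> is single-valued, and the operators are inverse to
  each other.\<close>

lemma bisim_cstep: "bisim m (cstep m p)"
  unfolding bisim_def
proof (intro allI impI ballI)
  fix x y k assume T: "cstep m p x y" and k: "k \<in> {1..<m}"
  have g: "letters_le m x" "letters_le m y" "Suc p < length x" "length y = length x"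
    using T cstep_letters_le[OF T] cstep_length[OF T] by (simp_all add: cstep_def)
  note f = g(1,2)[THEN letters_le_finite]
  note h = cstep_mx_rh[OF T k]
  have lower: "rel_option (cstep m p) (lower k x) (lower k y)"
  proof (cases "lower k x")
    case None
    then have "lower k y = None" using f g h by (simp add: lower_None_iff)
    then show ?thesis using None by simp
  next
    case (Some x')
    then show ?thesis using bisim_cstep_lower[OF T k] by fastforce
  qed
  have raise: "rel_option (cstep m p) (raise k x) (raise k y)"
  proof (cases "raise k x")
    case None
    then have "raise k y = None" using f g h by (simp add: raise_None_iff)
    then show ?thesis using None by simp
  next
    case (Some x')
    have g': "letters_le m x'" "length x' = length x" using letters_le_raise[OF g(1) k Some] by auto
    have l: "lower k x' = Some x" using lower_raise_inverse[OF f(1) Some] .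
    have "\<exists>y. cstep m p x y" using T by blast
    then have "\<exists>y'. cstep m p x' y'"
      using cstep_defined_iff[OF g(1,3)] cstep_defined_iff[OF g'(1)] g(3) g'(2)
        lower_mx_ch[OF g'(1) k l, of p] by simp
    then obtain y' where y': "cstep m p x' y'" ..
    obtain z where z: "lower k y' = Some z" "cstep m p x z" using bisim_cstep_lower[OF y' k l] by blast
    have "z = y" using cstep_fun[OF z(2) T] .
    then have "raise k y = Some y'"
      using raise_lower_inverse[OF letters_le_finite[OF cstep_letters_le[OF y']] z(1)] by simp
    then show ?thesis using Some y' by simp
  qed
  show "rel_option (cstep m p) (lower k x) (lower k y) \<and> rel_option (cstep m p) (raise k x) (raise k y)"
    using lower raise ..
qed

lemma tensors_iff: "b \<in> tensors m r s \<longleftrightarrow> length b = r \<and> letters_le m b \<and> sum_list (map card b) = s"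
  by (auto simp: tensors_def letters_le_def)

lemma card_exchange: "finite c \<Longrightarrow> a \<in> c \<Longrightarrow> a' \<notin> c \<Longrightarrow> card (insert a' (c - {a})) = card c"
  by (metis Diff_iff card_Suc_Diff1 card_insert_disjoint finite_Diff)

lemma map_card_update: "q < length b \<Longrightarrow> card c = card (b ! q) \<Longrightarrow> map card (b[q := c]) = map card b"
  by (metis length_map list_update_id map_update nth_map)

lemma lower_card:
  assumes "letters_le m b" "lower k b = Some b'" shows "map card b' = map card b"
proof -
  obtain q where q: "is_last (rh (mem b) k) (length b) q" "q < length b"
      "b' = b[q := insert (Suc k) (b ! q - {k})]"
    using lower_SomeD[OF letters_le_finite[OF assms(1)] assms(2)] by metis
  have "card (insert (Suc k) (b ! q - {k})) = card (b ! q)"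
    using rh_last_step[OF q(1,2)] letters_le_finite[OF assms(1)] q(2)
    by (intro card_exchange) (auto simp: mem_def)
  then show ?thesis unfolding q(3) by (rule map_card_update[OF q(2)])
qed

lemma raise_card:
  assumes "letters_le m b" "k \<in> {1..<m}" "raise k b = Some b'" shows "map card b' = map card b"
  using letters_le_raise[OF assms] lower_raise_inverse[OF letters_le_finite[OF assms(1)] assms(3)] lower_card by metis

lemma tensors_raise: "b \<in> tensors m r s \<Longrightarrow> k \<in> {1..<m} \<Longrightarrow> raise k b = Some b' \<Longrightarrow> b' \<in> tensors m r s"
  using raise_card letters_le_raise by (metis tensors_iff)

section \<open>Highest weights and uniqueness\<close>

text \<open>The usual string length: how many times the lowering operator \<open>k\<close> can be
  applied.\<close>

definition phi :: "nat \<Rightarrow> tensor \<Rightarrow> int" where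
  "phi k b = mx (rh (mem b) k) (length b) - rh (mem b) k (length b)"

lemma phi_nonneg: "phi k b \<ge> 0"
  by (simp add: phi_def mx_ge)

lemma lower_None_phi: "letters_le m b \<Longrightarrow> lower k b = None \<longleftrightarrow> phi k b = 0"
  by (auto simp: phi_def lower_None_iff[OF letters_le_finite])

lemma phi_lower:
  assumes "letters_le m b" "lower k b = Some b'" shows "phi k b' = phi k b - 1"
proof -
  obtain q where q: "is_last (rh (mem b) k) (length b) q" "q < length b"
      "b' = b[q := insert (Suc k) (b ! q - {k})]"
    using lower_SomeD[OF letters_le_finite[OF assms(1)] assms(2)] by metis
  note s = rh_last_step[OF q(1,2)]
  have m: "mem b' = rmove (mem b) k q" using q mem_rmove by simp
  have h: "rh (mem b') k r = rh (mem b) k r + (if q < r then 2 else 0)" for r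
    unfolding m by (rule rh_rmove) (use s in auto)
  have "is_first (rh (mem b') k) (length b) (Suc q)"
    by (rule is_first_bump[OF q(1,2) h]) (use s in \<open>simp add: rh_Suc\<close>)
  then have "mx (rh (mem b') k) (length b) = mx (rh (mem b) k) (length b) + 1"
    using s by (simp add: is_first_mx is_last_mx[OF q(1)] h rh_Suc[of "mem b"])
  moreover have "length b' = length b" using q(3) by simp
  ultimately show ?thesis using h[of "length b"] q(2) by (simp add: phi_def)
qed

lemma bisim_phi:
  assumes "bisim m T" "k \<in> {1..<m}" "T x y" "letters_le m x" "letters_le m y"
  shows "phi k x = phi k y"
  using assms(3-)
proof (induction "nat (phi k x)" arbitrary: x y)
  case 0
  then have "phi k x = 0" using phi_nonneg[of k x] by simp
  then have "lower k x = None" using lower_None_phi 0(3) by blast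
  moreover have "rel_option T (lower k x) (lower k y)"
    using assms(1,2) 0(2) by (simp add: bisim_def)
  ultimately have "lower k y = None" by simp
  then show ?case using \<open>phi k x = 0\<close> lower_None_phi 0(4) by metis
next
  case (Suc a)
  have "phi k x \<noteq> 0" using Suc.hyps(2) by auto
  then obtain x' where x': "lower k x = Some x'" using lower_None_phi Suc.prems(2) by blast
  have "rel_option T (lower k x) (lower k y)" using assms(1,2) Suc.prems by (simp add: bisim_def)
  then obtain y' where y': "lower k y = Some y'" "T x' y'" unfolding x' by (cases "lower k y") auto
  note g = letters_le_lower[OF Suc.prems(2) assms(2) x'] letters_le_lower[OF Suc.prems(3) assms(2) y'(1)]
  note p = phi_lower[OF Suc.prems(2) x'] phi_lower[OF Suc.prems(3) y'(1)]
  have "a = nat (phi k x')" using p(1) Suc.hyps(2) by simp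
  then have "phi k x' = phi k y'" using g y'(2) by (intro Suc.hyps(1)) auto
  then show ?case using p by simp
qed

text \<open>A termination measure rather than the weight of crystal theory: lowering increases it
  and raising decreases it, by one each.\<close>

definition weight :: "tensor \<Rightarrow> nat" where
  "weight b = sum_list (map (\<lambda>c. \<Sum>c) b)"

lemma weight_lower:
  assumes "letters_le m b" "lower k b = Some b'" shows "weight b' = Suc (weight b)"
proof -
  obtain q where q: "is_last (rh (mem b) k) (length b) q" "q < length b"
      "b' = b[q := insert (Suc k) (b ! q - {k})]"
    using lower_SomeD[OF letters_le_finite[OF assms(1)] assms(2)] by metis
  have f: "finite (b ! q)" using q(2) letters_le_finite[OF assms(1)] by simp
  note s = rh_last_step[OF q(1,2)]
  have "\<Sum>(insert (Suc k) (b ! q - {k})) = Suc (\<Sum>(b ! q))"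
    using s f by (simp add: mem_def sum.remove[of "b ! q" k])
  moreover have "\<Sum>(b ! q) \<le> sum_list (map (\<lambda>c. \<Sum>c) b)"
    using q(2) by (intro member_le_sum_list) auto
  ultimately show ?thesis using q(2) by (simp add: q(3) weight_def map_update sum_list_update)
qed

lemma weight_raise:
  assumes "letters_le m b" "k \<in> {1..<m}" "raise k b = Some b'" shows "weight b = Suc (weight b')"
  using weight_lower letters_le_raise[OF assms] lower_raise_inverse[OF letters_le_finite[OF assms(1)] assms(3)] by metis

definition highest :: "nat \<Rightarrow> tensor \<Rightarrow> bool" where
  "highest m b \<longleftrightarrow> (\<forall>k\<in>{1..<m}. raise k b = None)"

text \<open>Related elements are raised in parallel until both are of highest weight, where
  \<open>hw\<close> identifies them; lowering back along the same path carries the equality to the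
  start. With \<open>T\<close> composed of two isomorphisms this becomes their uniqueness.\<close>

lemma bisim_unique:
  assumes T: "bisim m T"
    and X: "\<And>z. z \<in> X \<Longrightarrow> letters_le m z"
    and raise: "\<And>z k z'. z \<in> X \<Longrightarrow> k \<in> {1..<m} \<Longrightarrow> raise k z = Some z' \<Longrightarrow> z' \<in> X"
    and hw: "\<And>z z'. z \<in> X \<Longrightarrow> z' \<in> X \<Longrightarrow> highest m z \<Longrightarrow> highest m z' \<Longrightarrow>
      (\<And>k. k \<in> {1..<m} \<Longrightarrow> phi k z = phi k z') \<Longrightarrow> z = z'"
    and "T y y'" "y \<in> X" "y' \<in> X"
  shows "y = y'"
  using assms(5-)
proof (induction "weight y" arbitrary: y y' rule: less_induct)
  case less
  have rel: "rel_option T (raise k y) (raise k y')" if "k \<in> {1..<m}" for k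
    using T that less.prems by (simp add: bisim_def)
  show ?case
  proof (cases "highest m y")
    case True
    then have "highest m y'" using rel unfolding highest_def by fastforce
    then show ?thesis using True less.prems hw bisim_phi[OF T] X by blast
  next
    case False
    then obtain k z where k: "k \<in> {1..<m}" "raise k y = Some z" by (auto simp: highest_def)
    then obtain z' where z': "raise k y' = Some z'" "T z z'" using rel[of k] by (auto simp: option_rel_Some1)
    have "z = z'"
    proof (rule less.hyps[OF _ z'(2)])
      show "weight z < weight y" using weight_raise[OF X k] less.prems by simp
      show "z \<in> X" "z' \<in> X" using raise[OF _ k] raise[OF _ k(1) z'(1)] less.prems by auto
    qed
    then show ?thesis
      using lower_raise_inverse[OF letters_le_finite[OF X] k(2)] lower_raise_inverse[OF letters_le_finite[OF X] z'(1)]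
        less.prems by simp
  qed
qed

section \<open>Components and crystal isomorphisms\<close>

definition closed :: "nat \<Rightarrow> tensor set \<Rightarrow> bool" where
  "closed m A \<longleftrightarrow> (\<forall>x\<in>A. \<forall>k\<in>{1..<m}. \<forall>y. lower k x = Some y \<or> raise k x = Some y \<longrightarrow> y \<in> A)"

lemma crystal_iso_bisim:
  assumes "crystal_iso m f A B" "closed m A"
  shows "bisim m (\<lambda>x y. x \<in> A \<and> y = f x)"
  unfolding bisim_def
proof (intro allI impI ballI)
  fix x y k assume xy: "x \<in> A \<and> y = f x" and k: "k \<in> {1..<m}"
  have *: "rel_option (\<lambda>x y. x \<in> A \<and> y = f x) a (map_option f a)" if "\<And>z. a = Some z \<Longrightarrow> z \<in> A" for a
    using that by (cases a) auto
  have l: "lower k y = map_option f (lower k x)" and r: "raise k y = map_option f (raise k x)"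
    using assms(1) xy k unfolding crystal_iso_def by metis+
  have "\<And>z. lower k x = Some z \<Longrightarrow> z \<in> A" "\<And>z. raise k x = Some z \<Longrightarrow> z \<in> A"
    using assms(2) xy k unfolding closed_def by blast+
  then show "rel_option (\<lambda>x y. x \<in> A \<and> y = f x) (lower k x) (lower k y) \<and>
      rel_option (\<lambda>x y. x \<in> A \<and> y = f x) (raise k x) (raise k y)"
    unfolding l r using * by blast
qed

lemma bisim_crystal_iso:
  assumes T: "bisim m T"
    and un: "\<And>x y y'. T x y \<Longrightarrow> T x y' \<Longrightarrow> y = y'" and inj: "\<And>x x' y. T x y \<Longrightarrow> T x' y \<Longrightarrow> x = x'"
    and AB: "\<And>x. x \<in> A \<Longrightarrow> \<exists>y\<in>B. T x y" and BA: "\<And>y. y \<in> B \<Longrightarrow> \<exists>x\<in>A. T x y"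
  shows "\<exists>f. crystal_iso m f A B \<and> (\<forall>x y. T x y \<longrightarrow> f x = y)"
proof -
  define f where "f x = (THE y. T x y)" for x
  have f: "f x = y" if "T x y" for x y
    unfolding f_def using that un by (intro the_equality) auto
  have "bij_betw f A B"
    unfolding bij_betw_def
  proof
    show "inj_on f A"
    proof (rule inj_onI)
      fix x x' assume "x \<in> A" "x' \<in> A" and e: "f x = f x'"
      then obtain y y' where y: "T x y" "T x' y'" using AB by blast
      then have "y = y'" using f e by simp
      then show "x = x'" using y inj by blast
    qed
    have "f x \<in> B" if "x \<in> A" for x using AB[OF that] f by auto
    moreover have "y \<in> f ` A" if "y \<in> B" for y using BA[OF that] f by blast
    ultimately show "f ` A = B" by blast
  qed
  moreover have "map_option f (lower k x) = lower k (f x) \<and> map_option f (raise k x) = raise k (f x)"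
    if "x \<in> A" "k \<in> {1..<m}" for x k
  proof -
    obtain y where y: "T x y" using AB \<open>x \<in> A\<close> by blast
    have *: "map_option f a = c" if "rel_option T a c" for a c
      using that by (cases a; cases c) (auto simp: f)
    have "rel_option T (lower k x) (lower k y)" "rel_option T (raise k x) (raise k y)"
      using T y that(2) by (auto simp: bisim_def)
    then show ?thesis unfolding f[OF y] using * by blast
  qed
  ultimately show ?thesis using f unfolding crystal_iso_def by blast
qed

lemma component_self: "b \<in> component m b"
  by (simp add: component_def)

lemma component_induct [consumes 1, case_names base step]:
  assumes "x \<in> component m b" "Q b"
    "\<And>y z k. y \<in> component m b \<Longrightarrow> Q y \<Longrightarrow> k \<in> {1..<m} \<Longrightarrow> lower k y = Some z \<or> raise k y = Some z \<Longrightarrow> Q z"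
  shows "Q x"
proof -
  let ?r = "{(x, y). \<exists>k\<in>{1..<m}. lower k x = Some y \<or> raise k x = Some y}"
  have "(b, x) \<in> ?r\<^sup>*" using assms(1) by (simp add: component_def)
  then have "x \<in> component m b \<and> Q x"
  proof (induction rule: rtrancl_induct)
    case base
    then show ?case using assms(2) component_self by blast
  next
    case (step y z)
    then have "z \<in> component m b"
      unfolding component_def by (auto intro: rtrancl_into_rtrancl)
    then show ?case using step assms(3) by blast
  qed
  then show ?thesis ..
qed

lemma component_step:
  "y \<in> component m b \<Longrightarrow> k \<in> {1..<m} \<Longrightarrow> lower k y = Some z \<or> raise k y = Some z \<Longrightarrow> z \<in> component m b"
  unfolding component_def Image_singleton_iff by (rule rtrancl_into_rtrancl) auto

lemma closed_component: "closed m (component m b)"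
  unfolding closed_def using component_step by blast

lemma bisim_component:
  assumes "bisim m T" "T b t" "x \<in> component m b"
  shows "\<exists>y\<in>component m t. T x y"
  using assms(3)
proof (induction rule: component_induct)
  case base
  then show ?case using assms(2) component_self by blast
next
  case (step y z k)
  then obtain y' where y': "y' \<in> component m t" "T y y'" by blast
  have "rel_option T (lower k y) (lower k y')" "rel_option T (raise k y) (raise k y')"
    using assms(1) y'(2) step.hyps(2) by (auto simp: bisim_def)
  with step.hyps(3) obtain z' where "T z z'" "lower k y' = Some z' \<or> raise k y' = Some z'"
    by (auto simp: option_rel_Some1)
  then show ?case using component_step[OF y'(1) step.hyps(2)] by blast
qed

section \<open>Duality\<close>

lemma length_dual [simp]: "length (dual n b) = n"
  by (simp add: dual_def)

lemma dual_nth: "i < n \<Longrightarrow> dual n b ! i = {j \<in> {1..length b}. Suc i \<in> b ! (length b - j)}"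
  by (simp add: dual_def col_def del: upt_Suc)

lemma letters_le_dual: "letters_le (length b) (dual n b)"
  by (auto simp: letters_le_def dual_def)

lemma mem_dual: "i < n \<Longrightarrow> mem (dual n b) j i \<longleftrightarrow> 1 \<le> j \<and> j \<le> length b \<and> mem b (Suc i) (length b - j)"
  by (simp add: mem_def dual_nth)

text \<open>The condition \<open>j + Suc p = length b\<close> matches the labels: letter
  \<open>j\<close> of the dual stands for the column at list position \<open>Suc p\<close>, and
  letter \<open>Suc j\<close> for the one at \<open>p\<close>.\<close>

lemma rh_dual:
  assumes "q \<le> n" "1 \<le> j" "j + Suc p = length b"
  shows "rh (mem (dual n b)) j q = ch (mem b) p q"
  unfolding rh_def ch_def
proof (rule sum.cong)
  fix t assume "t \<in> {..<q}"
  then have t: "t < n" using assms by simp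
  have "length b - j = Suc p" "length b - Suc j = p" "j < length b" using assms by auto
  then show "of_bool (mem (dual n b) (Suc j) t) - of_bool (mem (dual n b) j t) =
      (of_bool (mem b (Suc t) p) - of_bool (mem b (Suc t) (Suc p)) :: int)"
    using assms(2) by (simp add: mem_dual[OF t])
qed simp

lemma cstep_dual:
  assumes c: "cstep n p x y" and j: "1 \<le> j" "j + Suc p = length x"
  shows "lower j (dual n x) = Some (dual n y)"
proof -
  obtain i where i: "is_last (ch (mem x) p) n i" "i < n"
    and y: "y = x[p := insert (Suc i) (x ! p), Suc p := x ! Suc p - {Suc i}]"
    using c by (auto simp: cstep_def)
  have "is_last (rh (mem (dual n x)) j) (length (dual n x)) i"
    using i(1) is_last_cong[of n "rh (mem (dual n x)) j" "ch (mem x) p" i] rh_dual[OF _ j] by simp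
  then have "lower j (dual n x) = Some ((dual n x)[i := insert (Suc j) (dual n x ! i - {j})])"
    using lower_eq[OF letters_le_finite[OF letters_le_dual]] i(2) by simp
  moreover have "(dual n x)[i := insert (Suc j) (dual n x ! i - {j})] = dual n y" (is "?l = _")
  proof (rule nth_equalityI)
    fix r assume "r < length ?l"
    then have r: "r < n" by simp
    have l: "length y = length x" by (simp add: y)
    show "?l ! r = dual n y ! r"
      using r i(2) j by (auto simp: dual_nth nth_list_update l y)
  qed simp
  ultimately show ?thesis by simp
qed

section \<open>Tableaux\<close>

lemma sum_count: "(\<Sum>t<i. of_bool (Suc t \<in> c)) = int (card (c \<inter> {1..i}))"
proof (induction i)
  case (Suc i)
  have "c \<inter> {1..Suc i} = (if Suc i \<in> c then insert (Suc i) (c \<inter> {1..i}) else c \<inter> {1..i})"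
    by (auto simp: le_Suc_eq)
  then show ?case using Suc by simp
qed simp

lemma ch_card: "ch (mem x) p i = int (card (x ! p \<inter> {1..i})) - int (card (x ! Suc p \<inter> {1..i}))"
  by (simp add: ch_def mem_def sum_subtractf sum_count)

lemma nth_sorted_le_iff:
  fixes A :: "nat set"
  assumes "finite A" "r < card A"
  shows "sorted_list_of_set A ! r \<le> i \<longleftrightarrow> r < card {a \<in> A. a \<le> i}"
proof -
  define xs where "xs = sorted_list_of_set A"
  have xs: "sorted xs" "distinct xs" "set xs = A" "length xs = card A"
    using assms(1) by (simp_all add: xs_def)
  have "{a \<in> A. a \<le> i} = set (filter (\<lambda>a. a \<le> i) xs)" using xs(3) by auto
  then have c: "card {a \<in> A. a \<le> i} = card {j. j < length xs \<and> xs ! j \<le> i}"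
    using xs(2) by (simp add: distinct_card length_filter_conv_card del: set_filter)
  show ?thesis unfolding c xs_def[symmetric]
  proof
    assume "xs ! r \<le> i"
    then have "{..r} \<subseteq> {j. j < length xs \<and> xs ! j \<le> i}"
      using assms(2) xs(1,4) by (auto intro: order.trans[OF sorted_nth_mono])
    then have "card {..r} \<le> card {j. j < length xs \<and> xs ! j \<le> i}" by (intro card_mono) auto
    then show "r < card {j. j < length xs \<and> xs ! j \<le> i}" by simp
  next
    assume r: "r < card {j. j < length xs \<and> xs ! j \<le> i}"
    show "xs ! r \<le> i"
    proof (rule ccontr)
      assume "\<not> xs ! r \<le> i"
      then have "{j. j < length xs \<and> xs ! j \<le> i} \<subseteq> {..<r}"
        using assms(2) xs(1,4) by (auto simp: not_less dest: sorted_nth_mono order.trans)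
      then have "card {j. j < length xs \<and> xs ! j \<le> i} \<le> card {..<r}" by (intro card_mono) auto
      then show False using r by simp
    qed
  qed
qed

text \<open>Comparing sorted columns entry by entry amounts to comparing, for every bound
  \<open>i\<close>, how many entries are at most \<open>i\<close>. The shift \<open>t = 0\<close>
  serves for tableaux, a general \<open>t\<close> for \<open>H\<close>.\<close>

lemma shift_le_iff:
  fixes A B :: "nat set"
  assumes A: "A \<subseteq> {1..n}" and B: "B \<subseteq> {1..n}" and card: "card A \<le> t + card B"
  shows "(\<forall>r. t \<le> r \<and> r < card A \<longrightarrow> sorted_list_of_set B ! (r - t) \<le> sorted_list_of_set A ! r) \<longleftrightarrow>
    (\<forall>i\<le>n. card (A \<inter> {1..i}) \<le> t + card (B \<inter> {1..i}))"
proof -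
  have fin: "finite A" "finite B" using A B by (auto intro: finite_subset)
  have eq: "{a \<in> A. a \<le> i} = A \<inter> {1..i}" "{a \<in> B. a \<le> i} = B \<inter> {1..i}" for i
    using A B by auto
  note iff = nth_sorted_le_iff[OF fin(1), unfolded eq] nth_sorted_le_iff[OF fin(2), unfolded eq]
  show ?thesis
  proof (intro iffI allI impI)
    fix i assume *: "\<forall>r. t \<le> r \<and> r < card A \<longrightarrow> sorted_list_of_set B ! (r - t) \<le> sorted_list_of_set A ! r"
      and "i \<le> n"
    show "card (A \<inter> {1..i}) \<le> t + card (B \<inter> {1..i})"
    proof (rule ccontr)
      assume "\<not> card (A \<inter> {1..i}) \<le> t + card (B \<inter> {1..i})"
      then obtain r where r: "card (A \<inter> {1..i}) = Suc r" "t \<le> r" "card (B \<inter> {1..i}) \<le> r - t"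
        by (cases "card (A \<inter> {1..i})") auto
      have "card (A \<inter> {1..i}) \<le> card A" by (intro card_mono fin) auto
      then have rA: "r < card A" using r by simp
      then have "sorted_list_of_set A ! r \<le> i" using iff(1) r by simp
      then have "sorted_list_of_set B ! (r - t) \<le> i" using * rA r(2) by (meson order.trans)
      moreover have "r - t < card B" using card rA r(2) by linarith
      ultimately show False using iff(2) r(3) by simp
    qed
  next
    fix r assume *: "\<forall>i\<le>n. card (A \<inter> {1..i}) \<le> t + card (B \<inter> {1..i})" and r: "t \<le> r \<and> r < card A"
    define i where "i = sorted_list_of_set A ! r"
    have "i \<in> set (sorted_list_of_set A)" unfolding i_def using r fin by (intro nth_mem) simp
    then have "i \<le> n" using fin A by auto
    have "r < card (A \<inter> {1..i})" using iff(1)[of r i] r i_def by simp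
    also have "\<dots> \<le> t + card (B \<inter> {1..i})" using * \<open>i \<le> n\<close> by simp
    finally have "r - t < card (B \<inter> {1..i})" using r by linarith
    moreover have "r - t < card B" using card r by linarith
    ultimately show "sorted_list_of_set B ! (r - t) \<le> sorted_list_of_set A ! r"
      using iff(2) i_def by simp
  qed
qed

lemma mx_ch_eq_0_iff: "mx (ch (mem x) p) m = 0 \<longleftrightarrow>
    (\<forall>i\<le>m. card (x ! p \<inter> {1..i}) \<le> card (x ! Suc p \<inter> {1..i}))"
proof -
  have "mx (ch (mem x) p) m = 0 \<longleftrightarrow> mx (ch (mem x) p) m \<le> 0"
    using mx_ge[of 0 m "ch (mem x) p"] by auto
  then show ?thesis by (simp add: mx_le_iff ch_card)
qed

lemma is_tableau_iff:
  assumes g: "letters_le n b"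
  shows "is_tableau b \<longleftrightarrow> (\<forall>p. Suc p < length b \<longrightarrow> mx (ch (mem b) p) n = 0)"
proof -
  have *: "card (b ! p) \<le> card (b ! Suc p) \<and>
      (\<forall>r<card (b ! p). sorted_list_of_set (b ! Suc p) ! r \<le> sorted_list_of_set (b ! p) ! r) \<longleftrightarrow>
      mx (ch (mem b) p) n = 0" if p: "Suc p < length b" for p
  proof -
    have s: "b ! p \<subseteq> {1..n}" "b ! Suc p \<subseteq> {1..n}" using letters_le_nth[OF g] p by auto
    \<comment> \<open>The bound \<open>i = n\<close> yields the condition on the column
      lengths.\<close>
    have "card (b ! p) \<le> card (b ! Suc p)" if "mx (ch (mem b) p) n = 0"
      using that s by (auto simp: mx_ch_eq_0_iff Int_absorb2 dest!: spec[of _ n])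
    then show ?thesis
      using shift_le_iff[OF s, of 0] mx_ch_eq_0_iff[of b p n] by auto
  qed
  have c: "col b (j + 1) = b ! p \<and> col b j = b ! Suc p" if "j + Suc p = length b" for j p
    unfolding col_def that[symmetric] by simp
  show ?thesis
  proof
    assume t: "is_tableau b"
    show "\<forall>p. Suc p < length b \<longrightarrow> mx (ch (mem b) p) n = 0"
    proof (intro allI impI)
      fix p assume p: "Suc p < length b"
      define j where "j = length b - Suc p"
      have j: "j + Suc p = length b" "j \<in> {1..<length b}" using p by (auto simp: j_def)
      show "mx (ch (mem b) p) n = 0"
        using t j(2) *[OF p] c[OF j(1)] unfolding is_tableau_def by metis
    qed
  next
    assume t: "\<forall>p. Suc p < length b \<longrightarrow> mx (ch (mem b) p) n = 0"
    show "is_tableau b" unfolding is_tableau_def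
    proof (intro ballI)
      fix j assume j: "j \<in> {1..<length b}"
      define p where "p = length b - Suc j"
      have p: "j + Suc p = length b" "Suc p < length b" using j by (auto simp: p_def)
      show "card (col b (j + 1)) \<le> card (col b j) \<and> (\<forall>r<card (col b (j + 1)).
          sorted_list_of_set (col b j) ! r \<le> sorted_list_of_set (col b (j + 1)) ! r)"
        using t *[OF p(2)] p(2) c[OF p(1)] by metis
    qed
  qed
qed

text \<open>By \<open>is_tableau_iff\<close>, tableaux are recognised by the maxima of the column
  heights, which the row operators preserve.\<close>

lemma tableau_lower:
  assumes "letters_le n b" "k \<in> {1..<n}" "lower k b = Some b'"
  shows "is_tableau b' \<longleftrightarrow> is_tableau b"
  using letters_le_lower[OF assms] is_tableau_iff[of n] lower_mx_ch(1)[OF assms] assms(1) by auto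

lemma tableau_raise:
  assumes "letters_le n b" "k \<in> {1..<n}" "raise k b = Some b'"
  shows "is_tableau b' \<longleftrightarrow> is_tableau b"
  using tableau_lower[OF _ assms(2) lower_raise_inverse[OF letters_le_finite[OF assms(1)] assms(3)]]
    letters_le_raise[OF assms] by auto

lemma tableau_component:
  assumes "x \<in> component n t" "letters_le n t" "is_tableau t"
  shows "letters_le n x \<and> is_tableau x"
  using assms(1)
proof (induction rule: component_induct)
  case (step y z k)
  then show ?case using tableau_lower tableau_raise letters_le_lower letters_le_raise by metis
qed (use assms in auto)

section \<open>Highest weight tableaux\<close>

lemma highest_iff: "letters_le m z \<Longrightarrow> highest m z \<longleftrightarrow> (\<forall>k\<in>{1..<m}. mx (rh (mem z) k) (length z) = 0)"
  by (simp add: highest_def raise_None_iff[OF letters_le_finite])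

lemma initial_down:
  assumes "\<And>k. 1 \<le> k \<Longrightarrow> Suc k \<in> c \<Longrightarrow> k \<in> c" "i \<in> c" shows "{1..i} \<subseteq> c"
proof
  fix j assume "j \<in> {1..i}"
  then have "j \<le> i" "1 \<le> j" by auto
  then show "j \<in> c"
  proof (induction rule: inc_induct)
    case base show ?case by (rule assms(2))
  next
    case (step n) then show ?case using assms(1)[of n] by simp
  qed
qed

lemma highest_first_column:
  assumes g: "letters_le m z" and h: "highest m z" and "z \<noteq> []" "1 \<le> k" "Suc k \<in> z ! 0"
  shows "k \<in> z ! 0"
proof -
  have l: "0 < length z" using assms(3) by simp
  have "k \<in> {1..<m}" using letters_le_nth[OF g l] assms(4,5) by auto
  then have "rh (mem z) k (Suc 0) \<le> 0"
    using h g mx_ge[of "Suc 0" "length z" "rh (mem z) k"] l by (auto simp: highest_iff)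
  then show ?thesis using assms(5) by (cases "k \<in> z ! 0") (simp_all add: rh_Suc mem_def)
qed

text \<open>An initial segment is forced into the next column by the tableau inequalities. If that
  column contained \<open>Suc k\<close> without \<open>k\<close>, then neither letter would occur in
  any earlier column, and the row heights would become positive, against highest weight.\<close>

lemma highest_tableau_nested:
  assumes g: "letters_le n z" and h: "highest n z" and t: "is_tableau z" and "p < length z"
  shows "\<forall>p'\<le>p. (\<forall>k\<ge>1. Suc k \<in> z ! p' \<longrightarrow> k \<in> z ! p') \<and> z ! p' \<subseteq> z ! p"
  using assms(4)
proof (induction p)
  case 0
  then show ?case using highest_first_column[OF g h] by auto
next
  case (Suc p)
  then have IH: "\<And>p' k. p' \<le> p \<Longrightarrow> 1 \<le> k \<Longrightarrow> Suc k \<in> z ! p' \<Longrightarrow> k \<in> z ! p'"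
    "\<And>p'. p' \<le> p \<Longrightarrow> z ! p' \<subseteq> z ! p" by auto
  have sub: "z ! p \<subseteq> z ! Suc p"
  proof
    fix i assume i: "i \<in> z ! p"
    have "p < length z" using Suc.prems by simp
    then have i': "1 \<le> i" "i \<le> n" using letters_le_nth[OF g, of p] i by auto
    have "{1..i} \<subseteq> z ! p" using IH(1) i by (intro initial_down) auto
    then have "i = card (z ! p \<inter> {1..i})" by (simp add: Int_absorb1)
    also have "\<dots> \<le> card (z ! Suc p \<inter> {1..i})"
      using t Suc.prems i' mx_ch_eq_0_iff[of z p n] by (simp add: is_tableau_iff[OF g])
    finally have "z ! Suc p \<inter> {1..i} = {1..i}" by (intro card_seteq) auto
    moreover have "i \<in> {1..i}" using i' by simp
    ultimately show "i \<in> z ! Suc p" by blast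
  qed
  have init: "k \<in> z ! Suc p" if k: "1 \<le> k" "Suc k \<in> z ! Suc p" for k
  proof (cases "k \<in> z ! p")
    case True then show ?thesis using sub by auto
  next
    case False
    then have no: "k \<notin> z ! p'" "Suc k \<notin> z ! p'" if "p' \<le> p" for p'
      using IH that k by blast+
    then have "rh (mem z) k (Suc p) = 0" by (simp add: rh_def mem_def)
    then have "rh (mem z) k (Suc (Suc p)) = 1 - of_bool (k \<in> z ! Suc p)"
      using k(2) by (simp add: rh_Suc[of _ _ "Suc p"] mem_def)
    moreover have "k \<in> {1..<n}" using letters_le_nth[OF g Suc.prems] k by auto
    then have "rh (mem z) k (Suc (Suc p)) \<le> 0"
      using h g mx_ge[of "Suc (Suc p)" "length z" "rh (mem z) k"] Suc.prems by (auto simp: highest_iff)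
    ultimately show ?thesis by (cases "k \<in> z ! Suc p") simp_all
  qed
  show ?case
  proof (intro allI impI conjI)
    fix p' assume "p' \<le> Suc p"
    then consider "p' \<le> p" | "p' = Suc p" by (auto simp: le_Suc_eq)
    then show "z ! p' \<subseteq> z ! Suc p" and "\<And>k. 1 \<le> k \<Longrightarrow> Suc k \<in> z ! p' \<Longrightarrow> k \<in> z ! p'"
      using IH sub init by (cases; blast)+
  qed
qed

text \<open>Two final segments are comparable by inclusion, hence equal if they have the same
  size.\<close>

lemma upward_closed_unique:
  fixes U V :: "nat set"
  assumes "finite U" "finite V" "card U = card V"
    and "\<And>p q. p \<in> U \<Longrightarrow> p \<le> q \<Longrightarrow> q \<in> V \<Longrightarrow> q \<in> U"
    and "\<And>p q. p \<in> V \<Longrightarrow> p \<le> q \<Longrightarrow> q \<in> U \<Longrightarrow> q \<in> V"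
  shows "U = V"
proof -
  have "U \<subseteq> V \<or> V \<subseteq> U" using assms(4,5) by (meson nle_le subsetI)
  then show ?thesis using assms(1-3) card_subset_eq by metis
qed

lemma rh_mult: "rh (mem z) k (length z) = int (mult (Suc k) z) - int (mult k z)"
  by (simp add: rh_def mem_def mult_def sum_subtractf sum_of_bool_eq length_filter_conv_card
      lessThan_def Collect_conj_eq)

lemma sum_mult:
  assumes "letters_le n z" shows "(\<Sum>k\<in>{1..n}. mult k z) = sum_list (map card z)"
proof -
  have m: "mult k z = (\<Sum>p<length z. of_bool (k \<in> z ! p))" for k
    by (simp add: mult_def sum_of_bool_eq length_filter_conv_card lessThan_def Collect_conj_eq)
  have "(\<Sum>k\<in>{1..n}. mult k z) = (\<Sum>p<length z. \<Sum>k\<in>{1..n}. of_bool (k \<in> z ! p))"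
    unfolding m by (rule sum.swap)
  also have "\<dots> = (\<Sum>p<length z. card (z ! p))"
    using letters_le_nth[OF assms] by (intro sum.cong) (auto simp: sum_of_bool_eq Int_absorb1)
  finally show ?thesis by (simp add: sum_list_sum_nth atLeast0LessThan)
qed

text \<open>The string lengths give the differences of the multiplicities of successive letters, so
  the multiplicities in \<open>z\<close> and \<open>z'\<close> differ by one common constant; the
  common total \<open>s\<close> makes it zero. The multiplicities determine the tableau, because
  each letter occupies a final segment of the list.\<close>

lemma highest_tableau_unique:
  assumes n: "1 \<le> n" and z: "z \<in> tensors n l s" "highest n z" "is_tableau z"
    and z': "z' \<in> tensors n l s" "highest n z'" "is_tableau z'"
    and phi: "\<And>k. k \<in> {1..<n} \<Longrightarrow> phi k z = phi k z'"
  shows "z = z'"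
proof -
  have g: "letters_le n z" "length z = l" "letters_le n z'" "length z' = l"
    and s: "sum_list (map card z) = s" "sum_list (map card z') = s"
    using z(1) z'(1) by (auto simp: tensors_iff)
  define d where "d k = int (mult k z) - int (mult k z')" for k
  have d_Suc: "d (Suc k) = d k" if "k \<in> {1..<n}" for k
    using phi[OF that] z(2) z'(2) that g rh_mult[of z k] rh_mult[of z' k]
    by (simp add: phi_def highest_iff d_def)
  have d: "d k = d 1" if "1 \<le> k" "k \<le> n" for k
    using that by (induction k rule: dec_induct) (auto simp: d_Suc)
  have "(\<Sum>k\<in>{1..n}. d k) = 0"
    using sum_mult[OF g(1)] sum_mult[OF g(3)] s by (simp add: d_def sum_subtractf flip: of_nat_sum)
  moreover have "(\<Sum>k\<in>{1..n}. d k) = (\<Sum>k\<in>{1..n}. d 1)" by (intro sum.cong refl d) auto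
  ultimately have "d 1 = 0" using n by simp
  then have m: "mult k z = mult k z'" if "1 \<le> k" "k \<le> n" for k using d[OF that] by (simp add: d_def)
  have sub: "x ! p \<subseteq> x ! q" if "p \<le> q" "q < l" "x = z \<or> x = z'" for x p q
  proof -
    have "letters_le n x" "highest n x" "is_tableau x" "length x = l" using that(3) z z' g by auto
    then show ?thesis using highest_tableau_nested[of n x q] that(1,2) by blast
  qed
  have eq: "{p. p < l \<and> k \<in> z ! p} = {p. p < l \<and> k \<in> z' ! p}" if k: "1 \<le> k" "k \<le> n" for k
  proof (rule upward_closed_unique)
    show "card {p. p < l \<and> k \<in> z ! p} = card {p. p < l \<and> k \<in> z' ! p}"
      using m[OF k] g by (simp add: mult_def length_filter_conv_card)
  qed (use sub in auto)
  show ?thesis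
  proof (rule nth_equalityI)
    fix p assume p: "p < length z"
    have "k \<in> z ! p \<longleftrightarrow> k \<in> z' ! p" for k
    proof (cases "1 \<le> k \<and> k \<le> n")
      case True
      then show ?thesis using eq[of k] p g by auto
    next
      case False
      then show ?thesis using letters_le_nth[OF g(1), of p] letters_le_nth[OF g(3), of p] p g by auto
    qed
    then show "z ! p = z' ! p" by auto
  qed (use g in simp)
qed

section \<open>The tableau of a tensor\<close>

text \<open>Raising operators on the dual side.\<close>

definition up :: "nat \<Rightarrow> tensor \<Rightarrow> tensor \<Rightarrow> bool" where
  "up n x y \<longleftrightarrow> (\<exists>p. cstep n p y x)"

text \<open>Each step contributes the converse of one \<open>cstep\<close>, which is single-valued
  in both directions; \<open>T\<close> is the composite of these converses.\<close>

lemma up_star_bisim: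
  assumes "(up n)\<^sup>*\<^sup>* b t"
  shows "\<exists>T. bisim n T \<and> (\<forall>x y y'. T x y \<longrightarrow> T x y' \<longrightarrow> y = y') \<and>
    (\<forall>x x' y. T x y \<longrightarrow> T x' y \<longrightarrow> x = x') \<and> T b t"
  using assms
proof (induction rule: rtranclp_induct)
  case base
  show ?case using bisim_eq by (intro exI[of _ "(=)"]) auto
next
  case (step y z)
  then obtain T p where T: "bisim n T" "\<And>x y y'. T x y \<Longrightarrow> T x y' \<Longrightarrow> y = y'"
    "\<And>x x' y. T x y \<Longrightarrow> T x' y \<Longrightarrow> x = x'" "T b y" and p: "cstep n p z y" by (auto simp: up_def)
  have "bisim n (T OO (cstep n p)\<inverse>\<inverse>)" by (intro bisim_OO bisim_conversep T bisim_cstep)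
  moreover have "(T OO (cstep n p)\<inverse>\<inverse>) b z" using T(4) p by auto
  moreover have "x = x'" if "(T OO (cstep n p)\<inverse>\<inverse>) x y" "(T OO (cstep n p)\<inverse>\<inverse>) x' y" for x x' y
    using that T(3) by (auto dest: cstep_fun)
  moreover have "y = y'" if a: "(T OO (cstep n p)\<inverse>\<inverse>) x y" "(T OO (cstep n p)\<inverse>\<inverse>) x y'" for x y y'
  proof -
    obtain u u' where "T x u" "cstep n p y u" "T x u'" "cstep n p y' u'" using a by auto
    then show ?thesis using T(2) cstep_inj by blast
  qed
  ultimately show ?case by blast
qed

lemma cstep_card:
  assumes "cstep m p x y"
  shows "card (y ! p) = Suc (card (x ! p))" "Suc (card (y ! Suc p)) = card (x ! Suc p)"
    "q \<noteq> p \<Longrightarrow> q \<noteq> Suc p \<Longrightarrow> y ! q = x ! q"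
proof -
  obtain i where i: "is_last (ch (mem x) p) m i" "i < m" and g: "letters_le m x" "Suc p < length x"
    and y: "y = x[p := insert (Suc i) (x ! p), Suc p := x ! Suc p - {Suc i}]"
    using assms by (auto simp: cstep_def)
  have f: "finite (x ! p)" "finite (x ! Suc p)" using letters_le_finite[OF g(1)] g(2) by auto
  note s = ch_last_step[OF i]
  show "card (y ! p) = Suc (card (x ! p))" using f s g(2) by (simp add: y mem_def)
  show "Suc (card (y ! Suc p)) = card (x ! Suc p)"
    using f s g(2) by (simp add: y mem_def card_Suc_Diff1 del: card_Diff_insert)
  show "q \<noteq> p \<Longrightarrow> q \<noteq> Suc p \<Longrightarrow> y ! q = x ! q" by (simp add: y)
qed

lemma cstep_tensors:
  assumes "cstep n p x y" shows "x \<in> tensors n l s \<longleftrightarrow> y \<in> tensors n l s"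
proof -
  have g: "letters_le n x" "letters_le n y" "length y = length x" "Suc p < length x"
    using assms cstep_letters_le[OF assms] cstep_length[OF assms] by (simp_all add: cstep_def)
  let ?N = "{..<length x} - {p} - {Suc p}"
  have "sum_list (map card z) = card (z ! p) + (card (z ! Suc p) + (\<Sum>q\<in>?N. card (z ! q)))"
    if "length z = length x" for z :: tensor
    using that g(4) by (simp add: sum_list_sum_nth atLeast0LessThan sum.remove[of "{..<length x}" p]
        sum.remove[of "{..<length x} - {p}" "Suc p"])
  moreover have "(\<Sum>q\<in>?N. card (y ! q)) = (\<Sum>q\<in>?N. card (x ! q))"
    using cstep_card(3)[OF assms] by (intro sum.cong) auto
  ultimately have "sum_list (map card x) = sum_list (map card y)"
    using g(3) cstep_card(1,2)[OF assms] by simp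
  then show ?thesis using g by (simp add: tensors_iff)
qed

lemma up_star_tensors: "(up n)\<^sup>*\<^sup>* b t \<Longrightarrow> b \<in> tensors n l s \<Longrightarrow> t \<in> tensors n l s"
  by (induction rule: rtranclp_induct) (auto simp: up_def cstep_tensors)

text \<open>If \<open>b\<close> is not a tableau, some column heights have a nonzero maximum, so a
  step of \<open>up\<close> exists. On the dual it is a raising, which decreases the sum of the
  letters there.\<close>

lemma up_star_tableau:
  assumes "b \<in> tensors n l s"
  shows "\<exists>t. (up n)\<^sup>*\<^sup>* b t \<and> is_tableau t"
  using assms
proof (induction "weight (dual n b)" arbitrary: b rule: less_induct)
  case less
  have g: "letters_le n b" using less.prems by (simp add: tensors_iff)
  show ?case
  proof (cases "is_tableau b")
    case False
    then obtain p where p: "Suc p < length b" "mx (ch (mem b) p) n \<noteq> 0"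
      by (auto simp: is_tableau_iff[OF g])
    then obtain x where x: "cstep n p x b" using cstep_pred[OF g] by blast
    have l: "length x = length b" using cstep_length[OF x] by simp
    have "lower (length x - Suc p) (dual n x) = Some (dual n b)"
      using p l by (intro cstep_dual[OF x]) auto
    then have "weight (dual n x) < weight (dual n b)" using weight_lower[OF letters_le_dual] by fastforce
    moreover have "x \<in> tensors n l s" using cstep_tensors[OF x] less.prems by simp
    ultimately obtain t where "(up n)\<^sup>*\<^sup>* x t" "is_tableau t" using less.hyps by blast
    moreover have "up n b x" using x by (auto simp: up_def)
    ultimately show ?thesis by (meson converse_rtranclp_into_rtranclp)
  qed blast
qed

text \<open>The composite of the steps restricts to an isomorphism of components. Any other
  candidate \<open>t'\<close> is related to \<open>t\<close> through \<open>b\<close>, and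
  \<open>bisim_unique\<close> applies to the set of tableaux in \<open>F(s)\<close>.\<close>

lemma P_eq:
  assumes n: "1 \<le> n" and b: "b \<in> tensors n l s" and t: "(up n)\<^sup>*\<^sup>* b t" "is_tableau t"
  shows "P n b = t"
  unfolding P_def
proof (rule the_equality)
  have l: "length b = l" "sum_list (map card b) = s" using b by (auto simp: tensors_iff)
  obtain T where T: "bisim n T" "\<And>x y y'. T x y \<Longrightarrow> T x y' \<Longrightarrow> y = y'"
    "\<And>x x' y. T x y \<Longrightarrow> T x' y \<Longrightarrow> x = x'" "T b t" using up_star_bisim[OF t(1)] by blast
  have tt: "t \<in> tensors n l s" using up_star_tensors[OF t(1) b] .
  then have gt: "letters_le n t" by (simp add: tensors_iff)
  have "(T\<inverse>\<inverse>) t b" using T(4) by simp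
  then have "\<exists>f. crystal_iso n f (component n b) (component n t) \<and> (\<forall>x y. T x y \<longrightarrow> f x = y)"
    using bisim_component[OF bisim_conversep[OF T(1)]] bisim_component[OF T(1,4)]
    by (intro bisim_crystal_iso[OF T(1-3)]) auto
  then obtain f where f: "crystal_iso n f (component n b) (component n t)" "\<And>x y. T x y \<Longrightarrow> f x = y"
    by blast
  show "t \<in> tensors n (length b) (sum_list (map card b)) \<and> (\<forall>x\<in>component n t. is_tableau x) \<and>
      (\<exists>\<phi>. crystal_iso n \<phi> (component n b) (component n t) \<and> \<phi> b = t)"
    using tt l f T(4) tableau_component[OF _ gt t(2)] by blast
  fix t' assume t': "t' \<in> tensors n (length b) (sum_list (map card b)) \<and> (\<forall>x\<in>component n t'. is_tableau x) \<and>
      (\<exists>\<phi>. crystal_iso n \<phi> (component n b) (component n t') \<and> \<phi> b = t')"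
  then obtain f' where f': "crystal_iso n f' (component n b) (component n t')" "f' b = t'" by blast
  let ?T = "\<lambda>x y. x \<in> component n b \<and> y = f' x"
  have T': "bisim n (?T\<inverse>\<inverse> OO T)"
    by (intro bisim_OO bisim_conversep T(1) crystal_iso_bisim[OF f'(1) closed_component])
  show "t' = t"
  proof (rule bisim_unique[OF T', where X = "{x \<in> tensors n l s. is_tableau x}"])
    show "(?T\<inverse>\<inverse> OO T) t' t" using f'(2) T(4) component_self by auto
    show "t' \<in> {x \<in> tensors n l s. is_tableau x}" using t' l component_self by auto
    show "t \<in> {x \<in> tensors n l s. is_tableau x}" using tt t by auto
  next
    fix z k z' assume "z \<in> {x \<in> tensors n l s. is_tableau x}" "k \<in> {1..<n}" "raise k z = Some z'"
    then show "z' \<in> {x \<in> tensors n l s. is_tableau x}"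
      using tensors_raise tableau_raise by (auto simp: tensors_iff)
  qed (use highest_tableau_unique[OF n] in \<open>auto simp: tensors_iff\<close>)
qed

section \<open>The combinatorial R-matrix and the local energy\<close>

lemma relpowp_cstep_props:
  assumes "(cstep m p ^^ r) x y" "letters_le m x" "Suc p < length x"
  shows "letters_le m y" "length y = length x"
    "mx (ch (mem y) p) m = mx (ch (mem x) p) m + int r" "ch (mem y) p m = ch (mem x) p m + 2 * int r"
    "card (y ! p) = card (x ! p) + r" "card (x ! Suc p) = card (y ! Suc p) + r"
    "\<And>q. q \<noteq> p \<Longrightarrow> q \<noteq> Suc p \<Longrightarrow> y ! q = x ! q"
    "x ! p \<union> x ! Suc p = y ! p \<union> y ! Suc p" "x ! p \<inter> x ! Suc p = y ! p \<inter> y ! Suc p"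
proof -
  have "letters_le m y \<and> length y = length x \<and>
    mx (ch (mem y) p) m = mx (ch (mem x) p) m + int r \<and> ch (mem y) p m = ch (mem x) p m + 2 * int r \<and>
    card (y ! p) = card (x ! p) + r \<and> card (x ! Suc p) = card (y ! Suc p) + r \<and>
    (\<forall>q. q \<noteq> p \<longrightarrow> q \<noteq> Suc p \<longrightarrow> y ! q = x ! q) \<and>
    x ! p \<union> x ! Suc p = y ! p \<union> y ! Suc p \<and> x ! p \<inter> x ! Suc p = y ! p \<inter> y ! Suc p"
    using assms(1)
  proof (induction r arbitrary: y)
    case 0
    then show ?case using assms by simp
  next
    case (Suc r)
    then obtain z where z: "(cstep m p ^^ r) x z" "cstep m p z y" by auto
    note IH = Suc.IH[OF z(1)]
    obtain i where i: "is_last (ch (mem z) p) m i" "i < m" and l: "Suc p < length z"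
      and y: "y = z[p := insert (Suc i) (z ! p), Suc p := z ! Suc p - {Suc i}]"
      using z(2) by (auto simp: cstep_def)
    have "z ! p \<union> z ! Suc p = y ! p \<union> y ! Suc p" "z ! p \<inter> z ! Suc p = y ! p \<inter> y ! Suc p"
      using ch_last_step[OF i] l by (auto simp: y mem_def)
    then show ?case
      using IH cstep_letters_le[OF z(2)] cstep_length[OF z(2)] cstep_heights[OF z(2)] cstep_card[OF z(2)] by simp
  qed
  then show "letters_le m y" "length y = length x"
    "mx (ch (mem y) p) m = mx (ch (mem x) p) m + int r" "ch (mem y) p m = ch (mem x) p m + 2 * int r"
    "card (y ! p) = card (x ! p) + r" "card (x ! Suc p) = card (y ! Suc p) + r"
    "\<And>q. q \<noteq> p \<Longrightarrow> q \<noteq> Suc p \<Longrightarrow> y ! q = x ! q"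
    "x ! p \<union> x ! Suc p = y ! p \<union> y ! Suc p" "x ! p \<inter> x ! Suc p = y ! p \<inter> y ! Suc p"
    by blast+
qed

lemma relpowp_cstep_exists:
  assumes "letters_le m x" "Suc p < length x" "int r \<le> mx (ch (mem x) p) m - ch (mem x) p m"
  shows "\<exists>y. (cstep m p ^^ r) x y"
  using assms(3)
proof (induction r)
  case (Suc r)
  then obtain y where y: "(cstep m p ^^ r) x y" by auto
  note pr = relpowp_cstep_props[OF y assms(1,2)]
  have "\<exists>z. cstep m p y z"
    using Suc.prems pr assms(2) by (subst cstep_defined_iff) auto
  then show ?case using y by auto
qed simp

lemma relpowp_cstep_exists_pred:
  assumes "letters_le m y" "Suc p < length y" "int r \<le> mx (ch (mem y) p) m"
  shows "\<exists>x. letters_le m x \<and> length x = length y \<and> (cstep m p ^^ r) x y"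
  using assms
proof (induction r arbitrary: y)
  case (Suc r)
  then obtain x where x: "cstep m p x y" using cstep_pred by fastforce
  have "letters_le m x" "length x = length y" using x cstep_length[OF x] by (auto simp: cstep_def)
  moreover have "int r \<le> mx (ch (mem x) p) m" using cstep_heights(1)[OF x] Suc.prems by simp
  ultimately obtain z where "letters_le m z" "length z = length x" "(cstep m p ^^ r) z x"
    using Suc.IH[of x] Suc.prems(2) by auto
  then show ?case using x \<open>length x = length y\<close> by (auto intro!: exI[of _ z])
qed auto

lemma relpowp_cstep_fun: "(cstep m p ^^ r) x y \<Longrightarrow> (cstep m p ^^ r) x y' \<Longrightarrow> y = y'"
  by (induction r arbitrary: y y') (auto dest: cstep_fun)

lemma relpowp_cstep_inj: "(cstep m p ^^ r) x y \<Longrightarrow> (cstep m p ^^ r) x' y \<Longrightarrow> x = x'"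
  by (induction r arbitrary: y) (auto dest: cstep_inj)

lemma ch_pair: "ch (mem x) p = ch (mem [x ! p, x ! Suc p]) 0"
  by (rule ext) (simp add: ch_card)

lemma relpowp_cstep_local:
  assumes "(cstep m p ^^ r) x y"
  shows "(cstep m 0 ^^ r) [x ! p, x ! Suc p] [y ! p, y ! Suc p]"
  using assms
proof (induction r arbitrary: y)
  case (Suc r)
  then obtain z where z: "(cstep m p ^^ r) x z" "cstep m p z y" by auto
  obtain i where i: "is_last (ch (mem z) p) m i" "i < m" and l: "letters_le m z" "Suc p < length z"
    and y: "y = z[p := insert (Suc i) (z ! p), Suc p := z ! Suc p - {Suc i}]"
    using z(2) by (auto simp: cstep_def)
  have "letters_le m [z ! p, z ! Suc p]" using letters_le_nth[OF l(1), of p] letters_le_nth[OF l] l(2) by (simp add: letters_le_def)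
  then have "cstep m 0 [z ! p, z ! Suc p] [y ! p, y ! Suc p]"
    using i l(2) unfolding ch_pair[of z p] by (auto simp: cstep_def y intro!: exI[of _ i])
  then show ?case using Suc.IH[OF z(1)] by auto
qed simp

section \<open>Reflection along strings\<close>

text \<open>
  The combinatorial R-matrix of two columns is the reflection of the strings of the operators
  \<open>cstep\<close>: as these commute with the crystal operators, so does the reflection.
\<close>

definition reflects :: "nat \<Rightarrow> nat \<Rightarrow> tensor \<Rightarrow> tensor \<Rightarrow> bool" where
  "reflects m p x y \<longleftrightarrow> letters_le m x \<and> letters_le m y \<and> Suc p < length x \<and> length y = length x \<and>
     (if card (x ! p) \<le> card (x ! Suc p)
      then (cstep m p ^^ (card (x ! Suc p) - card (x ! p))) x y
      else (cstep m p ^^ (card (x ! p) - card (x ! Suc p))) y x)"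

lemma ch_end: "letters_le m x \<Longrightarrow> Suc p < length x \<Longrightarrow> ch (mem x) p m = int (card (x ! p)) - int (card (x ! Suc p))"
  using letters_le_nth[of m x p] letters_le_nth[of m x "Suc p"] by (simp add: ch_card Int_absorb2)

lemma mx_ch_nonneg: "mx (ch (mem x) p) m \<ge> 0"
  using mx_ge[of 0 m "ch (mem x) p"] by simp

text \<open>The number of steps needed is the difference of the two sizes, which is the final height
  up to sign. The string is long enough in the required direction, since the maximum is at least 0
  and at least the final height.\<close>

lemma reflects_exists:
  assumes "letters_le m x" "Suc p < length x"
  shows "\<exists>y. reflects m p x y"
proof (cases "card (x ! p) \<le> card (x ! Suc p)")
  case True
  then obtain y where y: "(cstep m p ^^ (card (x ! Suc p) - card (x ! p))) x y"
    using relpowp_cstep_exists[OF assms, of "card (x ! Suc p) - card (x ! p)"]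
      mx_ch_nonneg[of x p m] ch_end[OF assms] by auto
  then show ?thesis using True relpowp_cstep_props(1,2)[OF y assms] assms
    by (auto simp: reflects_def)
next
  case False
  have "int (card (x ! p) - card (x ! Suc p)) \<le> mx (ch (mem x) p) m"
    using False mx_ge[of m m "ch (mem x) p"] ch_end[OF assms] by simp
  then obtain y where "letters_le m y \<and> length y = length x \<and> (cstep m p ^^ (card (x ! p) - card (x ! Suc p))) y x"
    using relpowp_cstep_exists_pred[OF assms] by blast
  then show ?thesis using False assms by (auto simp: reflects_def)
qed

lemma reflects_props:
  assumes "reflects m p x y"
  shows "card (y ! p) = card (x ! Suc p)" "card (y ! Suc p) = card (x ! p)"
    "\<And>q. q \<noteq> p \<Longrightarrow> q \<noteq> Suc p \<Longrightarrow> y ! q = x ! q"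
    "x ! p \<union> x ! Suc p = y ! p \<union> y ! Suc p" "x ! p \<inter> x ! Suc p = y ! p \<inter> y ! Suc p"
proof -
  have g: "letters_le m x" "letters_le m y" "Suc p < length x" "Suc p < length y"
    using assms by (auto simp: reflects_def)
  consider "card (x ! p) \<le> card (x ! Suc p)" "(cstep m p ^^ (card (x ! Suc p) - card (x ! p))) x y"
    | "\<not> card (x ! p) \<le> card (x ! Suc p)" "(cstep m p ^^ (card (x ! p) - card (x ! Suc p))) y x"
    using assms by (auto simp: reflects_def split: if_splits)
  then have "card (y ! p) = card (x ! Suc p) \<and> card (y ! Suc p) = card (x ! p) \<and>
    (\<forall>q. q \<noteq> p \<longrightarrow> q \<noteq> Suc p \<longrightarrow> y ! q = x ! q) \<and>
    x ! p \<union> x ! Suc p = y ! p \<union> y ! Suc p \<and> x ! p \<inter> x ! Suc p = y ! p \<inter> y ! Suc p"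
  proof cases
    case 1
    show ?thesis using relpowp_cstep_props[OF 1(2) g(1,3)] 1(1) by simp
  next
    case 2
    show ?thesis using relpowp_cstep_props[OF 2(2) g(2,4)] 2(1) by simp
  qed
  then show "card (y ! p) = card (x ! Suc p)" "card (y ! Suc p) = card (x ! p)"
    "\<And>q. q \<noteq> p \<Longrightarrow> q \<noteq> Suc p \<Longrightarrow> y ! q = x ! q"
    "x ! p \<union> x ! Suc p = y ! p \<union> y ! Suc p" "x ! p \<inter> x ! Suc p = y ! p \<inter> y ! Suc p"
    by blast+
qed

lemma reflects_sym:
  assumes "reflects m p x y" shows "reflects m p y x"
proof -
  have g: "letters_le m x" "letters_le m y" "Suc p < length x" "Suc p < length y" "length y = length x"
    using assms by (auto simp: reflects_def)
  note pr = reflects_props(1,2)[OF assms]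
  show ?thesis
  proof (cases "card (x ! p) = card (x ! Suc p)")
    case True
    then have "y = x" using assms by (simp add: reflects_def)
    then show ?thesis using assms by simp
  next
    case False
    then show ?thesis using assms g pr unfolding reflects_def by (auto split: if_splits)
  qed
qed

lemma reflects_fun:
  assumes "reflects m p x y" "reflects m p x y'" shows "y = y'"
  using assms relpowp_cstep_fun relpowp_cstep_inj by (auto simp: reflects_def split: if_splits)

lemma map_card_nth: "map card x' = map card x \<Longrightarrow> q < length x \<Longrightarrow> card (x' ! q) = card (x ! q)"
  by (metis length_map nth_map)

text \<open>Crystal operators keep the sizes of the columns, hence also the direction and the number
  of steps of the reflection.\<close>

lemma bisim_reflects: "bisim m (reflects m p)"
  unfolding bisim_def
proof (intro allI impI ballI)
  fix x y k assume xy: "reflects m p x y" and k: "k \<in> {1..<m}"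
  have g: "letters_le m x" "letters_le m y" "Suc p < length x" "length y = length x"
    using xy by (auto simp: reflects_def)
  have *: "rel_option (reflects m p) a c"
    if T: "rel_option (if card (x ! p) \<le> card (x ! Suc p)
        then cstep m p ^^ (card (x ! Suc p) - card (x ! p))
        else (cstep m p ^^ (card (x ! p) - card (x ! Suc p)))\<inverse>\<inverse>) a c"
      and a: "\<And>x'. a = Some x' \<Longrightarrow> letters_le m x' \<and> length x' = length x \<and> map card x' = map card x"
      and c: "\<And>y'. c = Some y' \<Longrightarrow> letters_le m y' \<and> length y' = length y" for a c
  proof (cases a)
    case (Some x')
    then obtain y' where y': "c = Some y'" using T by (cases c) auto
    show ?thesis using T a[OF Some] c[OF y'] g Some y' map_card_nth[of x' x p] map_card_nth[of x' x "Suc p"]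
      by (auto simp: reflects_def split: if_splits)
  qed (use T in auto)
  let ?T = "if card (x ! p) \<le> card (x ! Suc p)
        then cstep m p ^^ (card (x ! Suc p) - card (x ! p))
        else (cstep m p ^^ (card (x ! p) - card (x ! Suc p)))\<inverse>\<inverse>"
  have "bisim m ?T" using bisim_relpowp[OF bisim_cstep] bisim_conversep by auto
  moreover have "?T x y" using xy by (auto simp: reflects_def)
  ultimately have "rel_option ?T (lower k x) (lower k y)" "rel_option ?T (raise k x) (raise k y)"
    using k unfolding bisim_def by blast+
  then show "rel_option (reflects m p) (lower k x) (lower k y) \<and> rel_option (reflects m p) (raise k x) (raise k y)"
    using *[of "lower k x" "lower k y"] *[of "raise k x" "raise k y"] letters_le_lower[OF _ k] letters_le_raise[OF _ k] g
      lower_card[OF g(1)] raise_card[OF g(1) k] by blast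
qed

lemma reflects_local:
  assumes "reflects m p x y" shows "reflects m 0 [x ! p, x ! Suc p] [y ! p, y ! Suc p]"
proof -
  have g: "letters_le m x" "letters_le m y" "Suc p < length x" "Suc p < length y"
    using assms by (auto simp: reflects_def)
  have "letters_le m [x ! p, x ! Suc p]" "letters_le m [y ! p, y ! Suc p]"
    using letters_le_nth[OF g(1)] letters_le_nth[OF g(2)] g(3,4) by (simp_all add: letters_le_def)
  then show ?thesis using assms relpowp_cstep_local unfolding reflects_def by auto
qed

section \<open>Products of two columns and the R-matrix\<close>

lemma column_product_iff: "x \<in> column_product l k k' \<longleftrightarrow> letters_le l x \<and> map card x = [k, k']"
  by (auto simp: column_product_def letters_le_def subset_iff)

lemma column_product_lower: "x \<in> column_product l a c \<Longrightarrow> k \<in> {1..<l} \<Longrightarrow> lower k x = Some y \<Longrightarrow> y \<in> column_product l a c"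
  unfolding column_product_iff using lower_card letters_le_lower by metis

lemma column_product_raise: "x \<in> column_product l a c \<Longrightarrow> k \<in> {1..<l} \<Longrightarrow> raise k x = Some y \<Longrightarrow> y \<in> column_product l a c"
  unfolding column_product_iff using raise_card letters_le_raise by metis

lemma closed_column_product: "closed l (column_product l a c)"
  unfolding closed_def using column_product_lower column_product_raise by blast

lemma initial_eq:
  fixes c :: "nat set"
  assumes "c \<subseteq> {1..n}" "\<And>k. 1 \<le> k \<Longrightarrow> Suc k \<in> c \<Longrightarrow> k \<in> c"
  shows "c = {1..card c}"
proof (cases "c = {}")
  case False
  have f: "finite c" using assms(1) finite_subset by blast
  have "{1..Max c} \<subseteq> c" by (rule initial_down) (use assms(2) Max_in[OF f False] in auto)
  moreover have "c \<subseteq> {1..Max c}" using assms(1) f by auto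
  ultimately have "c = {1..Max c}" by blast
  then show ?thesis by (metis card_atLeastAtMost diff_Suc_1)
qed simp

lemma highest_first:
  assumes "letters_le m z" "highest m z" "z \<noteq> []" shows "z ! 0 = {1..card (z ! 0)}"
  using letters_le_nth[OF assms(1), of 0] highest_first_column[OF assms] assms(3) by (intro initial_eq) auto

text \<open>The first column of a highest weight element is an initial segment, known from its size.
  The string lengths then fix the differences of successive indicators of the second column, and its
  size fixes the remaining constant: the product is multiplicity free.\<close>

lemma column_product_unique:
  assumes z: "z \<in> column_product l a c" "highest l z" and z': "z' \<in> column_product l a c" "highest l z'"
    and phi: "\<And>k. k \<in> {1..<l} \<Longrightarrow> phi k z = phi k z'"
  shows "z = z'"
proof -
  obtain u v where uv: "z = [u, v]" "card u = a" "card v = c" "u \<subseteq> {1..l}" "v \<subseteq> {1..l}"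
    using z(1) by (auto simp: column_product_def)
  obtain u' v' where uv': "z' = [u', v']" "card u' = a" "card v' = c" "u' \<subseteq> {1..l}" "v' \<subseteq> {1..l}"
    using z'(1) by (auto simp: column_product_def)
  have g: "letters_le l z" "letters_le l z'" using z z' by (auto simp: column_product_iff)
  have u: "u = u'" using highest_first[OF g(1) z(2)] highest_first[OF g(2) z'(2)] uv uv' by simp
  define d :: "nat \<Rightarrow> int" where "d k = of_bool (k \<in> v) - of_bool (k \<in> v')" for k
  have d_Suc: "d (Suc k) = d k" if "k \<in> {1..<l}" for k
    using phi[OF that] z(2) z'(2) that g u
    by (simp add: phi_def highest_iff uv uv' d_def rh_Suc[of _ _ 0, simplified] rh_Suc[of _ _ "Suc 0"] mem_def)
  have d: "d k = d 1" if "1 \<le> k" "k \<le> l" for k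
    using that by (induction k rule: dec_induct) (auto simp: d_Suc)
  have "(\<Sum>k\<in>{1..l}. of_bool (k \<in> w)) = int (card w)" if "w \<subseteq> {1..l}" for w
    using that by (simp add: sum_of_bool_eq Int_absorb1)
  then have "(\<Sum>k\<in>{1..l}. d k) = 0" using uv uv' by (simp add: d_def sum_subtractf)
  moreover have "(\<Sum>k\<in>{1..l}. d k) = (\<Sum>k\<in>{1..l}. d 1)" by (intro sum.cong refl d) auto
  ultimately have "l = 0 \<or> d 1 = 0" by simp
  then have "d k = 0" if "k \<in> {1..l}" for k using that d[of k] by auto
  then have "k \<in> v \<longleftrightarrow> k \<in> v'" if "k \<in> {1..l}" for k
    using that by (fastforce simp: d_def split: if_splits)
  then have "v = v'" using uv uv' by blast
  then show ?thesis using u uv uv' by simp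
qed

text \<open>Reflection is a symmetric, single-valued bisimulation that exchanges the two sizes,
  hence an isomorphism; \<open>bisim_unique\<close> shows that any other one agrees with it.\<close>

lemma R2_eq:
  assumes xy: "reflects l 0 [d, d'] y" shows "R2 l d d' = y"
proof -
  let ?A = "column_product l (card d) (card d')" and ?B = "column_product l (card d') (card d)"
  have AB: "y \<in> column_product l c' c" if r: "reflects l 0 x y" and c: "x \<in> column_product l c c'" for x y c c'
  proof -
    obtain a a' where x: "x = [a, a']" "card a = c" "card a' = c'" using c by (auto simp: column_product_def)
    have "length y = Suc (Suc 0)" using r x by (simp add: reflects_def)
    then obtain e e' where y: "y = [e, e']" by (auto simp: length_Suc_conv)
    show ?thesis using reflects_props(1,2)[OF r] r x y by (simp add: column_product_iff reflects_def)
  qed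
  have A: "[d, d'] \<in> ?A" using xy by (auto simp: column_product_iff reflects_def)
  have l: "Suc 0 < length x" if "x \<in> column_product l c c'" for x c c'
    using that by (auto simp: column_product_def)
  have ex: "\<exists>y\<in>column_product l c' c. reflects l 0 x y" if "x \<in> column_product l c c'" for x c c'
    using reflects_exists[OF _ l[OF that]] AB that by (metis column_product_iff)
  have "\<exists>f. crystal_iso l f ?A ?B \<and> (\<forall>x y. reflects l 0 x y \<longrightarrow> f x = y)"
  proof (rule bisim_crystal_iso[OF bisim_reflects])
    show "\<And>x y y'. reflects l 0 x y \<Longrightarrow> reflects l 0 x y' \<Longrightarrow> y = y'" by (rule reflects_fun)
    show "\<And>x x' y. reflects l 0 x y \<Longrightarrow> reflects l 0 x' y \<Longrightarrow> x = x'" using reflects_fun reflects_sym by blast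
    show "\<And>x. x \<in> ?A \<Longrightarrow> \<exists>y\<in>?B. reflects l 0 x y" by (rule ex)
    show "\<And>y. y \<in> ?B \<Longrightarrow> \<exists>x\<in>?A. reflects l 0 x y" using ex reflects_sym by blast
  qed
  then obtain f where f: "crystal_iso l f ?A ?B" "f [d, d'] = y" using xy by blast
  show ?thesis unfolding R2_def
  proof (rule the_equality)
    show "\<exists>\<phi>. crystal_iso l \<phi> ?A ?B \<and> y = \<phi> [d, d']" using f by blast
    fix y' assume "\<exists>\<phi>. crystal_iso l \<phi> ?A ?B \<and> y' = \<phi> [d, d']"
    then obtain f' where f': "crystal_iso l f' ?A ?B" "f' [d, d'] = y'" by blast
    let ?T = "\<lambda>x y. x \<in> ?A \<and> y = f' x"
    have T: "bisim l (?T\<inverse>\<inverse> OO reflects l 0)"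
      by (intro bisim_OO bisim_conversep bisim_reflects crystal_iso_bisim[OF f'(1) closed_column_product])
    show "y' = y"
    proof (rule bisim_unique[OF T, where X = ?B])
      show "(?T\<inverse>\<inverse> OO reflects l 0) y' y" using f'(2) A xy by auto
      show "y' \<in> ?B" using f' A by (auto simp: crystal_iso_def bij_betw_def)
      show "y \<in> ?B" using AB[OF xy A] .
    next
      show "letters_le l z" if "z \<in> ?B" for z using that by (simp add: column_product_iff)
      show "z' \<in> ?B" if "z \<in> ?B" "k \<in> {1..<l}" "raise k z = Some z'" for z k z'
        using that by (rule column_product_raise)
      show "z = z'" if "z \<in> ?B" "z' \<in> ?B" "highest l z" "highest l z'"
        "\<And>k. k \<in> {1..<l} \<Longrightarrow> phi k z = phi k z'" for z z'
        using that(1,3,2,4,5) by (rule column_product_unique)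
    qed
  qed
qed

lemma reflects_R2:
  assumes "d \<subseteq> {1..l}" "d' \<subseteq> {1..l}" shows "reflects l 0 [d, d'] (R2 l d d')"
proof -
  have "letters_le l [d, d']" using assms by (simp add: letters_le_def)
  then obtain y where y: "reflects l 0 [d, d'] y" using reflects_exists[of l "[d, d']" 0] by auto
  then show ?thesis using R2_eq[OF y] by simp
qed

lemma reflects_R:
  assumes "letters_le l x" "Suc p < length x" shows "reflects l p x (R l (Suc p) x)"
proof -
  obtain y where y: "reflects l p x y" using reflects_exists[OF assms] by blast
  have l: "length y = length x" using y by (simp add: reflects_def)
  have r: "R2 l (x ! p) (x ! Suc p) = [y ! p, y ! Suc p]" using R2_eq[OF reflects_local[OF y]] .
  have "R l (Suc p) x = y"
  proof (rule nth_equalityI)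
    show "length (R l (Suc p) x) = length y" using assms(2) l by (simp add: R_def r)
    fix q assume "q < length (R l (Suc p) x)"
    then have "q < length x" using assms(2) by (simp add: R_def r)
    have x: "R l (Suc p) x = take p x @ [y ! p, y ! Suc p] @ drop (Suc (Suc p)) x"
      "length (take p x) = p" using assms(2) by (simp_all add: R_def r)
    have "q < p \<or> q = p \<or> q = Suc p \<or> (\<exists>t. q = p + Suc (Suc t))" by presburger
    then consider "q < p" | "q = p" | "q = Suc p" | t where "q = p + Suc (Suc t)" by blast
    then show "R l (Suc p) x ! q = y ! q"
    proof cases
      case 1
      then show ?thesis using reflects_props(3)[OF y, of q] \<open>q < length x\<close> by (simp add: x nth_append)
    next
      case 4
      then show ?thesis using reflects_props(3)[OF y, of q] assms(2) \<open>q < length x\<close>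
        by (simp add: x nth_append)
    qed (use \<open>q < length x\<close> in \<open>simp_all add: x nth_append\<close>)
  qed
  then show ?thesis using y by simp
qed

section \<open>The local energy in terms of heights\<close>

lemma admissible_shift_iff:
  assumes "d \<subseteq> {1..l}" "d' \<subseteq> {1..l}"
  shows "admissible_shift d d' t \<longleftrightarrow> mx (ch (mem [d, d']) 0) l \<le> int t"
proof -
  have c: "card d \<le> t + card d'" if "\<forall>i\<le>l. card (d \<inter> {1..i}) \<le> t + card (d' \<inter> {1..i})"
    using that[rule_format, of l] assms by (simp add: Int_absorb2)
  \<comment> \<open>Rows count from 1 in the definition and from 0 on the right-hand side; the
    length condition absorbs the upper bound \<open>t + card d'\<close>.\<close>
  have "(\<forall>r\<in>{1..card d} \<inter> {t + 1..t + card d'}.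
        sorted_list_of_set d' ! (r - t - 1) \<le> sorted_list_of_set d ! (r - 1)) \<longleftrightarrow>
    (\<forall>r. t \<le> r \<and> r < card d \<longrightarrow> sorted_list_of_set d' ! (r - t) \<le> sorted_list_of_set d ! r)"
    (is "?L \<longleftrightarrow> ?R") if "card d \<le> t + card d'"
  proof
    assume L: ?L
    show ?R
    proof (intro allI impI)
      fix r assume "t \<le> r \<and> r < card d"
      then have "Suc r \<in> {1..card d} \<inter> {t + 1..t + card d'}" using that by auto
      with L have "sorted_list_of_set d' ! (Suc r - t - 1) \<le> sorted_list_of_set d ! (Suc r - 1)" by blast
      then show "sorted_list_of_set d' ! (r - t) \<le> sorted_list_of_set d ! r" by simp
    qed
  next
    assume R: ?R
    show ?L
    proof
      fix r assume "r \<in> {1..card d} \<inter> {t + 1..t + card d'}"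
      then have "t \<le> r - 1 \<and> r - 1 < card d" by auto
      with R have "sorted_list_of_set d' ! (r - 1 - t) \<le> sorted_list_of_set d ! (r - 1)" by blast
      then show "sorted_list_of_set d' ! (r - t - 1) \<le> sorted_list_of_set d ! (r - 1)" by simp
    qed
  qed
  then have "admissible_shift d d' t \<longleftrightarrow> (\<forall>i\<le>l. card (d \<inter> {1..i}) \<le> t + card (d' \<inter> {1..i}))"
    unfolding admissible_shift_def using shift_le_iff[OF assms, of t] c by blast
  also have "\<dots> \<longleftrightarrow> mx (ch (mem [d, d']) 0) l \<le> int t"
    by (auto simp: mx_le_iff ch_card)
  finally show ?thesis .
qed

lemma H_large_eq:
  assumes "d \<subseteq> {1..l}" "d' \<subseteq> {1..l}" "card d' \<le> card d"
  shows "H_large d d' = nat (mx (ch (mem [d, d']) 0) l - (int (card d) - int (card d')))"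
proof -
  have "(LEAST t. admissible_shift d d' t) = nat (mx (ch (mem [d, d']) 0) l)"
    unfolding admissible_shift_iff[OF assms(1,2)] by (rule Least_equality) auto
  then show ?thesis using assms(3) mx_ch_nonneg[of "[d, d']" 0 l] by (simp add: H_large_def nat_diff_distrib)
qed

text \<open>One formula covers both cases, as reflecting a pair with \<open>card d < card d'\<close>
  raises the maximum by the very amount that \<open>H_large\<close> subtracts. The value is the
  smaller of the maximum and the maximum minus the final height, the distances to the two ends of
  the string.\<close>

lemma H_eq:
  assumes "d \<subseteq> {1..l}" "d' \<subseteq> {1..l}"
  shows "H l d d' = nat (mx (ch (mem [d, d']) 0) l - max 0 (int (card d) - int (card d')))"
proof (cases "card d' \<le> card d")
  case True
  then show ?thesis using H_large_eq[OF assms True] by (simp add: H_def)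
next
  case False
  note r = reflects_R2[OF assms]
  obtain e e' where e: "R2 l d d' = [e, e']"
    using r by (auto simp: reflects_def length_Suc_conv)
  have g: "letters_le l [d, d']" "e \<subseteq> {1..l}" "e' \<subseteq> {1..l}" using r by (auto simp: reflects_def e letters_le_def)
  have c: "card e = card d'" "card e' = card d" using reflects_props(1,2)[OF r] by (simp_all add: e)
  have s: "(cstep l 0 ^^ (card d' - card d)) [d, d'] [e, e']" using r False by (simp add: reflects_def e)
  have "mx (ch (mem [e, e']) 0) l = mx (ch (mem [d, d']) 0) l + int (card d' - card d)"
    using relpowp_cstep_props(3)[OF s g(1)] by simp
  then have "H_large e e' = nat (mx (ch (mem [d, d']) 0) l)"
    using H_large_eq[OF g(2,3)] c False by simp
  then show ?thesis using False by (simp add: H_def e)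
qed

lemma H_at:
  assumes "letters_le l x" "Suc p < length x"
  shows "H l (x ! p) (x ! Suc p) = nat (mx (ch (mem x) p) l - max 0 (ch (mem x) p l))"
  using H_eq[OF letters_le_nth[OF assms(1), of p] letters_le_nth[OF assms]] assms(2) ch_end[OF assms]
  by (simp add: ch_pair[of x p])

section \<open>Rotation\<close>

text \<open>Rows flipped by \<open>r\<close> applications of \<open>cstep\<close>, in terms of the heights \<open>g\<close>.\<close>

definition flips :: "nat \<Rightarrow> (nat \<Rightarrow> int) \<Rightarrow> nat \<Rightarrow> nat set" where
  "flips m g r = {Suc i | i. i < m \<and> (\<forall>e. i < e \<and> e \<le> m \<longrightarrow> g e < g i) \<and> (\<forall>e\<le>m. g e < g i + int r)}"

text \<open>Flipped are the strict records from the right that lie less than \<open>r\<close> below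
  the maximum. One \<open>cstep\<close> uses up the topmost record \<open>q\<close> and raises the
  later heights by 2 and the maximum by 1, so later records need one step less; earlier positions
  are records neither before nor after.\<close>

lemma flips_Suc:
  assumes q: "is_last g m q" "q < m" and h: "\<And>e. e \<le> m \<Longrightarrow> h e = g e + (if q < e then 2 else 0)"
    and st: "g (Suc q) = g q - 1"
  shows "flips m g (Suc r) = insert (Suc q) (flips m h r)"
proof -
  have q1: "g e \<le> g q" "q < e \<Longrightarrow> g e < g q" if "e \<le> m" for e using q that by (auto simp: is_last_def)
  have "(\<forall>e. i < e \<and> e \<le> m \<longrightarrow> g e < g i) \<and> (\<forall>e\<le>m. g e < g i + int (Suc r)) \<longleftrightarrow>
    i = q \<or> (\<forall>e. i < e \<and> e \<le> m \<longrightarrow> h e < h i) \<and> (\<forall>e\<le>m. h e < h i + int r)" (is "?G \<longleftrightarrow> i = q \<or> ?H")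
    if i: "i < m" for i
  proof -
    consider "i < q" | "i = q" | "q < i" by linarith
    then show ?thesis
    proof cases
      case 1
      have "g i \<le> g q" using q1 i by simp
      then have "\<not> ?G" using 1 q(2) by (auto intro!: exI[of _ q])
      moreover have "h (Suc q) = g q + 1" "h i = g i" using h st q(2) 1 i by auto
      then have "\<not> h (Suc q) < h i" using \<open>g i \<le> g q\<close> by simp
      then have "\<not> ?H" using 1 q(2) by (auto intro!: exI[of _ "Suc q"])
      moreover have "i \<noteq> q" using 1 by simp
      ultimately show ?thesis by blast
    next
      case 2
      have "g e < g q + int (Suc r)" if "e \<le> m" for e using q1(1)[OF that] by simp
      then show ?thesis using 2 q1 by simp
    next
      case 3
      have hi: "h i = g i + 2" using h i 3 by simp
      have a: "(\<forall>e. i < e \<and> e \<le> m \<longrightarrow> g e < g i) \<longleftrightarrow> (\<forall>e. i < e \<and> e \<le> m \<longrightarrow> h e < h i)"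
        using h hi 3 by auto
      have b: "(\<forall>e\<le>m. g e < g i + int (Suc r)) \<longleftrightarrow> g q < g i + int (Suc r)"
        using q1(1) q(2) by (meson le_less_trans less_imp_le)
      have hq: "h e \<le> g q + 1" if "e \<le> m" for e using h[OF that] q1[OF that] by auto
      have "h (Suc q) = g q + 1" using h st q(2) by simp
      then have c: "(\<forall>e\<le>m. h e < h i + int r) \<longleftrightarrow> g q + 1 < h i + int r"
        using hq q(2) by (metis Suc_leI le_less_trans)
      show ?thesis using a b c hi 3 by auto
    qed
  qed
  then show ?thesis using q(2) unfolding flips_def by blast
qed

lemma flips_0 [simp]: "flips m g 0 = {}"
proof -
  have "\<not> (\<forall>e\<le>m. g e < g i + int 0)" if "i < m" for i using that by (auto intro!: exI[of _ i])
  then show ?thesis unfolding flips_def by blast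
qed

lemma relpowp_cstep_flips:
  assumes "(cstep m p ^^ r) x y"
  shows "y ! p = x ! p \<union> flips m (ch (mem x) p) r \<and> y ! Suc p = x ! Suc p - flips m (ch (mem x) p) r"
  using assms
proof (induction r arbitrary: x)
  case (Suc r)
  then obtain z where z: "cstep m p x z" "(cstep m p ^^ r) z y" by (meson relpowp_Suc_D2)
  obtain i where i: "is_last (ch (mem x) p) m i" "i < m" and l: "Suc p < length x"
    and y: "z = x[p := insert (Suc i) (x ! p), Suc p := x ! Suc p - {Suc i}]"
    using z(1) by (auto simp: cstep_def)
  have m: "mem z = cmove (mem x) p i" using y mem_cmove l by simp
  note s = ch_last_step[OF i]
  have h: "ch (mem z) p r = ch (mem x) p r + (if i < r then 2 else 0)" for r
    unfolding m by (rule ch_cmove) (use s in auto)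
  have "flips m (ch (mem x) p) (Suc r) = insert (Suc i) (flips m (ch (mem z) p) r)"
    by (rule flips_Suc[OF i h]) (use s in \<open>simp add: ch_Suc\<close>)
  then show ?case using Suc.IH[OF z(2)] l by (auto simp: y)
qed simp

definition rot :: "nat \<Rightarrow> nat \<Rightarrow> nat" where
  "rot l j = (if j = l then 1 else Suc j)"

lemma mem_rot:
  assumes "d \<subseteq> {1..l}" "i < l"
  shows "Suc i \<in> rot l ` d \<longleftrightarrow> (if i = 0 then l \<in> d else i \<in> d)"
  using assms by (auto simp: rot_def image_iff split: if_splits intro!: bexI[of _ i] bexI[of _ l])

lemma rot_subset: "d \<subseteq> {1..l} \<Longrightarrow> rot l ` d \<subseteq> {1..l}"
  by (fastforce simp: rot_def)

lemma inj_rot: "inj_on (rot l) {1..l}"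
  by (auto simp: inj_on_def rot_def split: if_splits)

lemma letters_le_rot: "letters_le l x \<Longrightarrow> letters_le l (map (image (rot l)) x)"
  using rot_subset by (auto simp: letters_le_def)

lemma card_rot: "d \<subseteq> {1..l} \<Longrightarrow> card (rot l ` d) = card d"
  by (meson card_image inj_on_subset inj_rot)

text \<open>The step of letter \<open>l\<close> becomes the first one, and all other steps come one
  position later.\<close>

lemma ch_rot:
  assumes g: "letters_le l x" "Suc p < length x" and i: "i < l"
  shows "ch (mem (map (image (rot l)) x)) p (Suc i) =
    (of_bool (l \<in> x ! p) - of_bool (l \<in> x ! Suc p)) + ch (mem x) p i"
  using i
proof (induction i)
  case 0
  then show ?case using g mem_rot[OF letters_le_nth[OF g(1), of p]] mem_rot[OF letters_le_nth[OF g]]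
    by (simp add: ch_Suc mem_def)
next
  case (Suc i)
  then show ?case using g mem_rot[OF letters_le_nth[OF g(1), of p] Suc.prems] mem_rot[OF letters_le_nth[OF g] Suc.prems]
    by (simp add: ch_Suc mem_def)
qed

text \<open>
  A row is flipped by the reflection iff the height after it stays below the height before it
  forever in the periodic extension of the heights; this does not depend on where the period starts.
\<close>

lemma flips_rot:
  assumes a: "a = g l - g (l - 1)" and h: "h 0 = 0" "\<And>i. i < l \<Longrightarrow> h (Suc i) = a + g i"
    and g: "g 0 = 0" "g l = - int r" and l: "1 \<le> l"
  shows "flips l h r = rot l ` flips l g r"
proof -
  let ?F = "\<lambda>g i. (\<forall>e. i < e \<and> e \<le> l \<longrightarrow> g e < g i) \<and> (\<forall>e\<le>l. g e < g i + int r)"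
  have F: "flips l g r = {Suc i | i. i < l \<and> ?F g i}" for g :: "nat \<Rightarrow> int" by (auto simp: flips_def)
  have all: "(\<forall>e\<le>l. Q e) \<longleftrightarrow> Q 0 \<and> (\<forall>e<l. Q (Suc e))" for Q
    using l by (auto simp: less_Suc_eq_le dest: Suc_leI) (metis Suc_le_eq not0_implies_Suc)
  have 1: "?F h (Suc i) \<longleftrightarrow> ?F g i" if i: "Suc i < l" for i
  proof
    assume H: "?F h (Suc i)"
    have hi: "h (Suc i) = a + g i" using h i by simp
    have A: "g e < g i" if "i < e" "e < l" for e using H[THEN conjunct1, rule_format, of "Suc e"] h(2)[of e] that hi by simp
    have B: "g e < g i + int r" if "e < l" for e using H[THEN conjunct2, rule_format, of "Suc e"] h(2)[of e] that hi by simp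
    \<comment> \<open>Over one period the heights drop by \<open>r\<close>, so the bound at position
      0 is the one needed at position \<open>l\<close>.\<close>
    have C: "g l < g i" using B[of 0] g i by simp
    show "?F g i"
    proof (intro conjI allI impI)
      show "g e < g i" if "i < e \<and> e \<le> l" for e using A[of e] C that by (cases "e = l") auto
      show "g e < g i + int r" if "e \<le> l" for e using B[of e] C that by (cases "e = l") auto
    qed
  next
    assume G: "?F g i"
    have hi: "h (Suc i) = a + g i" using h i by simp
    have L: "g (l - 1) < g i" using G i by auto
    show "?F h (Suc i)"
    proof (intro conjI allI impI)
      show "h e < h (Suc i)" if "Suc i < e \<and> e \<le> l" for e
        using G h(2)[of "e - 1"] hi that by (cases e) auto
      show "h e < h (Suc i) + int r" if "e \<le> l" for e
        using G[THEN conjunct2, rule_format, of "e - 1"] h(2)[of "e - 1"] h(1) hi that L a g by (cases e) auto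
    qed
  qed
  \<comment> \<open>The wrap-around: the last step of \<open>g\<close> is the first step of
    \<open>h\<close>.\<close>
  have 2: "?F h 0 \<longleftrightarrow> ?F g (l - 1)"
  proof
    assume H: "?F h 0"
    have A: "a + g e < 0" if "e < l" for e using H[THEN conjunct1, rule_format, of "Suc e"] h that by simp
    have B: "0 < int r" using H[THEN conjunct2, rule_format, of 0] by simp
    show "?F g (l - 1)"
    proof (intro conjI allI impI)
      show "g e < g (l - 1)" if "l - 1 < e \<and> e \<le> l" for e
      proof -
        have "e = l" using that by auto
        then show ?thesis using A[of 0] g a l by simp
      qed
      show "g e < g (l - 1) + int r" if "e \<le> l" for e
        using A[of e] A[of 0] that a g B l by (cases "e = l") auto
    qed
  next
    assume G: "?F g (l - 1)"
    have A: "a + g e < 0" if "e < l" for e using G[THEN conjunct2, rule_format, of e] a g that by simp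
    have "a + g (l - 1) < 0" using A[of "l - 1"] l by simp
    then have B: "0 < int r" using a g by simp
    show "?F h 0"
    proof (intro conjI allI impI)
      show "h e < h 0" if "0 < e \<and> e \<le> l" for e using A[of "e - 1"] h that by (cases e) auto
      show "h e < h 0 + int r" if "e \<le> l" for e using A[of "e - 1"] h that B by (cases e) force+
    qed
  qed
  show ?thesis
  proof (intro set_eqI iffI)
    fix j assume "j \<in> flips l h r"
    then obtain i where i: "j = Suc i" "i < l" "?F h i" unfolding F by blast
    show "j \<in> rot l ` flips l g r"
    proof (cases i)
      case 0
      then have "?F g (l - 1)" using i(3) 2 by blast
      then have "l \<in> flips l g r" unfolding F using l by (auto intro!: exI[of _ "l - 1"])
      then show ?thesis using i 0 by (auto simp: rot_def intro!: image_eqI[of _ _ l])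
    next
      case (Suc i')
      then have "?F g i'" using i 1[of i'] by blast
      then have "i \<in> flips l g r" unfolding F using i Suc by auto
      then show ?thesis using i by (auto simp: rot_def intro!: image_eqI[of _ _ i])
    qed
  next
    fix j assume "j \<in> rot l ` flips l g r"
    then obtain i where i: "j = rot l (Suc i)" "i < l" "?F g i" unfolding F by blast
    show "j \<in> flips l h r"
    proof (cases "Suc i = l")
      case True
      then have "i = l - 1" by simp
      then have "?F h 0" using i(3) 2 by blast
      then show ?thesis unfolding F using i True l by (auto simp: rot_def intro!: exI[of _ 0])
    next
      case False
      then have "?F h (Suc i)" using i 1[of i] by simp
      then show ?thesis unfolding F using i False by (auto simp: rot_def)
    qed
  qed
qed

lemma flips_subset: "flips m g r \<subseteq> {1..m}"
  by (auto simp: flips_def)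

text \<open>By \<open>relpowp_cstep_flips\<close> a reflection is determined by its flipped rows,
  and these rotate by \<open>flips_rot\<close>.\<close>

lemma reflects_rot_le:
  assumes xy: "reflects l p x y" and le: "card (x ! p) \<le> card (x ! Suc p)" and l: "1 \<le> l"
  shows "reflects l p (map (image (rot l)) x) (map (image (rot l)) y)"
proof -
  have g: "letters_le l x" "letters_le l y" "Suc p < length x" "length y = length x"
    using xy by (auto simp: reflects_def)
  define r where "r = card (x ! Suc p) - card (x ! p)"
  let ?x = "map (image (rot l)) x" and ?y = "map (image (rot l)) y"
  have gx: "letters_le l ?x" "Suc p < length ?x" "?x ! p = rot l ` (x ! p)" "?x ! Suc p = rot l ` (x ! Suc p)"
    using letters_le_rot[OF g(1)] g by simp_all
  have s: "x ! p \<subseteq> {1..l}" "x ! Suc p \<subseteq> {1..l}" using letters_le_nth[OF g(1)] g(3) by auto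
  have xy': "(cstep l p ^^ r) x y" using xy le by (simp add: reflects_def r_def)
  obtain z where z: "reflects l p ?x z" using reflects_exists[OF gx(1,2)] by blast
  have cc: "card (?x ! p) = card (x ! p)" "card (?x ! Suc p) = card (x ! Suc p)"
    unfolding gx(3,4) using s by (simp_all only: card_rot)
  have xz: "(cstep l p ^^ r) ?x z" using z le unfolding reflects_def r_def cc by simp
  have "flips l (ch (mem ?x) p) r = rot l ` flips l (ch (mem x) p) r"
  proof (rule flips_rot)
    show "ch (mem ?x) p (Suc i) = (of_bool (l \<in> x ! p) - of_bool (l \<in> x ! Suc p)) + ch (mem x) p i"
      if "i < l" for i using ch_rot[OF g(1,3) that] .
    show "of_bool (l \<in> x ! p) - of_bool (l \<in> x ! Suc p) = ch (mem x) p l - ch (mem x) p (l - 1)"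
      using ch_Suc[of "mem x" p "l - 1"] l by (simp add: mem_def)
    show "ch (mem x) p l = - int r" using ch_end[OF g(1,3)] le by (simp add: r_def)
  qed (use l in auto)
  then have zp: "z ! p = rot l ` (y ! p)" "z ! Suc p = rot l ` (y ! Suc p)"
    using relpowp_cstep_flips[OF xz] relpowp_cstep_flips[OF xy'] gx
      inj_on_image_set_diff[OF inj_rot[of l], of "x ! Suc p" "flips l (ch (mem x) p) r"] s flips_subset
    by (auto simp: image_Un)
  have "z = ?y"
  proof (rule nth_equalityI)
    show "length z = length ?y" using z g by (simp add: reflects_def)
    fix q assume "q < length z"
    then show "z ! q = ?y ! q"
      using zp reflects_props(3)[OF z, of q] reflects_props(3)[OF xy, of q] z g
      by (cases "q = p"; cases "q = Suc p") (auto simp: reflects_def)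
  qed
  then show ?thesis using z by simp
qed

lemma reflects_rot:
  assumes xy: "reflects l p x y" and l: "1 \<le> l"
  shows "reflects l p (map (image (rot l)) x) (map (image (rot l)) y)"
proof (cases "card (x ! p) \<le> card (x ! Suc p)")
  case True
  then show ?thesis using reflects_rot_le[OF xy _ l] by simp
next
  case False
  then have "card (y ! p) \<le> card (y ! Suc p)" using reflects_props(1,2)[OF xy] by simp
  then show ?thesis using reflects_rot_le[OF reflects_sym[OF xy] _ l] reflects_sym by blast
qed

section \<open>The local energy under reflection and rotation\<close>

lemma H_reflects:
  assumes "reflects l p x y"
  shows "H l (y ! p) (y ! Suc p) = H l (x ! p) (x ! Suc p)"
proof -
  \<comment> \<open>The final height changes sign and the maximum grows by the number of steps,
    which exchanges the two distances whose minimum is \<open>H\<close>.\<close>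
  have *: "H l (y ! p) (y ! Suc p) = H l (x ! p) (x ! Suc p)"
    if xy: "reflects l p x y" and le: "card (x ! p) \<le> card (x ! Suc p)" for x y
  proof -
    have g: "letters_le l x" "letters_le l y" "Suc p < length x" "Suc p < length y" using xy by (auto simp: reflects_def)
    have "(cstep l p ^^ (card (x ! Suc p) - card (x ! p))) x y" using xy le by (simp add: reflects_def)
    note pr = relpowp_cstep_props[OF this g(1,3)]
    show ?thesis using pr(3,4) ch_end[OF g(1,3)] le H_at[OF g(1,3)] H_at[OF g(2,4)] by simp
  qed
  show ?thesis
  proof (cases "card (x ! p) \<le> card (x ! Suc p)")
    case True
    then show ?thesis using * assms by blast
  next
    case False
    then have "card (y ! p) \<le> card (y ! Suc p)" using reflects_props(1,2)[OF assms] by simp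
    then show ?thesis using *[OF reflects_sym[OF assms]] by simp
  qed
qed

lemma mx_Suc_end: "mx g (Suc N) = max (mx g N) (g (Suc N))"
proof (rule antisym)
  show "mx g (Suc N) \<le> max (mx g N) (g (Suc N))"
    unfolding mx_le_iff using mx_ge[of _ N g] by (auto simp: le_Suc_eq intro: max.coboundedI1)
  have "mx g N \<le> mx g (Suc N)" unfolding mx_le_iff by (auto intro: mx_ge)
  then show "max (mx g N) (g (Suc N)) \<le> mx g (Suc N)" using mx_ge[of "Suc N" "Suc N" g] by simp
qed

text \<open>Here \<open>H\<close> is the maximum \<open>M\<close> of the heights before the step
  \<open>a\<close> of row \<open>l\<close>, and after rotation it is \<open>max 0 (a + M)\<close>.
  These differ only if \<open>a = 1\<close>, or if \<open>a = -1\<close> and \<open>M > 0\<close>;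
  in the remaining case with a nonzero step, \<open>a = -1\<close> and \<open>M = 0\<close>, row
  \<open>l\<close> is flipped and both indicators equal 1.\<close>

lemma H_rot_le:
  assumes xy: "reflects l p x y" and le: "card (x ! p) \<le> card (x ! Suc p)" and l: "1 \<le> l"
  shows "int (H l (x ! p) (x ! Suc p)) - int (H l (rot l ` (x ! p)) (rot l ` (x ! Suc p))) =
    of_bool (l \<in> x ! Suc p) - of_bool (l \<in> y ! p)"
proof -
  have g: "letters_le l x" "letters_le l y" "Suc p < length x" "length y = length x"
    using xy by (auto simp: reflects_def)
  define r where "r = card (x ! Suc p) - card (x ! p)"
  let ?x = "map (image (rot l)) x"
  have gx: "letters_le l ?x" "Suc p < length ?x" "?x ! p = rot l ` (x ! p)" "?x ! Suc p = rot l ` (x ! Suc p)"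
    using letters_le_rot[OF g(1)] g by simp_all
  have s: "x ! p \<subseteq> {1..l}" "x ! Suc p \<subseteq> {1..l}" using letters_le_nth[OF g(1)] g(3) by auto
  have xy': "(cstep l p ^^ r) x y" using xy le by (simp add: reflects_def r_def)
  obtain l' where l': "l = Suc l'" using l by (cases l) auto
  define c where "c = ch (mem x) p"
  define M where "M = mx c l'"
  define a :: int where "a = of_bool (l \<in> x ! p) - of_bool (l \<in> x ! Suc p)"
  have cl: "c l = - int r" using ch_end[OF g(1,3)] le by (simp add: r_def c_def)
  have cl': "c l = c l' + a" by (simp add: c_def a_def l' ch_Suc mem_def)
  have M0: "M \<ge> 0" using mx_ge[of 0 l' c] by (simp add: M_def c_def)
  have Ml: "c l' \<le> M" using mx_ge[of l' l' c] by (simp add: M_def)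
  have "mx (ch (mem ?x) p) (Suc l') = max (ch (mem ?x) p 0) (a + mx c l')"
    by (rule mx_Suc) (use ch_rot[OF g(1,3)] l' in \<open>simp add: a_def c_def\<close>)
  then have mx1: "mx (ch (mem ?x) p) l = max 0 (a + M)" by (simp add: l' M_def)
  have mx2: "mx c l = max M (c l)" by (simp add: l' mx_Suc_end M_def)
  have c1: "ch (mem ?x) p l = - int r"
    using ch_end[OF gx(1,2)] ch_end[OF g(1,3)] cl gx s by (simp add: card_rot c_def)
  have H1: "int (H l (x ! p) (x ! Suc p)) = M"
    using H_at[OF g(1,3)] mx2 cl M0 by (simp flip: c_def)
  have H2: "int (H l (rot l ` (x ! p)) (rot l ` (x ! Suc p))) = max 0 (a + M)"
    using H_at[OF gx(1,2)] mx1 c1 gx(3,4) by simp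
  have fl: "l \<in> flips l c r \<longleftrightarrow> c l < c l' \<and> (\<forall>e\<le>l. c e < c l' + int r)"
    by (auto simp: flips_def l' le_Suc_eq)
  have yp: "l \<in> y ! p \<longleftrightarrow> l \<in> x ! p \<or> l \<in> flips l c r"
    using relpowp_cstep_flips[OF xy'] by (simp add: c_def)
  show ?thesis
  proof (cases "l \<in> x ! p")
    case True
    then have "a \<ge> 0" "l \<in> y ! p" using yp by (auto simp: a_def)
    moreover have "l \<notin> x ! Suc p \<Longrightarrow> a = 1" "l \<in> x ! Suc p \<Longrightarrow> a = 0" using True by (auto simp: a_def)
    ultimately show ?thesis using H1 H2 M0 by (cases "l \<in> x ! Suc p") auto
  next
    case False
    show ?thesis
    proof (cases "l \<in> x ! Suc p")
      case True
      then have a1: "a = -1" using False by (simp add: a_def)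
      have "(\<forall>e\<le>l. c e < c l' + int r) \<longleftrightarrow> mx c l < c l' + int r"
        by (metis le_less_trans mx_attained mx_ge)
      then have "l \<in> flips l c r \<longleftrightarrow> M < 1"
        using fl cl cl' a1 mx2 M0 by auto
      then show ?thesis using H1 H2 M0 a1 yp False True by (cases "M < 1") auto
    next
      case False2: False
      then have a0: "a = 0" using False by (simp add: a_def)
      then have "l \<notin> flips l c r" using fl cl' by simp
      then show ?thesis using H1 H2 M0 a0 yp False False2 by simp
    qed
  qed
qed

text \<open>If the first column is the larger one, the formula is applied to the reflected pair. It
  turns into the desired one because reflection keeps the union and the intersection of the two
  columns.\<close>

lemma H_rot:
  assumes xy: "reflects l p x y" and l: "1 \<le> l"
  shows "int (H l (x ! p) (x ! Suc p)) - int (H l (rot l ` (x ! p)) (rot l ` (x ! Suc p))) =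
    of_bool (l \<in> x ! Suc p) - of_bool (l \<in> y ! p)"
proof (cases "card (x ! p) \<le> card (x ! Suc p)")
  case True
  then show ?thesis using H_rot_le[OF xy _ l] by simp
next
  case False
  have g: "Suc p < length x" "length y = length x" using xy by (auto simp: reflects_def)
  have "card (y ! p) \<le> card (y ! Suc p)" using False reflects_props(1,2)[OF xy] by simp
  note y = H_rot_le[OF reflects_sym[OF xy] this l]
  have "H l (rot l ` (y ! p)) (rot l ` (y ! Suc p)) = H l (rot l ` (x ! p)) (rot l ` (x ! Suc p))"
    using H_reflects[OF reflects_rot[OF xy l]] g by simp
  moreover have "l \<in> x ! p \<union> x ! Suc p \<longleftrightarrow> l \<in> y ! p \<union> y ! Suc p"
    "l \<in> x ! p \<inter> x ! Suc p \<longleftrightarrow> l \<in> y ! p \<inter> y ! Suc p"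
    using reflects_props(4,5)[OF xy] by simp_all
  ultimately show ?thesis using y H_reflects[OF xy] by (auto simp: of_bool_def)
qed

section \<open>Energy\<close>

lemma reflects_unique_R:
  assumes "reflects l p x y" shows "R l (Suc p) x = y"
proof -
  have "letters_le l x" "Suc p < length x" using assms by (simp_all add: reflects_def)
  from reflects_fun[OF reflects_R[OF this] assms] show ?thesis .
qed

text \<open>The factor \<open>d\<^sub>j\<close> of \<open>x\<close> is moved to the left, up to the place \<open>i + 1\<close>.\<close>

definition shifted :: "nat \<Rightarrow> tensor \<Rightarrow> nat \<Rightarrow> nat \<Rightarrow> tensor" where
  "shifted l x i j = fold (R l) (rev [i + 1..<j]) x"

lemma shifted_end [simp]: "shifted l x i (Suc i) = x"
  by (simp add: shifted_def)

lemma shifted_step: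
  assumes "Suc i < j" shows "shifted l x i j = R l (Suc i) (shifted l x (Suc i) j)"
proof -
  have "[i + 1..<j] = Suc i # [Suc i + 1..<j]" using assms by (simp add: upt_conv_Cons)
  then show ?thesis by (simp add: shifted_def del: upt_Suc)
qed

text \<open>Downward induction on \<open>i\<close> from \<open>j - 1\<close>, in the order in which
  the exchanges are performed.\<close>

lemma shifted_induct [consumes 1, case_names base step]:
  assumes "i < j" "Q (j - 1)" "\<And>i. Suc i < j \<Longrightarrow> Q (Suc i) \<Longrightarrow> Q i"
  shows "Q i"
proof -
  have "i \<le> j - 1" using assms(1) by simp
  then show ?thesis
  proof (induction rule: inc_induct)
    case base
    then show ?case by (rule assms(2))
  next
    case (step n)
    then show ?case using assms(3)[of n] by simp
  qed
qed

lemma shifted_props: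
  assumes "letters_le l x" "j \<le> length x" "i < j"
  shows "letters_le l (shifted l x i j) \<and> length (shifted l x i j) = length x \<and>
    (\<forall>r<i. shifted l x i j ! r = x ! r) \<and> card (shifted l x i j ! i) = card (x ! (j - 1))"
  using assms(3)
proof (induction rule: shifted_induct)
  case base
  have "shifted l x (j - 1) j = x" using assms(3) shifted_end[of l x "j - 1"] by simp
  then show ?case using assms by simp
next
  case (step i)
  let ?y = "shifted l x (Suc i) j"
  have "reflects l i ?y (R l (Suc i) ?y)" using step assms by (intro reflects_R) auto
  then show ?case
    using step reflects_props[of l i ?y "R l (Suc i) ?y"]
    by (auto simp: shifted_step[OF step(1)] reflects_def)
qed

lemma reflects_shifted:
  assumes "letters_le l x" "j \<le> length x" "Suc i < j"
  shows "reflects l i (shifted l x (Suc i) j) (shifted l x i j)"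
  unfolding shifted_step[OF assms(3)] using shifted_props[OF assms] assms by (intro reflects_R) auto

lemma sum_pairs:
  fixes f :: "nat \<Rightarrow> nat \<Rightarrow> 'a :: comm_monoid_add"
  shows "(\<Sum>(i, j) | 1 \<le> i \<and> i < j \<and> j \<le> N. f i j) = (\<Sum>j\<in>{1..N}. \<Sum>i\<in>{1..<j}. f i j)"
proof -
  have "(\<Sum>j\<in>{1..N}. \<Sum>i\<in>{1..<j}. f i j) = (\<Sum>(j, i)\<in>Sigma {1..N} (\<lambda>j. {1..<j}). f i j)"
    by (rule sum.Sigma) auto
  also have "\<dots> = (\<Sum>(i, j) | 1 \<le> i \<and> i < j \<and> j \<le> N. f i j)"
    by (rule sum.reindex_bij_witness[of _ prod.swap prod.swap]) auto
  finally show ?thesis by simp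
qed

text \<open>Moving \<open>d_j\<close> to place \<open>i + 1\<close> leaves the first
  \<open>i\<close> factors alone, so both arguments of \<open>H\<close> are neighbours in one
  tensor.\<close>

lemma energy_shifted:
  assumes "letters_le l x"
  shows "energy l x = (\<Sum>j\<in>{1..length x}. \<Sum>i\<in>{1..<j}. H l (shifted l x i j ! (i - 1)) (shifted l x i j ! i))"
  unfolding energy_def sum_pairs moved_def shifted_def[symmetric]
  using shifted_props[OF assms] by (intro sum.cong refl) auto

section \<open>Invariance of the energy under crystal operators\<close>

lemma lower_reflects:
  assumes "reflects l p x y" "k \<in> {1..<l}" "lower k x = Some x'"
  shows "\<exists>y'. lower k y = Some y' \<and> reflects l p x' y'"
proof -
  have "rel_option (reflects l p) (lower k x) (lower k y)"
    using bisim_reflects assms(1,2) unfolding bisim_def by blast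
  then show ?thesis unfolding assms(3) by (cases "lower k y") auto
qed

lemma lower_shifted:
  assumes "letters_le l x" "j \<le> length x" "i < j" "k \<in> {1..<l}" "lower k x = Some x'"
  shows "lower k (shifted l x i j) = Some (shifted l x' i j)"
  using assms(3)
proof (induction rule: shifted_induct)
  case base
  have "shifted l z (j - 1) j = z" for z using assms(3) shifted_end[of l z "j - 1"] by simp
  then show ?case using assms by simp
next
  case (step i)
  obtain y' where y': "lower k (shifted l x i j) = Some y'" "reflects l i (shifted l x' (Suc i) j) y'"
    using lower_reflects[OF reflects_shifted[OF assms(1,2) step(1)] assms(4) step(2)] by blast
  then show ?case using reflects_unique_R[OF y'(2)] shifted_step[OF step(1)] by simp
qed

lemma H_lower:
  assumes "letters_le l x" "k \<in> {1..<l}" "lower k x = Some x'" "Suc p < length x"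
  shows "H l (x' ! p) (x' ! Suc p) = H l (x ! p) (x ! Suc p)"
  using H_at[of l x p] H_at[of l x' p] letters_le_lower[OF assms(1-3)] lower_mx_ch[OF assms] assms by simp

lemma energy_lower:
  assumes "letters_le l x" "k \<in> {1..<l}" "lower k x = Some x'"
  shows "energy l x' = energy l x"
proof -
  have g: "letters_le l x'" "length x' = length x" using letters_le_lower[OF assms] by auto
  have "H l (shifted l x' i j ! (i - 1)) (shifted l x' i j ! i) = H l (shifted l x i j ! (i - 1)) (shifted l x i j ! i)"
    if "j \<in> {1..length x}" "i \<in> {1..<j}" for i j
  proof -
    have ij: "j \<le> length x" "i < j" "i \<noteq> 0" using that by auto
    then obtain p where p: "i = Suc p" by (cases i) auto
    have "letters_le l (shifted l x i j)" "Suc p < length (shifted l x i j)"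
      using shifted_props[OF assms(1) ij(1,2)] ij p by auto
    from H_lower[OF this(1) assms(2) lower_shifted[OF assms(1) ij(1,2) assms(2,3)] this(2)]
    show ?thesis by (simp add: p)
  qed
  then show ?thesis unfolding energy_shifted[OF assms(1)] energy_shifted[OF g(1)] g(2)
    by (intro sum.cong refl) auto
qed

lemma energy_up_star:
  assumes "(up n)\<^sup>*\<^sup>* b t" shows "energy (length b) (dual n t) = energy (length b) (dual n b) \<and> length t = length b"
  using assms
proof (induction rule: rtranclp_induct)
  case (step y z)
  then obtain p where p: "cstep n p z y" by (auto simp: up_def)
  have l: "length z = length y" "Suc p < length z" using cstep_length[OF p] p by (auto simp: cstep_def)
  have "lower (length z - Suc p) (dual n z) = Some (dual n y)"
    using l by (intro cstep_dual[OF p]) auto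
  then have "energy (length z) (dual n y) = energy (length z) (dual n z)"
    using l by (intro energy_lower[OF letters_le_dual]) auto
  then show ?case using step.IH l by simp
qed simp

section \<open>The energy under rotation and cyclage\<close>

lemma shifted_rot:
  assumes "letters_le l x" "j \<le> length x" "i < j" "1 \<le> l"
  shows "shifted l (map (image (rot l)) x) i j = map (image (rot l)) (shifted l x i j)"
  using assms(3)
proof (induction rule: shifted_induct)
  case base
  have "shifted l z (j - 1) j = z" for z using assms(3) shifted_end[of l z "j - 1"] by simp
  then show ?case by simp
next
  case (step i)
  show ?case
    using reflects_unique_R[OF reflects_rot[OF reflects_shifted[OF assms(1,2) step(1)] assms(4)]]
    by (simp add: shifted_step[OF step(1), of l "map _ _"] step(2))
qed

text \<open>For fixed \<open>j\<close>, the moving factor is the left output of one exchange and the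
  right input of the next, so the terms from \<open>H_rot\<close> telescope. The last of them
  concerns \<open>shifted l x 0 j\<close>, one exchange beyond those that the energy uses.\<close>

lemma energy_rot:
  assumes "letters_le l x" "1 \<le> l"
  shows "int (energy l x) - int (energy l (map (image (rot l)) x)) =
    (\<Sum>j\<in>{1..length x}. of_bool (l \<in> x ! (j - 1)) - of_bool (l \<in> shifted l x 0 j ! 0))"
proof -
  let ?r = "map (image (rot l))"
  have "(\<Sum>i\<in>{1..<j}. int (H l (shifted l x i j ! (i - 1)) (shifted l x i j ! i)) -
        int (H l (shifted l (?r x) i j ! (i - 1)) (shifted l (?r x) i j ! i))) =
      of_bool (l \<in> x ! (j - 1)) - of_bool (l \<in> shifted l x 0 j ! 0)" (is "?L = _")
    if j: "j \<in> {1..length x}" for j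
  proof -
    obtain j' where j': "j = Suc j'" using j by (cases j) auto
    define a :: "nat \<Rightarrow> int" where "a i = of_bool (l \<in> shifted l x i j ! i)" for i
    have "int (H l (shifted l x (Suc i) j ! i) (shifted l x (Suc i) j ! Suc i)) -
        int (H l (shifted l (?r x) (Suc i) j ! i) (shifted l (?r x) (Suc i) j ! Suc i)) = a (Suc i) - a i"
      if i: "i < j'" for i
    proof -
      have i': "Suc i < j" "j \<le> length x" using i j j' by auto
      have "length (shifted l x (Suc i) j) = length x" using shifted_props[OF assms(1) i'(2,1)] by simp
      then show ?thesis
        using H_rot[OF reflects_shifted[OF assms(1) i'(2,1)] assms(2)] i'
        by (simp add: shifted_rot[OF assms(1) i'(2,1) assms(2)] a_def)
    qed
    then have "?L = (\<Sum>i\<in>{0..<j'}. a (Suc i) - a i)"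
      unfolding j' One_nat_def sum.shift_bounds_Suc_ivl by (intro sum.cong refl) auto
    also have "\<dots> = a j' - a 0" by (rule sum_Suc_diff') simp
    finally show ?thesis by (simp add: a_def j')
  qed
  note * = this
  have "int (energy l x) - int (energy l (?r x)) =
      (\<Sum>j\<in>{1..length x}. \<Sum>i\<in>{1..<j}. int (H l (shifted l x i j ! (i - 1)) (shifted l x i j ! i)) -
        int (H l (shifted l (?r x) i j ! (i - 1)) (shifted l (?r x) i j ! i)))"
    unfolding energy_shifted[OF assms(1)] energy_shifted[OF letters_le_rot[OF assms(1)]]
    by (simp add: sum_subtractf)
  also have "\<dots> = (\<Sum>j\<in>{1..length x}. of_bool (l \<in> x ! (j - 1)) - of_bool (l \<in> shifted l x 0 j ! 0))"
    by (rule sum.cong[OF refl]) (rule *)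
  finally show ?thesis .
qed

lemma highest_reflects:
  assumes "reflects l p x y" "highest l x" shows "highest l y"
  unfolding highest_def
proof
  fix k assume k: "k \<in> {1..<l}"
  have "rel_option (reflects l p) (raise k x) (raise k y)"
    using bisim_reflects assms(1) k unfolding bisim_def by blast
  then show "raise k y = None" using assms(2) k by (simp add: highest_def)
qed

lemma highest_shifted:
  assumes "letters_le l x" "j \<le> length x" "i < j" "highest l x"
  shows "highest l (shifted l x i j)"
  using assms(3)
proof (induction rule: shifted_induct)
  case base
  have "shifted l x (j - 1) j = x" using assms(3) shifted_end[of l x "j - 1"] by simp
  then show ?case using assms(4) by simp
next
  case (step i)
  then show ?case using highest_reflects[OF reflects_shifted[OF assms(1,2) step(1)]] by simp
qed

lemma highest_dual:
  assumes "letters_le n b" "is_tableau b" shows "highest (length b) (dual n b)"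
  unfolding highest_iff[OF letters_le_dual] length_dual
proof
  fix j assume j: "j \<in> {1..<length b}"
  define p where "p = length b - Suc j"
  have p: "j + Suc p = length b" "1 \<le> j" using j by (auto simp: p_def)
  have "mx (rh (mem (dual n b)) j) n = mx (ch (mem b) p) n"
    using rh_dual[OF _ p(2,1)] by (intro mx_cong) auto
  also have "\<dots> = 0" using assms p by (simp add: is_tableau_iff)
  finally show "mx (rh (mem (dual n b)) j) n = 0" .
qed

lemma dual_cyclage:
  assumes "b \<noteq> []"
  shows "dual n (cyclage b) = map (image (rot (length b))) (dual n b)"
proof (rule nth_equalityI)
  fix i assume "i < length (dual n (cyclage b))"
  then have i: "i < n" by simp
  let ?l = "length b"
  have l: "length (cyclage b) = ?l" using assms by (simp add: cyclage_def)
  have c: "cyclage b ! q = b ! Suc q" if "Suc q < ?l" for q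
  proof -
    have "q < length (tl b)" using that by auto
    then show ?thesis by (simp add: cyclage_def nth_append nth_tl)
  qed
  have c': "cyclage b ! (?l - 1) = b ! 0" using assms by (simp add: cyclage_def nth_append hd_conv_nth)
  define D where "D = dual n b ! i"
  have D: "D \<subseteq> {1..?l}" "\<And>j. j \<in> D \<longleftrightarrow> 1 \<le> j \<and> j \<le> ?l \<and> Suc i \<in> b ! (?l - j)"
    using i by (auto simp: D_def dual_nth)
  have C: "j \<in> dual n (cyclage b) ! i \<longleftrightarrow> 1 \<le> j \<and> j \<le> ?l \<and> Suc i \<in> cyclage b ! (?l - j)" for j
    using i by (simp add: dual_nth l)
  have l1: "0 < ?l" using assms by simp
  have "j \<in> dual n (cyclage b) ! i \<longleftrightarrow> j \<in> rot ?l ` D" for j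
  proof -
    consider "j = 0 \<or> j > ?l" | "j = 1" | "2 \<le> j" "j \<le> ?l" by linarith
    then show ?thesis
    proof cases
      case 1
      then have "j \<notin> {1..?l}" by auto
      then show ?thesis using C rot_subset[OF D(1)] by auto
    next
      case 2
      have "Suc 0 \<in> rot ?l ` D \<longleftrightarrow> ?l \<in> D" using mem_rot[OF D(1) l1] by simp
      then show ?thesis unfolding 2 C using l1 Suc_leI[OF l1] c' D(2)[of ?l] by simp
    next
      case 3
      then obtain j' where j': "j = Suc j'" "0 < j'" "j' < ?l" by (cases j) auto
      have "Suc (?l - j) = ?l - j'" using j' by simp
      moreover have "cyclage b ! (?l - j) = b ! Suc (?l - j)" using j' by (intro c) simp
      moreover have "Suc j' \<in> rot ?l ` D \<longleftrightarrow> j' \<in> D" using mem_rot[OF D(1) j'(3)] j'(2) by simp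
      ultimately show ?thesis using C[of j] D(2)[of j'] j' by simp
    qed
  qed
  then show "dual n (cyclage b) ! i = map (image (rot ?l)) (dual n b) ! i"
    using i by (auto simp: D_def)
qed simp

lemma energy_cyclage:
  assumes b: "letters_le n b" "is_tableau b" "b \<noteq> []" and no: "\<And>k. k \<in> {1..n} \<Longrightarrow> \<not> in_every_column k b"
  shows "energy (length b) (dual n b) = energy (length b) (dual n (cyclage b)) + card (hd b)"
proof -
  let ?l = "length b" and ?x = "dual n b"
  have g: "letters_le ?l ?x" by (rule letters_le_dual)
  have l: "1 \<le> ?l" using b(3) by (simp add: Suc_leI)
  \<comment> \<open>A letter missing from some column gives a proper subset of the alphabet, and an
    initial segment of the same size avoids the letter \<open>l\<close>.\<close>
  have lt: "card (?x ! i) < ?l" if i: "i < n" for i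
  proof -
    have "\<not> in_every_column (Suc i) b" using no i by simp
    then obtain q where q: "q < ?l" "Suc i \<notin> b ! q" by (auto simp: in_every_column_def in_set_conv_nth)
    have "?x ! i \<subset> {1..?l}"
    proof
      show "?x ! i \<subseteq> {1..?l}" using i by (auto simp: dual_nth)
      have "?l - q \<in> {1..?l}" "?l - q \<notin> ?x ! i" using q i by (auto simp: dual_nth)
      then show "?x ! i \<noteq> {1..?l}" by blast
    qed
    then have "card (?x ! i) < card {1..?l}" by (intro psubset_card_mono) auto
    then show ?thesis by simp
  qed
  have "?l \<notin> shifted ?l ?x 0 j ! 0" if j: "j \<in> {1..n}" for j
  proof -
    have pr: "letters_le ?l (shifted ?l ?x 0 j)" "length (shifted ?l ?x 0 j) = n"
      "card (shifted ?l ?x 0 j ! 0) = card (?x ! (j - 1))"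
      using shifted_props[OF g, of j 0] j by auto
    have "highest ?l (shifted ?l ?x 0 j)"
      using highest_shifted[OF g _ _ highest_dual[OF b(1,2)], of j 0] j by simp
    then have "shifted ?l ?x 0 j ! 0 = {1..card (?x ! (j - 1))}"
      using highest_first[OF pr(1)] pr j by fastforce
    moreover have "card (?x ! (j - 1)) < ?l" using j by (intro lt) auto
    ultimately show ?thesis by simp
  qed
  \<comment> \<open>Letter \<open>l\<close> of the dual stands for the head of the list, so the
    first indicators count the letters of \<open>hd b\<close>; the second ones vanish.\<close>
  then have "(\<Sum>j\<in>{1..length ?x}. of_bool (?l \<in> ?x ! (j - 1)) - of_bool (?l \<in> shifted ?l ?x 0 j ! 0))
      = (\<Sum>j\<in>{1..n}. of_bool (j \<in> hd b) :: int)"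
    using b(3) l by (intro sum.cong) (auto simp: dual_nth hd_conv_nth)
  also have "\<dots> = int (card (hd b))"
    using letters_le_nth[OF b(1), of 0] b(3) by (simp add: sum_of_bool_eq hd_conv_nth Int_absorb1)
  finally show ?thesis using energy_rot[OF g l] dual_cyclage[OF b(3), of n] by simp
qed

section \<open>Trivial columns\<close>

text \<open>\<open>us\<close> lists the factors to be passed, nearest first. In this recursive form
  of the energy a factor can be deleted by induction, which is awkward with pairs of
  indices.\<close>

fun slide :: "nat \<Rightarrow> tensor \<Rightarrow> nat set \<Rightarrow> nat" where
  "slide l [] d = 0"
| "slide l (u # us) d = H l u d + slide l us (hd (R2 l u d))"

fun energy_rec :: "nat \<Rightarrow> tensor \<Rightarrow> tensor \<Rightarrow> nat" where
  "energy_rec l acc [] = 0"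
| "energy_rec l acc (d # ds) = slide l acc d + energy_rec l (d # acc) ds"

lemma slide_eq:
  assumes g: "letters_le l x" and j: "j \<le> length x" "m < j"
  shows "(\<Sum>i\<in>{1..<Suc m}. H l (shifted l x i j ! (i - 1)) (shifted l x i j ! i)) =
    slide l (rev (take m x)) (shifted l x m j ! m)"
  using j(2)
proof (induction m)
  case (Suc m)
  let ?y = "shifted l x (Suc m) j"
  have pr: "letters_le l ?y" "length ?y = length x" "?y ! m = x ! m"
    using shifted_props[OF g j(1) Suc.prems] by auto
  have r: "reflects l m ?y (shifted l x m j)" using Suc.prems by (intro reflects_shifted[OF g j(1)])
  have R2: "R2 l (x ! m) (?y ! Suc m) = [shifted l x m j ! m, shifted l x m j ! Suc m]"
    using R2_eq[OF reflects_local[OF r]] pr(3) by simp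
  have "take (Suc m) x = take m x @ [x ! m]" using Suc.prems j(1) by (simp add: take_Suc_conv_app_nth)
  then show ?case using Suc.IH Suc.prems R2 pr(3) by simp
qed simp

lemma energy_rec_eq:
  "energy_rec l (rev xs) ys = (\<Sum>j<length ys. slide l (rev (xs @ take j ys)) (ys ! j))"
proof (induction ys arbitrary: xs)
  case (Cons d ds)
  show ?case using Cons.IH[of "xs @ [d]"] by (simp add: sum.lessThan_Suc_shift del: sum.lessThan_Suc)
qed simp

lemma energy_energy_rec:
  assumes "letters_le l x" shows "energy l x = energy_rec l [] x"
proof -
  have "(\<Sum>i\<in>{1..<j}. H l (shifted l x i j ! (i - 1)) (shifted l x i j ! i)) =
      slide l (rev (take (j - 1) x)) (x ! (j - 1))" if j: "j \<in> {1..length x}" for j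
  proof -
    obtain j' where j': "j = Suc j'" using j by (cases j) auto
    show ?thesis using slide_eq[OF assms, of j j'] j by (simp add: j')
  qed
  then have "energy l x = (\<Sum>j\<in>{1..length x}. slide l (rev (take (j - 1) x)) (x ! (j - 1)))"
    unfolding energy_shifted[OF assms] by (intro sum.cong) auto
  also have "\<dots> = (\<Sum>j<length x. slide l (rev (take j x)) (x ! j))"
    by (rule sum.reindex_bij_witness[of _ Suc "\<lambda>j. j - 1"]) auto
  finally show ?thesis using energy_rec_eq[of l "[]" x] by simp
qed

text \<open>Empty and full columns are trivial as crystals, so they pass through all other columns.\<close>

definition trivial_column :: "nat \<Rightarrow> nat set \<Rightarrow> bool" where
  "trivial_column l u \<longleftrightarrow> u \<subseteq> {1..l} \<and>
     (\<forall>d\<subseteq>{1..l}. R2 l u d = [d, u] \<and> R2 l d u = [u, d] \<and> H l u d = 0 \<and> H l d u = 0)"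

text \<open>The exchange of sizes determines the image of the empty or full column; union and
  intersection then determine the other one.\<close>

lemma R2_swap:
  assumes "d \<subseteq> {1..l}" "d' \<subseteq> {1..l}" "d \<subseteq> d' \<or> d' \<subseteq> d" "d = {} \<or> d = {1..l} \<or> d' = {} \<or> d' = {1..l}"
  shows "R2 l d d' = [d', d]"
proof -
  note r = reflects_R2[OF assms(1,2)]
  obtain e e' where e: "R2 l d d' = [e, e']" using r by (auto simp: reflects_def length_Suc_conv)
  have s: "e \<subseteq> {1..l}" "e' \<subseteq> {1..l}" using r by (auto simp: reflects_def e letters_le_def)
  then have f: "finite e" "finite e'" using finite_subset by blast+
  have c: "card e = card d'" "card e' = card d" using reflects_props(1,2)[OF r] by (simp_all add: e)
  have u: "d \<union> d' = e \<union> e'" "d \<inter> d' = e \<inter> e'" using reflects_props(4,5)[OF r] by (simp_all add: e)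
  have full: "v = {1..l}" if "card v = card {1..l}" "v \<subseteq> {1..l}" for v
    using that by (intro card_subset_eq) auto
  from assms(4) show ?thesis
  proof (elim disjE)
    assume "d = {}"
    then have "e' = {}" using c f by simp
    then show ?thesis using u e \<open>d = {}\<close> by simp
  next
    assume "d = {1..l}"
    then have "e' = {1..l}" using c s full by metis
    then show ?thesis using u e s assms(2) \<open>d = {1..l}\<close> by (metis inf.absorb_iff1 inf.absorb_iff2 inf_commute)
  next
    assume "d' = {}"
    then have "e = {}" using c f by simp
    then show ?thesis using u e \<open>d' = {}\<close> by simp
  next
    assume "d' = {1..l}"
    then have "e = {1..l}" using c s full by metis
    then show ?thesis using u e s assms(1) \<open>d' = {1..l}\<close> by (metis inf.absorb_iff1 inf.absorb_iff2 inf_commute)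
  qed
qed

lemma card_Int_complement:
  "card (d \<inter> {1..i}) \<le> i" "i \<le> l \<Longrightarrow> d \<subseteq> {1..l} \<Longrightarrow> i + card d \<le> l + card (d \<inter> {1..i})"
proof -
  show "card (d \<inter> {1..i}) \<le> i" using card_mono[of "{1..i}" "d \<inter> {1..i}"] by simp
  assume i: "i \<le> l" "d \<subseteq> {1..l}"
  have "d \<subseteq> (d \<inter> {1..i}) \<union> {i + 1..l}" using i by auto
  then have "card d \<le> card ((d \<inter> {1..i}) \<union> {i + 1..l})" by (intro card_mono) auto
  also have "\<dots> \<le> card (d \<inter> {1..i}) + card {i + 1..l}" by (rule card_Un_le)
  finally show "i + card d \<le> l + card (d \<inter> {1..i})" using i by simp
qed

lemma trivial_empty: "trivial_column l {}"
proof -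
  have "H l {} d = 0" "H l d {} = 0" if d: "d \<subseteq> {1..l}" for d
  proof -
    have f: "finite d" using d finite_subset by blast
    have "mx (ch (mem [{}, d]) 0) l \<le> 0" by (simp add: mx_le_iff ch_card)
    then show "H l {} d = 0" using H_eq[of "{}" l d] d by simp
    have "mx (ch (mem [d, {}]) 0) l \<le> int (card d)" using f by (auto simp: mx_le_iff ch_card intro: card_mono)
    then show "H l d {} = 0" using H_eq[of d l "{}"] d by simp
  qed
  then show ?thesis unfolding trivial_column_def using R2_swap by auto
qed

lemma trivial_full: "trivial_column l {1..l}"
proof -
  have i: "{1..l} \<inter> {1..i} = {1..i}" if "i \<le> l" for i using that by auto
  have "H l {1..l} d = 0" "H l d {1..l} = 0" if d: "d \<subseteq> {1..l}" for d
  proof -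
    have c: "card d \<le> l" using card_mono[OF _ d] by simp
    have "int i - int (card (d \<inter> {1..i})) \<le> int l - int (card d)" if "i \<le> l" for i
      using card_Int_complement(2)[OF that d] by linarith
    then have "mx (ch (mem [{1..l}, d]) 0) l \<le> int l - int (card d)"
      by (auto simp: mx_le_iff ch_card i)
    then show "H l {1..l} d = 0" using H_eq[of "{1..l}" l d] d c by simp
    have "mx (ch (mem [d, {1..l}]) 0) l \<le> 0"
      using card_Int_complement(1)[of d] by (auto simp: mx_le_iff ch_card i)
    then show "H l d {1..l} = 0" using H_eq[of d l "{1..l}"] d by simp
  qed
  then show ?thesis unfolding trivial_column_def using R2_swap[of _ l "{1..l}"] R2_swap[of "{1..l}" l] by auto
qed

lemma R2_subset:
  assumes "d \<subseteq> {1..l}" "d' \<subseteq> {1..l}" shows "hd (R2 l d d') \<subseteq> {1..l}"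
proof -
  note r = reflects_R2[OF assms]
  obtain e e' where e: "R2 l d d' = [e, e']" using r by (auto simp: reflects_def length_Suc_conv)
  then show ?thesis using r by (auto simp: reflects_def letters_le_def)
qed

lemma letters_le_Cons [simp]: "letters_le l (d # x) \<longleftrightarrow> d \<subseteq> {1..l} \<and> letters_le l x"
  and letters_le_append [simp]: "letters_le l (x @ y) \<longleftrightarrow> letters_le l x \<and> letters_le l y"
  and letters_le_Nil [simp]: "letters_le l []"
  by (auto simp: letters_le_def)

lemma slide_trivial: "trivial_column l u \<Longrightarrow> letters_le l us \<Longrightarrow> slide l us u = 0"
  by (induction us) (auto simp: trivial_column_def)

lemma slide_remove:
  "trivial_column l u \<Longrightarrow> letters_le l us \<Longrightarrow> d \<subseteq> {1..l} \<Longrightarrow> slide l (us @ u # vs) d = slide l (us @ vs) d"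
proof (induction us arbitrary: d)
  case Nil
  then show ?case by (auto simp: trivial_column_def)
next
  case (Cons c us)
  then show ?case using R2_subset[of c l d] by simp
qed

lemma energy_rec_remove:
  "trivial_column l u \<Longrightarrow> letters_le l us \<Longrightarrow> letters_le l ds \<Longrightarrow> energy_rec l (us @ u # vs) ds = energy_rec l (us @ vs) ds"
proof (induction ds arbitrary: us)
  case (Cons d ds)
  then show ?case using slide_remove[OF Cons.prems(1,2)] Cons.IH[of "d # us"] by simp
qed simp

lemma energy_rec_insert:
  "trivial_column l u \<Longrightarrow> letters_le l acc \<Longrightarrow> letters_le l xs \<Longrightarrow> letters_le l ys \<Longrightarrow>
    energy_rec l acc (xs @ u # ys) = energy_rec l acc (xs @ ys)"
proof (induction xs arbitrary: acc)
  case Nil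
  then show ?case using slide_trivial energy_rec_remove[of l u "[]" ys acc] by simp
qed simp

lemma energy_insert:
  assumes "trivial_column l u" "letters_le l xs" "letters_le l ys"
  shows "energy l (xs @ u # ys) = energy l (xs @ ys)"
  using energy_rec_insert[OF assms(1) _ assms(2,3), of "[]"] assms
  by (simp add: energy_energy_rec trivial_column_def)

lemma energy_trivial:
  assumes "\<forall>d\<in>set x. trivial_column l d" shows "energy l x = 0"
  using assms
proof (induction x)
  case Nil
  then show ?case using energy_energy_rec[of l "[]"] by simp
next
  case (Cons d x)
  then have "letters_le l x" by (auto simp: letters_le_def trivial_column_def)
  then show ?case using Cons energy_insert[of l d "[]" x] by simp
qed

section \<open>Enlarging the alphabet\<close>

lemma cstep_mono:
  assumes "cstep l p x y" shows "cstep (Suc l) p x y"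
proof -
  obtain i where i: "is_last (ch (mem x) p) l i" "i < l" and g: "letters_le l x" "Suc p < length x"
    and y: "y = x[p := insert (Suc i) (x ! p), Suc p := x ! Suc p - {Suc i}]"
    using assms by (auto simp: cstep_def)
  have "Suc l \<notin> x ! p" "Suc l \<notin> x ! Suc p" using letters_le_nth[OF g(1), of p] letters_le_nth[OF g] g(2) by auto
  \<comment> \<open>The absent letter adds a zero step at the end, where the height is below the
    last maximum because \<open>i < l\<close>.\<close>
  then have "ch (mem x) p (Suc l) = ch (mem x) p l" by (simp add: ch_Suc mem_def)
  then have "is_last (ch (mem x) p) (Suc l) i" using i by (auto simp: is_last_def le_Suc_eq)
  moreover have "letters_le (Suc l) x" using g(1) by (force simp: letters_le_def)
  ultimately show ?thesis using g(2) i(2) y less_SucI unfolding cstep_def by blast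
qed

lemma reflects_mono:
  assumes "reflects l p x y" shows "reflects (Suc l) p x y"
proof -
  have "(cstep (Suc l) p ^^ r) a c" if "(cstep l p ^^ r) a c" for r a c
    using that by (induction r arbitrary: c) (auto dest: cstep_mono)
  moreover have "letters_le (Suc l) x" if "letters_le l x" for x using that by (force simp: letters_le_def)
  ultimately show ?thesis using assms unfolding reflects_def by auto
qed

lemma R2_mono: "d \<subseteq> {1..l} \<Longrightarrow> d' \<subseteq> {1..l} \<Longrightarrow> R2 (Suc l) d d' = R2 l d d'"
  using R2_eq[OF reflects_mono[OF reflects_R2]] by simp

lemma H_mono: "d \<subseteq> {1..l} \<Longrightarrow> d' \<subseteq> {1..l} \<Longrightarrow> H (Suc l) d d' = H l d d'"
  by (simp add: H_def R2_mono)

lemma slide_mono: "letters_le l us \<Longrightarrow> d \<subseteq> {1..l} \<Longrightarrow> slide (Suc l) us d = slide l us d"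
proof (induction us arbitrary: d)
  case (Cons c us)
  then show ?case using R2_subset[of c l d] by (simp add: H_mono R2_mono)
qed simp

lemma energy_mono:
  assumes "letters_le l x" shows "energy (Suc l) x = energy l x"
proof -
  have "energy_rec (Suc l) acc x = energy_rec l acc x" if "letters_le l acc" for acc
    using that assms by (induction x arbitrary: acc) (simp_all add: slide_mono)
  moreover have "letters_le (Suc l) x" using assms by (force simp: letters_le_def)
  ultimately show ?thesis using assms by (simp add: energy_energy_rec)
qed

text \<open>In the alphabet {1} every column is empty or full, hence trivial; larger alphabets
  follow by \<open>energy_mono\<close>. This is the base case of a tableau with a single
  column.\<close>

lemma energy_one:
  assumes "letters_le 1 x" "1 \<le> l" shows "energy l x = 0"
  using assms(2)
proof (induction l rule: dec_induct)
  case base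
  have "d = {} \<or> d = {1..1}" if "d \<in> set x" for d using assms(1) that by (auto simp: letters_le_def)
  then have "\<forall>d\<in>set x. trivial_column 1 d" using trivial_empty trivial_full by metis
  then show ?case by (rule energy_trivial)
next
  case (step l)
  have "letters_le l x" using assms(1) step.hyps by (force simp: letters_le_def)
  then show ?case using step.IH energy_mono by simp
qed

section \<open>The energy under reduction\<close>

lemma mem_red:
  assumes "k0 = (LEAST k. in_every_column k b)" "q < length b" "1 \<le> k"
  shows "k \<in> red b ! q \<longleftrightarrow> (if k < k0 then k \<in> b ! q else Suc k \<in> b ! q)"
proof -
  have "red b ! q = (\<lambda>k. if k > k0 then k - 1 else k) ` (b ! q - {k0})"
    using assms(1,2) by (simp add: red_def Let_def)
  then show ?thesis using assms(3)
    by (auto simp: image_iff split: if_splits intro!: bexI[of _ k] bexI[of _ "Suc k"])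
qed

lemma length_red [simp]: "length (red b) = length b"
  by (simp add: red_def Let_def)

lemma letters_le_red:
  assumes "letters_le n b" "in_every_column k b" "b \<noteq> []"
  shows "letters_le n (red b)" "(LEAST k. in_every_column k b) \<in> {1..n}"
    "sum_list (map card (red b)) < sum_list (map card b)"
proof -
  define k0 where "k0 = (LEAST k. in_every_column k b)"
  have k0: "in_every_column k0 b" unfolding k0_def using assms(2) by (rule LeastI)
  have "hd b \<in> set b" using assms(3) by simp
  then have "k0 \<in> hd b" "hd b \<subseteq> {1..n}" using k0 assms(1) by (auto simp: in_every_column_def letters_le_def)
  then have k0n: "k0 \<in> {1..n}" by blast
  then show "(LEAST k. in_every_column k b) \<in> {1..n}" by (simp add: k0_def)
  show "letters_le n (red b)"
    unfolding letters_le_def red_def Let_def k0_def[symmetric]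
    using assms(1) k0n by (fastforce simp: letters_le_def split: if_splits)
  have "card ((\<lambda>k. if k > k0 then k - 1 else k) ` (c - {k0})) < card c" if "c \<in> set b" for c
  proof -
    have f: "finite c" using letters_le_finite[OF assms(1)] that by blast
    have "card ((\<lambda>k. if k > k0 then k - 1 else k) ` (c - {k0})) \<le> card (c - {k0})"
      using f by (intro card_image_le) simp
    also have "\<dots> < card c" using f k0 that by (intro card_Diff1_less) (auto simp: in_every_column_def)
    finally show ?thesis .
  qed
  then show "sum_list (map card (red b)) < sum_list (map card b)"
    unfolding red_def Let_def k0_def[symmetric] map_map o_def
    using assms(3) by (intro sum_list_strict_mono) auto
qed

text \<open>A letter in every column is a full factor of the dual. As \<open>n\<close> stays fixed,
  its removal shifts the later factors and leaves an empty one at the end; both are trivial.\<close>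

lemma energy_red:
  assumes g: "letters_le n b" and k: "in_every_column k b" and "b \<noteq> []"
  shows "energy (length b) (dual n (red b)) = energy (length b) (dual n b)"
proof -
  define k0 where "k0 = (LEAST k. in_every_column k b)"
  have k0: "in_every_column k0 b" unfolding k0_def using k by (rule LeastI)
  have k0n: "k0 \<in> {1..n}" using letters_le_red(2)[OF assms] by (simp add: k0_def)
  then obtain a where a: "k0 = Suc a" "a < n" by (cases k0) auto
  let ?l = "length b" and ?x = "dual n b"
  have full: "?x ! a = {1..?l}"
  proof -
    have "Suc a \<in> b ! (?l - j)" if "j \<in> {1..?l}" for j
      using k0 that unfolding in_every_column_def a(1) by (intro bspec[OF _ nth_mem]) auto
    then show ?thesis unfolding dual_nth[OF a(2)] by blast
  qed
  have x: "?x = take a ?x @ {1..?l} # drop (Suc a) ?x"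
    using id_take_nth_drop[of a ?x] a full by simp
  have gx: "letters_le ?l (take a ?x)" "letters_le ?l (drop (Suc a) ?x)"
    using letters_le_dual[of b n] by (auto simp: letters_le_def dest: in_set_takeD in_set_dropD)
  have "dual n (red b) = (take a ?x @ drop (Suc a) ?x) @ [{}]"
  proof (rule nth_equalityI)
    show "length (dual n (red b)) = length ((take a ?x @ drop (Suc a) ?x) @ [{}])" using a by simp
    fix i assume "i < length (dual n (red b))"
    then have i: "i < n" by simp
    have r: "dual n (red b) ! i =
      {j \<in> {1..?l}. if Suc i < k0 then Suc i \<in> b ! (?l - j) else Suc (Suc i) \<in> b ! (?l - j)}"
      using i mem_red[OF k0_def] by (auto simp: dual_nth)
    consider "i < a" | "a \<le> i" "Suc i < n" | "a \<le> i" "Suc i = n" using i by linarith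
    then show "dual n (red b) ! i = ((take a ?x @ drop (Suc a) ?x) @ [{}]) ! i"
    proof cases
      case 1
      then show ?thesis using a i by (simp add: r nth_append dual_nth)
    next
      case 2
      then have "i - a < n - Suc a" "Suc a + (i - a) = Suc i" by linarith+
      then show ?thesis using 2 a i by (simp add: r nth_append dual_nth)
    next
      case 3
      have "Suc (Suc i) \<notin> b ! (?l - j)" if "j \<in> {1..?l}" for j
      proof -
        have "?l - j < ?l" using that by auto
        from letters_le_nth[OF g this] show ?thesis using 3(2) by auto
      qed
      then have e: "dual n (red b) ! i = {}" using 3 a by (auto simp: r)
      have "\<not> i - a < n - Suc a" "i - a - (n - Suc a) = 0" "\<not> i < a" using 3 a by linarith+
      then show ?thesis using 3 a e by (simp add: nth_append)
    qed
  qed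
  then have "energy ?l (dual n (red b)) = energy ?l (take a ?x @ drop (Suc a) ?x)"
    using energy_insert[OF trivial_empty, of ?l "take a ?x @ drop (Suc a) ?x" "[]"] gx by simp
  also have "\<dots> = energy ?l ?x"
    using energy_insert[OF trivial_full gx] x by simp
  finally show ?thesis .
qed

section \<open>Charge\<close>

text \<open>If \<open>1\<close> is missing from the head, it occurs fewer than
  \<open>length b\<close> times, and by dominance so does every other letter. Condition (b) excludes
  full letters outright.\<close>

lemma authorised_no_full:
  assumes "authorised b" "b \<noteq> []" "1 \<le> k" shows "\<not> in_every_column k b"
proof
  assume k: "in_every_column k b"
  then have a: "dominant_evaluation b" "1 \<notin> hd b" using assms(1) by (auto simp: authorised_def)
  have "mult k b \<le> mult 1 b"
    using assms(3)
  proof (induction k rule: dec_induct)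
    case (step k)
    then show ?case using a(1) by (force simp: dominant_evaluation_def)
  qed simp
  moreover have "mult k b = length b" using k by (simp add: mult_def in_every_column_def)
  moreover have "mult 1 b < length b"
    using a(2) assms(2) unfolding mult_def by (intro length_filter_less[of "hd b"]) auto
  ultimately show False by simp
qed

text \<open>Labels count from the end of the list, so a new head leaves the others unchanged, and an
  empty one adds its own label to no factor.\<close>

lemma dual_drop: "dual n ({} # b) = dual n b"
proof (rule nth_equalityI)
  fix i assume "i < length (dual n ({} # b))"
  then have i: "i < n" by simp
  have "j \<in> dual n ({} # b) ! i \<longleftrightarrow> j \<in> dual n b ! i" for j
  proof (cases "j \<in> {1..length b}")
    case True
    then have "length ({} # b) - j = Suc (length b - j)" by auto
    then show ?thesis using True i by (simp add: dual_nth)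
  next
    case False
    then have "j = 0 \<or> j = Suc (length b) \<or> j > Suc (length b)" by auto
    then show ?thesis using i by (auto simp: dual_nth)
  qed
  then show "dual n ({} # b) ! i = dual n b ! i" by blast
qed simp

lemma P_props:
  assumes "1 \<le> n" "letters_le n b"
  shows "letters_le n (P n b)" "length (P n b) = length b" "is_tableau (P n b)"
    "sum_list (map card (P n b)) = sum_list (map card b)"
    "energy (length b) (dual n (P n b)) = energy (length b) (dual n b)"
proof -
  have b: "b \<in> tensors n (length b) (sum_list (map card b))" using assms(2) by (simp add: tensors_iff)
  obtain t where t: "(up n)\<^sup>*\<^sup>* b t" "is_tableau t" using up_star_tableau[OF b] by blast
  have P: "P n b = t" by (rule P_eq[OF assms(1) b t])
  show "letters_le n (P n b)" "length (P n b) = length b" "is_tableau (P n b)"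
    "sum_list (map card (P n b)) = sum_list (map card b)"
    "energy (length b) (dual n (P n b)) = energy (length b) (dual n b)"
    unfolding P using up_star_tensors[OF t(1) b] t energy_up_star[OF t(1)] by (auto simp: tensors_iff)
qed

lemma letters_le_cyclage: "letters_le n b \<Longrightarrow> b \<noteq> [] \<Longrightarrow> letters_le n (cyclage b)"
  by (cases b) (auto simp: cyclage_def)

text \<open>Each rule keeps this equation. As the right-hand side depends on \<open>b\<close> and
  \<open>n\<close> alone, the charge is unique.\<close>

lemma charge_rel_energy:
  assumes "charge_rel n b m" "1 \<le> n" "letters_le n b" "b \<noteq> []"
  shows "m = energy (length b) (dual n b)"
  using assms(1,3,4)
proof (induction rule: charge_rel.induct)
  case (column b)
  have "dual n b ! i \<subseteq> {1..1}" if i: "i < n" for i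
  proof
    fix j assume "j \<in> dual n b ! i"
    then have "j \<in> {1..length b}" "col b j \<noteq> {}" using i by (auto simp: dual_nth col_def)
    then show "j \<in> {1..1}" using column(2) by (cases "j = 1") auto
  qed
  then have "letters_le 1 (dual n b)" by (fastforce simp: letters_le_def in_set_conv_nth)
  then show ?case using energy_one[of "dual n b" "length b"] column.prems by (simp add: Suc_leI)
next
  case (red b m)
  then obtain k where k: "in_every_column k b" by blast
  have "red b \<noteq> []" using red.prems by (metis length_red length_0_conv)
  then show ?case using red.IH letters_le_red(1)[OF _ k] energy_red[OF _ k] red.prems by simp
next
  case (cyclage b m)
  have l: "length (cyclage b) = length b" "cyclage b \<noteq> []"
    using cyclage.prems by (simp_all add: cyclage_def)
  show ?case
    using cyclage.IH letters_le_cyclage l cyclage.prems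
      energy_cyclage[OF _ cyclage.hyps(1), of n] authorised_no_full[OF cyclage.hyps(2)] by simp
next
  case (P b m)
  have "P n b \<noteq> []" using P_props(2)[OF assms(2) P.prems(1)] P.prems(2) by (metis length_0_conv)
  then show ?case using P.IH P_props[OF assms(2) P.prems(1)] by simp
next
  case (drop b m)
  then show ?case using energy_mono[OF letters_le_dual, of b n] by (simp add: dual_drop)
qed

lemma charge_rel_exists:
  assumes n: "1 \<le> n" and "letters_le n b" "b \<noteq> []"
  shows "\<exists>m. charge_rel n b m"
  using assms(2,3)
\<comment> \<open>Applying \<open>P\<close> keeps all three entries. On the resulting tableau,
  \<open>drop\<close> shortens the list, reduction removes letters, and a cyclage keeps length and
  number of letters but lowers the energy.\<close>
proof (induction "(length b, sum_list (map card b), energy (length b) (dual n b))" arbitrary: b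
    rule: wf_induct_rule[OF wf_lex_prod[OF wf_less_than wf_lex_prod[OF wf_less_than wf_less_than]]])
  case (1 b)
  let ?t = "P n b"
  note t = P_props[OF n 1(2)]
  have tn: "?t \<noteq> []" using t(2) 1(3) by (metis length_0_conv)
  have IH: "\<exists>m. charge_rel n x m" if "letters_le n x" "x \<noteq> []"
    "length x < length ?t \<or> length x = length ?t \<and> (sum_list (map card x) < sum_list (map card ?t) \<or>
      sum_list (map card x) = sum_list (map card ?t) \<and>
      energy (length x) (dual n x) < energy (length ?t) (dual n ?t))" for x
    using 1(1)[OF _ that(1,2)] that(3) t by auto
  have "\<exists>m. charge_rel n ?t m"
  proof (cases "\<forall>j\<in>{2..length ?t}. col ?t j = {}")
    case True
    then show ?thesis using charge_rel.column t(3) by blast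
  next
    case False
    obtain c x where x: "?t = c # x" using tn by (cases ?t) auto
    have xn: "x \<noteq> []" using False x by auto
    show ?thesis
    \<comment> \<open>An empty head has to be dropped before any cyclage, which would lower the
      energy by \<open>card c = 0\<close>.\<close>
    proof (cases "c = {}")
      case True
      have "\<exists>m. charge_rel n x m" using t(1) x xn by (intro IH) auto
      then show ?thesis using charge_rel.drop[of x n] t(3) x xn True by auto
    next
      case c: False
      show ?thesis
      proof (cases "\<exists>k. in_every_column k ?t")
        case True
        then obtain k where k: "in_every_column k ?t" by blast
        have "red ?t \<noteq> []" using tn by (metis length_red length_0_conv)
        then have "\<exists>m. charge_rel n (red ?t) m"
          using letters_le_red[OF t(1) k tn] by (intro IH) auto
        then show ?thesis using charge_rel.red[OF t(3) True] by blast
      next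
        case no: False
        have "card c > 0" using c t(1) x letters_le_finite[OF t(1)] by (simp add: card_gt_0_iff)
        moreover have "energy (length ?t) (dual n ?t) = energy (length ?t) (dual n (cyclage ?t)) + card (hd ?t)"
          using no by (intro energy_cyclage[OF t(1,3) tn]) blast
        ultimately have "\<exists>m. charge_rel n (cyclage ?t) m"
          using letters_le_cyclage[OF t(1) tn] x by (intro IH) (auto simp: cyclage_def)
        moreover have "authorised ?t" using no t(3) by (simp add: authorised_def)
        ultimately show ?thesis using charge_rel.cyclage[OF t(3)] by blast
      qed
    qed
  qed
  then show ?case using charge_rel.P by blast
qed

theorem theorem2p51:
  fixes n l s :: nat and b :: tensor
  assumes "n \<ge> 1" and "l \<ge> 2"
    and "b \<in> tensors n l s"
  shows "charge n b = energy l (dual n b)"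
proof -
  have b: "letters_le n b" "length b = l" "b \<noteq> []" using assms by (auto simp: tensors_iff)
  obtain m where m: "charge_rel n b m" using charge_rel_exists[OF assms(1) b(1,3)] by blast
  have "charge n b = m"
    unfolding charge_def using m charge_rel_energy[OF _ assms(1) b(1,3)] by (intro the_equality) metis+
  then show ?thesis using charge_rel_energy[OF m assms(1) b(1,3)] b(2) by simp
qed

end
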